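(* Fix $N\ge 1$, $\Lambda\ge 1$, $\beta\in(0,1]$ and $\alpha=1-\beta$. There exist $\varepsilon_0>0$ and a non-decreasing function $\varphi:(0,1]\to(0,1)$, depending only on $N,\Lambda,\alpha,\beta$, such that for every admissible family $\nu$, every $0<\varepsilon<\varepsilon_0$, every Borel set $A\subset Q_1$ with $|A|>0$ and every $x\in Q_1$, $$\mathbb{P}^x\big(T_A<\tau_{Q_{10\sqrt N}}\big)>\varphi(|A|).$$
   Context: $Q_r=\{y\in\mathbb{R}^N:|y_i|<r/2,\ i=1,\dots,N\}$ is the open cube of side $r$ centered at $0$; $B_r(x)$ is the open ball, $B_r=B_r(0)$; $|E|$ is Lebesgue measure. Let $\mathcal{M}(B_\Lambda)$ be the set of Radon probability measures on $\mathbb{R}^N$ with support in $B_\Lambda$ that are symmetric ($\nu(E)=\nu(-E)$ for all measurable $E$). An admissible family is a map $\nu:\mathbb{R}^N\to\mathcal{M}(B_\Lambda)$, $x\mapsto\nu_x$, such that $x\mapsto\int u(x+z)\,d\nu_x(z)$ is Borel measurable for every Borel measurable $u$ (for which these integrals are defined). Given $\nu$ and $\varepsilon>0$, $\mathbb{P}^{x}$ denotes the law of the Markov chain $(X_k)_{k\ge0}$ in $\mathbb{R}^N$ with $X_0=x$ and transition probabilities $$\mathbb{P}(X_{k+1}\in E\mid X_0,\dots,X_k)=\alpha\,\nu_{X_k}\Big(\frac{E-X_k}{\varepsilon}\Big)+\beta\frac{|E\cap B_\varepsilon(X_k)|}{|B_\varepsilon|}$$ for Borel $E$. Hitting and exit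 times: $T_A=\min\{k\ge0:X_k\in A\}$, $\tau_A=\min\{k\ge0:X_k\notin A\}$ (with $\min\emptyset=+\infty$). *)

theory Defs
  imports "HOL-Probability.Probability"
begin

definition cube :: "real \<Rightarrow> (real ^ 'n) set" where
  "cube r = {y. \<forall>i. \<bar>y $ i\<bar> < r / 2}"

definition measure_support :: "'a::topological_space measure \<Rightarrow> 'a set" where
  "measure_support \<mu> = {z. \<forall>U. open U \<longrightarrow> z \<in> U \<longrightarrow> 0 < emeasure \<mu> U}"

(* Every Borel probability measure on R^N is Radon, so no separate regularity condition is needed. *)
definition symmetric_measures :: "real \<Rightarrow> (real ^ 'n) measure set" where
  "symmetric_measures L = {\<mu>. prob_space \<mu> \<and> sets \<mu> = sets borel
     \<and> measure_support \<mu> \<subseteq> ball 0 L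
     \<and> (\<forall>E\<in>sets borel. emeasure \<mu> E = emeasure \<mu> (uminus ` E))}"

(* Measurability is required only of those u for which all the integrals exist; in particular
   of all bounded Borel u. *)
definition admissible :: "real \<Rightarrow> (real ^ 'n \<Rightarrow> (real ^ 'n) measure) \<Rightarrow> bool" where
  "admissible L \<nu> \<longleftrightarrow> (\<forall>x. \<nu> x \<in> symmetric_measures L)
     \<and> (\<forall>u :: real ^ 'n \<Rightarrow> real. u \<in> borel_measurable borel
          \<longrightarrow> (\<forall>x. integrable (\<nu> x) (\<lambda>z. u (x + z)))
          \<longrightarrow> (\<lambda>x. \<integral>z. u (x + z) \<partial>\<nu> x) \<in> borel_measurable borel)"

definition transition_prob ::
  "real \<Rightarrow> real \<Rightarrow> real \<Rightarrow> (real ^ 'n \<Rightarrow> (real ^ 'n) measure) \<Rightarrow> real ^ 'n \<Rightarrow> (real ^ 'n) set \<Rightarrow> real" where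
  "transition_prob \<alpha> \<beta> \<epsilon> \<nu> y E =
     \<alpha> * measure (\<nu> y) ((\<lambda>z. (1 / \<epsilon>) *\<^sub>R (z - y)) ` E)
     + \<beta> * (measure lborel (E \<inter> ball y \<epsilon>) / measure lborel (ball (0 :: real ^ 'n) \<epsilon>))"

abbreviation path_space :: "(nat \<Rightarrow> real ^ 'n) measure" where
  "path_space \<equiv> PiM UNIV (\<lambda>_. borel)"

(* The sigma-algebra generated by X_0, ..., X_k, where X_j is the j-th coordinate. *)
definition past :: "nat \<Rightarrow> (nat \<Rightarrow> real ^ 'n) measure" where
  "past k = vimage_algebra UNIV (\<lambda>\<omega>. restrict \<omega> {..k}) (PiM {..k} (\<lambda>_. borel))"

(* P is the law, on path space, of the chain started at x. Existence of such a P for every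
   admissible family is chain_law_exists below. *)
definition chain_law ::
  "real \<Rightarrow> real \<Rightarrow> real \<Rightarrow> (real ^ 'n \<Rightarrow> (real ^ 'n) measure) \<Rightarrow> real ^ 'n
     \<Rightarrow> (nat \<Rightarrow> real ^ 'n) measure \<Rightarrow> bool" where
  "chain_law \<alpha> \<beta> \<epsilon> \<nu> x P \<longleftrightarrow> prob_space P \<and> sets P = sets path_space
     \<and> (AE \<omega> in P. \<omega> 0 = x)
     \<and> (\<forall>k. \<forall>E\<in>sets borel. AE \<omega> in P.
          real_cond_exp P (past k) (indicator {\<omega>. \<omega> (Suc k) \<in> E}) \<omega>
            = transition_prob \<alpha> \<beta> \<epsilon> \<nu> (\<omega> k) E)"

(* The infimum of the empty set in enat is infinity. *)
definition hitting_time :: "'a set \<Rightarrow> (nat \<Rightarrow> 'a) \<Rightarrow> enat" where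
  "hitting_time A \<omega> = Inf (enat ` {k. \<omega> k \<in> A})"

definition exit_time :: "'a set \<Rightarrow> (nat \<Rightarrow> 'a) \<Rightarrow> enat" where
  "exit_time A \<omega> = Inf (enat ` {k. \<omega> k \<notin> A})"

lemma transition_kernel_exists:
  fixes \<nu> :: "real ^ 'n \<Rightarrow> (real ^ 'n) measure"
  assumes adm: "admissible L \<nu>" and \<beta>: "0 \<le> \<beta>" "\<beta> \<le> 1" "\<alpha> = 1 - \<beta>" and \<epsilon>: "0 < \<epsilon>"
  shows "\<exists>K. K \<in> borel \<rightarrow>\<^sub>M subprob_algebra borel \<and> (\<forall>y. prob_space (K y))
    \<and> (\<forall>y. \<forall>E\<in>sets borel. measure (K y) E = transition_prob \<alpha> \<beta> \<epsilon> \<nu> y E)"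
proof -
  have \<nu>: "prob_space (\<nu> y)" "sets (\<nu> y) = sets borel" for y
    using adm by (auto simp: admissible_def symmetric_measures_def)
  have sp: "space (\<nu> y) = UNIV" for y
    using sets_eq_imp_space_eq[OF \<nu>(2)] by simp
  note [measurable_cong] = \<nu>(2)
  define J where "J y = distr (\<nu> y) borel (\<lambda>z. y + z)" for y
  have J: "J \<in> borel \<rightarrow>\<^sub>M subprob_algebra borel"
  proof (rule measurable_subprob_algebra)
    fix y show "subprob_space (J y)"
      unfolding J_def
      by (intro prob_space_imp_subprob_space prob_space.prob_space_distr \<nu>) measurable
    show "sets (J y) = sets borel" by (simp add: J_def)
  next
    fix E :: "(real ^ 'n) set" assume E[measurable]: "E \<in> sets borel"
    let ?u = "indicator E :: real ^ 'n \<Rightarrow> real"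
    have int: "integrable (\<nu> x) (\<lambda>z. ?u (x + z))" for x
    proof -
      interpret prob_space "\<nu> x" by (rule \<nu>)
      show ?thesis by (rule integrable_const_bound[where B=1]) (auto simp: indicator_def)
    qed
    have "(\<lambda>x. \<integral>z. ?u (x + z) \<partial>\<nu> x) \<in> borel_measurable borel"
      using adm int E unfolding admissible_def by (meson borel_measurable_indicator)
    moreover have "emeasure (J x) E = ennreal (\<integral>z. ?u (x + z) \<partial>\<nu> x)" for x
    proof -
      interpret prob_space "J x" unfolding J_def by (intro prob_space.prob_space_distr \<nu>) measurable
      have "measure (J x) E = (\<integral>z. ?u z \<partial>J x)" by (simp add: J_def)
      also have "\<dots> = (\<integral>z. ?u (x + z) \<partial>\<nu> x)"
        unfolding J_def by (rule integral_distr) auto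
      finally show ?thesis by (simp add: emeasure_eq_measure)
    qed
    ultimately show "(\<lambda>x. emeasure (J x) E) \<in> borel_measurable borel" by simp
  qed
  define N where "N y = distr (J y) borel (\<lambda>w. y + \<epsilon> *\<^sub>R (w - y))" for y
  have N: "N \<in> borel \<rightarrow>\<^sub>M subprob_algebra borel"
    unfolding N_def by (rule measurable_distr2[OF _ J]) measurable
  define U :: "real ^ 'n \<Rightarrow> (real ^ 'n) measure" where "U y = uniform_measure lborel (ball y \<epsilon>)" for y
  have ball_pos: "emeasure lborel (ball y \<epsilon>) \<noteq> 0" "emeasure lborel (ball y \<epsilon>) \<noteq> \<infinity>" for y :: "real ^ 'n"
  proof -
    show "emeasure lborel (ball y \<epsilon>) \<noteq> \<infinity>" using emeasure_bounded_finite[of "ball y \<epsilon>"] by auto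
    then show "emeasure lborel (ball y \<epsilon>) \<noteq> 0"
      using content_ball_pos[OF \<epsilon>, of y] by (auto simp: measure_def)
  qed
  have Uprob: "prob_space (U y)" for y
    unfolding U_def by (rule prob_space_uniform_measure) (use ball_pos in auto)
  have Uval: "emeasure (U y) E = emeasure lborel (E \<inter> ball y \<epsilon>) / emeasure lborel (ball (0 :: real ^ 'n) \<epsilon>)"
    if "E \<in> sets borel" for y E
  proof -
    have "measure lborel (ball y \<epsilon>) = measure lborel (ball (0 :: real ^ 'n) \<epsilon>)"
      using \<epsilon> by (simp add: content_ball)
    then have "emeasure lborel (ball y \<epsilon>) = emeasure lborel (ball (0 :: real ^ 'n) \<epsilon>)"
      using ball_pos by (simp add: emeasure_eq_ennreal_measure)
    then show ?thesis unfolding U_def using that by (simp add: Int_commute)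
  qed
  have U: "U \<in> borel \<rightarrow>\<^sub>M subprob_algebra borel"
  proof (rule measurable_subprob_algebra)
    fix y show "subprob_space (U y)" by (rule prob_space_imp_subprob_space[OF Uprob])
    show "sets (U y) = sets borel" by (simp add: U_def)
  next
    fix E :: "(real ^ 'n) set" assume E[measurable]: "E \<in> sets borel"
    have 1: "{p :: (real ^ 'n) \<times> (real ^ 'n). snd p \<in> E \<and> dist (fst p) (snd p) < \<epsilon>} \<in> sets (borel \<Otimes>\<^sub>M lborel)"
    proof -
      have "{p \<in> space (borel \<Otimes>\<^sub>M lborel). snd p \<in> E \<and> dist (fst p :: real ^ 'n) (snd p) < \<epsilon>} \<in> sets (borel \<Otimes>\<^sub>M lborel)"
        by measurable
      then show ?thesis by (simp add: space_pair_measure)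
    qed
    have "(\<lambda>y. emeasure lborel (Pair y -` {p. snd p \<in> E \<and> dist (fst p) (snd p) < \<epsilon>})) \<in> borel_measurable borel"
      by (rule lborel.measurable_emeasure_Pair[OF 1])
    moreover have "Pair y -` {p. snd p \<in> E \<and> dist (fst p) (snd p) < \<epsilon>} = E \<inter> ball y \<epsilon>" for y
      by auto
    ultimately have "(\<lambda>y. emeasure lborel (E \<inter> ball y \<epsilon>)) \<in> borel_measurable borel"
      by (simp only:)
    then show "(\<lambda>y. emeasure (U y) E) \<in> borel_measurable borel"
      by (simp add: Uval)
  qed
  define K where "K y = measure_pmf (bernoulli_pmf \<beta>) \<bind> (\<lambda>b. if b then U y else N y)" for y
  have Km: "K \<in> borel \<rightarrow>\<^sub>M subprob_algebra borel"
    unfolding K_def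
  proof (rule measurable_bind[where N="count_space UNIV"])
    show "(\<lambda>x. measure_pmf (bernoulli_pmf \<beta>)) \<in> borel \<rightarrow>\<^sub>M subprob_algebra (count_space UNIV)"
      by (rule measurable_const) (simp add: measure_pmf_in_subprob_algebra)
    show "(\<lambda>p. if snd p then U (fst p) else N (fst p)) \<in> borel \<Otimes>\<^sub>M count_space UNIV \<rightarrow>\<^sub>M subprob_algebra borel"
      using U N by measurable
  qed
  have Nprob: "prob_space (N y)" for y
    unfolding N_def J_def by (intro prob_space.prob_space_distr \<nu>) measurable
  have bm: "(\<lambda>b. if b then U y else N y) \<in> measure_pmf (bernoulli_pmf \<beta>) \<rightarrow>\<^sub>M subprob_algebra borel" for y
    using measurable_space[OF U, of y] measurable_space[OF N, of y] by auto
  have Kprob: "prob_space (K y)" for y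
    unfolding K_def
    by (rule prob_space.prob_space_bind[OF prob_space_measure_pmf _ bm]) (auto simp: Uprob Nprob)
  have "measure (K y) E = transition_prob \<alpha> \<beta> \<epsilon> \<nu> y E" if E[measurable]: "E \<in> sets borel" for y E
  proof -
    interpret \<nu>: prob_space "\<nu> y" by (rule \<nu>)
    have "N y = distr (\<nu> y) borel (\<lambda>z. y + \<epsilon> *\<^sub>R (y + z - y))"
      unfolding N_def J_def by (subst distr_distr) (auto simp: comp_def)
    also have "(\<lambda>z. y + \<epsilon> *\<^sub>R (y + z - y)) = (\<lambda>z. y + \<epsilon> *\<^sub>R z)" by simp
    finally have "emeasure (N y) E = emeasure (\<nu> y) ((\<lambda>z. y + \<epsilon> *\<^sub>R z) -` E)"
      by (simp add: emeasure_distr sp)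
    also have "(\<lambda>z. y + \<epsilon> *\<^sub>R z) -` E = (\<lambda>z. (1 / \<epsilon>) *\<^sub>R (z - y)) ` E"
    proof safe
      fix w assume "y + \<epsilon> *\<^sub>R w \<in> E"
      then show "w \<in> (\<lambda>z. (1 / \<epsilon>) *\<^sub>R (z - y)) ` E"
        using \<epsilon> by (intro image_eqI[where x="y + \<epsilon> *\<^sub>R w"]) auto
    qed (use \<epsilon> in simp)
    finally have Nval: "emeasure (N y) E = ennreal (measure (\<nu> y) ((\<lambda>z. (1 / \<epsilon>) *\<^sub>R (z - y)) ` E))"
      by (simp add: \<nu>.emeasure_eq_measure)
    have fin: "emeasure lborel (E \<inter> ball y \<epsilon>) \<noteq> \<infinity>"
      using emeasure_bounded_finite[of "E \<inter> ball y \<epsilon>"] bounded_subset[OF bounded_ball, of "E \<inter> ball y \<epsilon>" y \<epsilon>] by auto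
    have mix: "ennreal a * ennreal \<beta> + ennreal b * ennreal (1 - \<beta>) = ennreal ((1 - \<beta>) * b + \<beta> * a)"
      if "0 \<le> a" "0 \<le> b" for a b
      using that \<beta> by (simp add: ennreal_mult'' [symmetric] ennreal_plus[symmetric] ac_simps del: ennreal_plus)
    have "emeasure (U y) E = ennreal (measure lborel (E \<inter> ball y \<epsilon>) / measure lborel (ball (0 :: real ^ 'n) \<epsilon>))"
      unfolding Uval[OF E]
      using fin ball_pos(2)[of 0] content_ball_pos[OF \<epsilon>, of "0 :: real ^ 'n"]
      by (simp add: emeasure_eq_ennreal_measure divide_ennreal)
    moreover have "emeasure (K y) E = emeasure (U y) E * \<beta> + emeasure (N y) E * (1 - \<beta>)"
      unfolding K_def using \<beta> by (subst emeasure_bind[OF _ bm E]) simp_all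
    ultimately have "emeasure (K y) E = ennreal (transition_prob \<alpha> \<beta> \<epsilon> \<nu> y E)"
      unfolding transition_prob_def Nval using \<beta> mix by simp
    moreover have "0 \<le> transition_prob \<alpha> \<beta> \<epsilon> \<nu> y E"
      using \<beta> by (auto simp: transition_prob_def)
    ultimately show ?thesis by (simp add: measure_def)
  qed
  with Km Kprob show ?thesis by blast
qed

lemma chain_law_exists:
  fixes \<nu> :: "real ^ 'n \<Rightarrow> (real ^ 'n) measure"
  assumes adm: "admissible L \<nu>" and \<beta>: "0 \<le> \<beta>" "\<beta> \<le> 1" "\<alpha> = 1 - \<beta>" and \<epsilon>: "0 < \<epsilon>"
  shows "\<exists>P. chain_law \<alpha> \<beta> \<epsilon> \<nu> x P"
proof -
  obtain K where "K \<in> borel \<rightarrow>\<^sub>M subprob_algebra borel \<and> (\<forall>y. prob_space (K y))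
      \<and> (\<forall>y. \<forall>E\<in>sets borel. measure (K y) E = transition_prob \<alpha> \<beta> \<epsilon> \<nu> y E)"
    using transition_kernel_exists[OF adm \<beta> \<epsilon>] ..
  then have K[measurable]: "K \<in> borel \<rightarrow>\<^sub>M subprob_algebra borel"
    and Kprob: "prob_space (K y)"
    and Kval: "E \<in> sets borel \<Longrightarrow> measure (K y) E = transition_prob \<alpha> \<beta> \<epsilon> \<nu> y E" for y E
    by blast+
  let ?M = "\<lambda>_ :: nat. borel :: (real ^ 'n) measure"
  define S where "S i \<omega> = (case i of 0 \<Rightarrow> return borel x | Suc j \<Rightarrow> K (\<omega> j))" for i :: nat and \<omega>
  have Sm: "S i \<in> PiM {0..<i} ?M \<rightarrow>\<^sub>M subprob_algebra borel" for i
  proof (cases i)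
    case 0 then show ?thesis
      unfolding S_def by (simp add: space_subprob_algebra prob_space_return prob_space_imp_subprob_space)
  next
    case (Suc j)
    have "(\<lambda>\<omega>. \<omega> j) \<in> PiM {0..<i} ?M \<rightarrow>\<^sub>M borel" 
      by (rule measurable_component_singleton) (simp add: Suc)
    from measurable_compose[OF this K] show ?thesis unfolding S_def Suc by simp
  qed
  interpret IT: Ionescu_Tulcea S ?M
  proof (rule Ionescu_Tulcea.intro)
    show "prob_space (S i \<omega>)" for i \<omega>
      by (cases i) (simp_all add: S_def prob_space_return Kprob)
    show "S i \<in> PiM {0..<i} ?M \<rightarrow>\<^sub>M subprob_algebra borel" for i
      by (rule Sm)
  qed
  let ?P = "IT.PF.lim"
  have setsP: "sets ?P = sets (PiM UNIV ?M)" by simp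
  have spP: "space ?P = UNIV" "space (PiM UNIV ?M) = UNIV" by (simp_all add: space_PiM)
  have pc[measurable]: "(\<lambda>\<omega>. \<omega> k) \<in> measurable ?P borel" for k
    using measurable_component_singleton[of k UNIV ?M] measurable_cong_sets[OF setsP refl] by blast
  have Cn: "emeasure ?P {\<omega>. restrict \<omega> {0..<n} \<in> B} = emeasure (IT.C 0 n (\<lambda>_. undefined)) B"
    if B: "B \<in> sets (PiM {0..<n} ?M)" for n B
  proof -
    have "prod_emb UNIV ?M {0..<n} B = {\<omega>. restrict \<omega> {0..<n} \<in> B}"
      by (auto simp: prod_emb_def space_PiM)
    moreover have "emeasure ?P (prod_emb UNIV ?M {0..<n} B) = emeasure (IT.CI {0..<n}) B"
      by (rule IT.lim) (use B in auto)
    moreover have "IT.CI {0..<n} B = IT.C 0 n (\<lambda>_. undefined) (prod_emb {0..<n} ?M {0..<n} B)"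
      by (rule IT.emeasure_CI) (use B in auto)
    moreover have "prod_emb {0..<n} ?M {0..<n} B = B"
      using B by (rule prod_emb_id[OF sets.sets_into_space[THEN order_trans]]) (simp add: space_PiM)
    ultimately show ?thesis by simp
  qed
  have und: "(\<lambda>_. undefined) \<in> space (PiM {0..<0} ?M)" by (simp add: space_PiM)
  have Pprob: "prob_space ?P"
  proof (rule prob_spaceI)
    have "emeasure ?P (space ?P) = emeasure ?P {\<omega>. restrict \<omega> {0..<0} \<in> space (PiM {0..<0} ?M)}"
      by (simp add: spP space_PiM restrict_def)
    also have "\<dots> = emeasure (IT.C 0 0 (\<lambda>_. undefined)) (space (PiM {0..<0} ?M))"
      by (rule Cn) simp
    also have "\<dots> = 1"
      using prob_space.emeasure_space_1[OF IT.prob_space_C[OF und, of 0]] unfolding IT.space_C[OF und] by simp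
    finally show "emeasure ?P (space ?P) = 1" .
  qed
  interpret P: prob_space ?P by (rule Pprob)
  define D where "D n = distr ?P (PiM {0..<n} ?M) (\<lambda>\<omega>. restrict \<omega> {0..<n})" for n
  have rm[measurable]: "(\<lambda>\<omega>. restrict \<omega> {0..<n}) \<in> ?P \<rightarrow>\<^sub>M PiM {0..<n} ?M" for n
    by (rule measurable_restrict) (rule pc)
  have D: "D n = IT.C 0 n (\<lambda>_. undefined)" for n
  proof (rule measure_eqI)
    show "sets (D n) = sets (IT.C 0 n (\<lambda>_. undefined))"
      using IT.sets_C[OF und, of n] by (simp add: D_def)
    fix B assume "B \<in> sets (D n)"
    then have B: "B \<in> sets (PiM {0..<n} ?M)" by (simp add: D_def)
    then show "emeasure (D n) B = emeasure (IT.C 0 n (\<lambda>_. undefined)) B"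
      unfolding D_def by (subst emeasure_distr) (auto simp: spP vimage_def Cn)
  qed
  have step: "emeasure ?P ({\<omega>. restrict \<omega> {0..<n} \<in> B} \<inter> {\<omega>. \<omega> n \<in> E})
      = (\<integral>\<^sup>+\<omega>. indicator B (restrict \<omega> {0..<n}) * emeasure (S n (restrict \<omega> {0..<n})) E \<partial>?P)"
    if B[measurable]: "B \<in> sets (PiM {0..<n} ?M)" and E[measurable]: "E \<in> sets borel" for n B E
  proof -
    let ?B = "{\<omega> \<in> space (PiM {0..<Suc n} ?M). restrict \<omega> {0..<n} \<in> B \<and> \<omega> n \<in> E}"
    have rr: "(\<lambda>\<omega>. restrict \<omega> {0..<n}) \<in> PiM {0..<Suc n} ?M \<rightarrow>\<^sub>M PiM {0..<n} ?M"
      by (rule measurable_restrict_subset) auto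
    have cc: "(\<lambda>\<omega>. \<omega> n) \<in> PiM {0..<Suc n} ?M \<rightarrow>\<^sub>M borel" by simp
    have B': "?B \<in> sets (PiM {0..<Suc n} ?M)"
    proof -
      have "?B = ((\<lambda>\<omega>. restrict \<omega> {0..<n}) -` B \<inter> space (PiM {0..<Suc n} ?M))
          \<inter> ((\<lambda>\<omega>. \<omega> n) -` E \<inter> space (PiM {0..<Suc n} ?M))" by blast
      then show ?thesis
        using sets.Int[OF measurable_sets[OF rr B] measurable_sets[OF cc E]] by (simp only:)
    qed
    have "{\<omega>. restrict \<omega> {0..<n} \<in> B} \<inter> {\<omega>. \<omega> n \<in> E} = {\<omega>. restrict \<omega> {0..<Suc n} \<in> ?B}"
      by (auto simp: space_PiM Int_absorb1)
    then have "emeasure ?P ({\<omega>. restrict \<omega> {0..<n} \<in> B} \<inter> {\<omega>. \<omega> n \<in> E}) = emeasure (IT.C 0 (Suc n) (\<lambda>_. undefined)) ?B"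
      using Cn[OF B'] by simp
    also have "\<dots> = (\<integral>\<^sup>+\<omega>. emeasure (IT.eP n \<omega>) ?B \<partial>IT.C 0 n (\<lambda>_. undefined))"
    proof -
      have "IT.eP n \<in> IT.C 0 n (\<lambda>_. undefined) \<rightarrow>\<^sub>M subprob_algebra (PiM {0..<Suc n} ?M)"
        by (subst measurable_cong_sets[OF IT.sets_C[OF und, of n] refl]) (simp add: IT.measurable_eP)
      from emeasure_bind[OF prob_space.not_empty[OF IT.prob_space_C[OF und, of n]] this B']
      show ?thesis by simp
    qed
    also have "\<dots> = (\<integral>\<^sup>+\<omega>. indicator B \<omega> * emeasure (S n \<omega>) E \<partial>IT.C 0 n (\<lambda>_. undefined))"
    proof (rule nn_integral_cong)
      fix \<omega> assume "\<omega> \<in> space (IT.C 0 n (\<lambda>_. undefined))"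
      then have \<omega>: "\<omega> \<in> space (PiM {0..<n} ?M)" using IT.space_C[OF und, of n] by simp
      then have r: "restrict (fun_upd \<omega> n y) {0..<n} = \<omega>" for y
        by (auto simp: space_PiM PiE_iff extensional_def restrict_def fun_eq_iff)
      have "fun_upd \<omega> n y \<in> space (PiM {0..<Suc n} ?M)" for y
        using \<omega> by (auto simp: space_PiM PiE_iff extensional_def)
      then have "(\<lambda>y. fun_upd \<omega> n y) -` ?B = (if \<omega> \<in> B then E else {})"
        by (auto simp: r)
      then show "emeasure (IT.eP n \<omega>) ?B = indicator B \<omega> * emeasure (S n \<omega>) E"
        by (subst IT.emeasure_eP[OF \<omega> B']) auto
    qed
    also have "\<dots> = (\<integral>\<^sup>+\<omega>. indicator B \<omega> * emeasure (S n \<omega>) E \<partial>D n)" by (simp add: D)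
    also have "\<dots> = (\<integral>\<^sup>+\<omega>. indicator B (restrict \<omega> {0..<n}) * emeasure (S n (restrict \<omega> {0..<n})) E \<partial>?P)"
      unfolding D_def
      by (rule nn_integral_distr[OF rm]) (use Sm[of n] in measurable)
    finally show ?thesis .
  qed
  have init: "AE \<omega> in ?P. \<omega> 0 = x"
  proof -
    have B0: "restrict \<omega> {0..<0} \<in> space (PiM {0..<0} ?M)" for \<omega> :: "nat \<Rightarrow> real ^ 'n"
      by (simp add: space_PiM restrict_def)
    have "emeasure ?P ({\<omega>. restrict \<omega> {0..<0} \<in> space (PiM {0..<0} ?M)} \<inter> {\<omega>. \<omega> 0 \<in> {x}})
        = (\<integral>\<^sup>+\<omega>. 1 \<partial>?P)"
      unfolding step[OF sets.top borel_singleton[OF sets.empty_sets]]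
      by (rule nn_integral_cong) (simp only: indicator_simps(1)[OF B0], simp add: S_def)
    then have "emeasure ?P {\<omega>. \<omega> 0 = x} = 1"
      using P.emeasure_space_1 B0 by (simp add: nn_integral_const)
    then have "P.prob {\<omega>. \<omega> 0 = x} = 1" by (simp add: measure_def)
    then show ?thesis using P.AE_prob_1 by fastforce
  qed
  have cond: "AE \<omega> in ?P. real_cond_exp ?P (past k) (indicator {\<omega>. \<omega> (Suc k) \<in> E}) \<omega>
            = transition_prob \<alpha> \<beta> \<epsilon> \<nu> (\<omega> k) E" if E[measurable]: "E \<in> sets borel" for k E
  proof -
    have at: "{..k} = {0..<Suc k}" by auto
    have setsF: "sets (past k) = {(\<lambda>\<omega>. restrict \<omega> {0..<Suc k}) -` B |B. B \<in> sets (PiM {0..<Suc k} ?M)}"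
      unfolding past_def at by (subst sets_vimage_algebra2) (auto simp: space_PiM)
    have sub: "subalgebra ?P (past k)"
      unfolding subalgebra_def
    proof
      show "space (past k) = space ?P" by (simp add: past_def spP)
      show "sets (past k) \<subseteq> sets ?P"
        unfolding setsF using measurable_sets[OF rm] by (auto simp: spP simp del: IT.PF.sets_lim)
    qed
    interpret F: finite_measure_subalgebra ?P "past k"
      by standard (rule sub)
    have Em: "{\<omega>. \<omega> (Suc k) \<in> E} \<in> sets ?P"
      using measurable_sets[OF pc E, of "Suc k"] by (simp add: spP vimage_def)
    have g: "(\<lambda>y. measure (K y) E) \<in> borel_measurable borel"
      by measurable
    have coordF: "(\<lambda>\<omega> :: nat \<Rightarrow> real ^ 'n. \<omega> k) \<in> past k \<rightarrow>\<^sub>M borel"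
    proof -
      have "(\<lambda>\<omega>. restrict \<omega> {..k}) \<in> past k \<rightarrow>\<^sub>M PiM {..k} ?M"
        unfolding past_def by (rule measurable_vimage_algebra1) (auto simp: space_PiM)
      from measurable_compose[OF this measurable_component_singleton[of k "{..k}"]] show ?thesis by simp
    qed
    have gF: "(\<lambda>\<omega>. measure (K (\<omega> k)) E) \<in> borel_measurable (past k)"
      by (rule measurable_compose[OF coordF g])
    have le1: "measure (K y) E \<le> 1" for y
      by (rule prob_space.prob_le_1[OF Kprob])
    have gi: "integrable ?P (\<lambda>\<omega>. measure (K (\<omega> k)) E)"
      by (rule P.integrable_const_bound[where B=1])
         (auto simp: le1 intro: measurable_from_subalg[OF sub gF])
    have "AE \<omega> in ?P. real_cond_exp ?P (past k) (indicator {\<omega>. \<omega> (Suc k) \<in> E}) \<omega> = measure (K (\<omega> k)) E"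
    proof (rule F.real_cond_exp_charact[OF _ _ gi gF])
      show "integrable ?P (indicator {\<omega>. \<omega> (Suc k) \<in> E} :: _ \<Rightarrow> real)"
        using Em by (simp add: P.emeasure_eq_measure)
      fix A :: "(nat \<Rightarrow> real ^ 'n) set" assume A: "A \<in> sets (past k)"
      then obtain B where B: "B \<in> sets (PiM {0..<Suc k} ?M)" "A = {\<omega>. restrict \<omega> {0..<Suc k} \<in> B}"
        unfolding setsF by (auto simp: vimage_def)
      have AP: "A \<in> sets ?P" using A sub unfolding subalgebra_def by blast
      have "(\<integral>\<omega>\<in>A. indicator {\<omega>. \<omega> (Suc k) \<in> E} \<omega> \<partial>?P) = measure ?P (A \<inter> {\<omega>. \<omega> (Suc k) \<in> E})"
        unfolding set_lebesgue_integral_def using AP Em spP by (simp add: indicator_inter_arith[symmetric])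
      moreover have "emeasure ?P (A \<inter> {\<omega>. \<omega> (Suc k) \<in> E}) = (\<integral>\<^sup>+\<omega>. ennreal (indicator A \<omega> * measure (K (\<omega> k)) E) \<partial>?P)"
        unfolding B(2) step[OF B(1) E]
        by (rule nn_integral_cong)
           (auto simp: S_def indicator_def finite_measure.emeasure_eq_measure[OF prob_space.finite_measure[OF Kprob]])
      moreover have "(\<integral>\<^sup>+\<omega>. ennreal (indicator A \<omega> * measure (K (\<omega> k)) E) \<partial>?P) = ennreal (\<integral>\<omega>. indicator A \<omega> * measure (K (\<omega> k)) E \<partial>?P)"
      proof (rule nn_integral_eq_integral)
        show "integrable ?P (\<lambda>\<omega>. indicator A \<omega> * measure (K (\<omega> k)) E)"
          using integrable_mult_indicator[OF AP gi] by simp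
      qed auto
      ultimately show "(\<integral>\<omega>\<in>A. indicator {\<omega>. \<omega> (Suc k) \<in> E} \<omega> \<partial>?P) = (\<integral>\<omega>\<in>A. measure (K (\<omega> k)) E \<partial>?P)"
        unfolding set_lebesgue_integral_def by (simp add: measure_def)
    qed
    then show ?thesis by (simp add: Kval E)
  qed
  show ?thesis
    unfolding chain_law_def using Pprob setsP init cond by blast
qed

end

theory Submission
  imports Defs
begin

text \<open>
  The hitting probability, as a function of the starting point, is at least some \<open>u\<close> with \<open>u \<ge> 1\<close> on \<open>A\<close>
  that is a nonnegative supersolution of the one-step mean value equation in the large cube, so it
  suffices to bound such supersolutions from below on the unit cube in terms of the measure
  of \<open>A\<close> (Krylov--Safonov). A discrete Aleksandrov--Bakelman--Pucci argument with a Gaussian barrier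
  shows that \<open>u \<ge> 1\<close> on nearly all of a cube forces \<open>u \<ge> c\<close> on the dyadic parent, provided the cube is large compared
  to \<open>\<epsilon>\<close>; for cubes of side comparable to \<open>\<epsilon>\<close> the uniform part of the step distribution propagates any
  positive density. A Calderon--Zygmund decomposition stopped at side length about \<open>\<epsilon>\<close> then shows
  that the set where \<open>u\<close> is bounded below grows by a fixed factor until it fills the cube.
\<close>

subsection \<open>Symmetric measures and the uniform distribution on the unit ball\<close>

text \<open>The measures \<open>\<nu> x\<close> vary with \<open>x\<close> in a merely measurable
  way and may be degenerate, even a point mass at the origin. All nondegeneracy therefore comes from
  the uniform part, and that part acts only at scale \<epsilon>: below this scale a supersolution
  may be wildly irregular, suprema need not be attained, and an envelope has no usable pointwise
  gradient. Hence touching is granted a slack of order \<epsilon>^2, slopes are counted on a grid of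
  mesh proportional to \<epsilon>, and dyadic subdivision stops near \<epsilon>. Stopping costs an
  additive error in measure; it is chosen proportional to the current lower bound for the measure,
  so that the growth survives and the number of iterations does not depend on \<epsilon>. A chain
  law is given for one starting point at a time. The supersolution is therefore built by value
  iteration with the transition kernel rather than from a family of laws, which also makes it Borel;
  it is compared with the law only at the starting point. Since the lower bound holds for a whole
  class of supersolutions, it is uniform in \<nu>, \<epsilon> and the law.\<close>

lemma vimage_uminus_eq: "uminus -` E = uminus ` (E :: 'a::group_add set)"
proof safe
  fix x assume "- x \<in> E"
  then show "x \<in> uminus ` E" by (intro image_eqI[where x="- x"]) auto
qed auto

lemma symmetric_measuresD:
  fixes \<mu> :: "(real ^ 'n) measure"
  assumes "\<mu> \<in> symmetric_measures L"
  shows "prob_space \<mu>" "sets \<mu> = sets borel" "space \<mu> = UNIV"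
    "distr \<mu> borel uminus = \<mu>" "AE z in \<mu>. norm z < L"
proof -
  show p: "prob_space \<mu>" and s: "sets \<mu> = sets borel"
    using assms by (auto simp: symmetric_measures_def)
  show sp: "space \<mu> = UNIV" using sets_eq_imp_space_eq[OF s] by simp
  show "distr \<mu> borel uminus = \<mu>"
  proof (rule measure_eqI)
    fix E assume "E \<in> sets (distr \<mu> borel uminus)"
    then have E: "E \<in> sets borel" by simp
    then show "emeasure (distr \<mu> borel uminus) E = emeasure \<mu> E"
      using assms E s by (subst emeasure_distr) (auto simp: sp vimage_uminus_eq symmetric_measures_def measurable_cong_sets[OF s refl])
  qed (use s in simp)
  \<comment> \<open>The complement of the support is a union of open null sets, possibly uncountably
    many. Lindelof's theorem reduces it to a countable union, which is null.\<close>
  let ?F = "{U. open U \<and> emeasure \<mu> U = 0}"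
  obtain F' where F': "F' \<subseteq> ?F" "countable F'" "\<Union>F' = \<Union>?F"
    using Lindelof[of ?F] by auto
  have "\<Union>F' \<in> null_sets \<mu>"
  proof -
    have "(\<Union>U\<in>F'. U) \<in> null_sets \<mu>"
      using F' s by (intro null_sets_UN') (auto simp: null_sets_def)
    then show ?thesis by simp
  qed
  moreover have "{z. \<not> norm z < L} \<subseteq> \<Union>F'"
  proof
    fix z :: "real ^ 'n" assume "z \<in> {z. \<not> norm z < L}"
    then have "z \<notin> measure_support \<mu>"
      using assms by (auto simp: symmetric_measures_def)
    then show "z \<in> \<Union>F'" unfolding F'(3) by (auto simp: measure_support_def)
  qed
  ultimately show "AE z in \<mu>. norm z < L"
    by (intro AE_I'[of "\<Union>F'"]) (simp_all add: sp)
qed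

lemma integrable_symmetric_measure:
  fixes f :: "real ^ 'n \<Rightarrow> real"
  assumes \<mu>: "\<mu> \<in> symmetric_measures L" and f: "f \<in> borel_measurable borel"
    and b: "\<And>z. norm z < L \<Longrightarrow> \<bar>f z\<bar> \<le> B"
  shows "integrable \<mu> f"
proof -
  interpret prob_space \<mu> using symmetric_measuresD[OF \<mu>] by simp
  show ?thesis
  proof (rule integrable_const_bound[where B=B])
    show "AE z in \<mu>. norm (f z) \<le> B"
      using symmetric_measuresD(5)[OF \<mu>] by eventually_elim (use b in auto)
    show "f \<in> borel_measurable \<mu>"
      using f measurable_cong_sets[OF symmetric_measuresD(2)[OF \<mu>] refl] by blast
  qed
qed

text \<open>This cancellation is the only use made of symmetry: first-order terms vanish in every
  one-step mean.\<close>

lemma symmetric_measure_inner: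
  fixes a :: "real ^ 'n"
  assumes \<mu>: "\<mu> \<in> symmetric_measures L"
  shows "integrable \<mu> (\<lambda>z. a \<bullet> z)" "(\<integral>z. a \<bullet> z \<partial>\<mu>) = 0"
proof -
  show "integrable \<mu> (\<lambda>z. a \<bullet> z)"
  proof (rule integrable_symmetric_measure[OF \<mu>, where B="norm a * L"])
    fix z :: "real ^ 'n" assume "norm z < L"
    then show "\<bar>a \<bullet> z\<bar> \<le> norm a * L"
      by (intro order_trans[OF Cauchy_Schwarz_ineq2] mult_left_mono) auto
  qed simp
  have "(\<integral>z. a \<bullet> z \<partial>\<mu>) = (\<integral>z. a \<bullet> z \<partial>distr \<mu> borel uminus)"
    by (simp add: symmetric_measuresD[OF \<mu>])
  also have "\<dots> = (\<integral>z. a \<bullet> (- z) \<partial>\<mu>)"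
    by (rule integral_distr) (auto simp: measurable_cong_sets[OF symmetric_measuresD(2)[OF \<mu>] refl])
  finally show "(\<integral>z. a \<bullet> z \<partial>\<mu>) = 0" by simp
qed

lemma integral_mono_symmetric:
  fixes f g :: "real ^ 'n \<Rightarrow> real"
  assumes \<mu>: "\<mu> \<in> symmetric_measures L" and "integrable \<mu> f" "integrable \<mu> g"
    and "\<And>z. norm z < L \<Longrightarrow> f z \<le> g z"
  shows "integral\<^sup>L \<mu> f \<le> integral\<^sup>L \<mu> g"
proof (rule integral_mono_AE[OF assms(2,3)])
  show "AE z in \<mu>. f z \<le> g z"
    using symmetric_measuresD(5)[OF \<mu>] by eventually_elim (rule assms(4))
qed

definition unif_ball :: "(real ^ 'n) measure" where
  "unif_ball = uniform_measure lborel (ball 0 1)"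

lemma lborel_distr_uminus_euclidean: "distr lborel borel uminus = (lborel :: 'a::euclidean_space measure)"
proof -
  have "uminus = (\<lambda>x::'a. 0 + (-1::real) *\<^sub>R x)" by auto
  then show ?thesis
    by (subst (2) lborel_affine[of "-1 :: real" 0]) (simp_all add: density_1)
qed

lemma measure_unif_ball:
  fixes S :: "(real ^ 'n) set"
  assumes "S \<in> sets borel"
  shows "measure unif_ball S = measure lborel (S \<inter> ball 0 1) / measure lborel (ball (0::real^'n) 1)"
proof -
  have e: "emeasure lborel (ball (0::real^'n) 1) = ennreal (measure lborel (ball (0::real^'n) 1))"
    using emeasure_lborel_ball_finite[of "0::real^'n" 1] by (subst emeasure_eq_ennreal_measure) auto
  show ?thesis
    unfolding unif_ball_def using assms content_ball_pos[of 1 "0::real^'n"]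
    by (subst measure_uniform_measure) (auto simp: e Int_commute)
qed

text \<open>The support is the closed unit ball, while the class asks for an open ball, so the
  radius has to exceed 1. The sharp bound that holds almost everywhere is
  \<open>AE_unif_ball\<close>.\<close>

lemma unif_ball_symmetric: "(unif_ball :: (real ^ 'n) measure) \<in> symmetric_measures 2"
  unfolding symmetric_measures_def
proof (intro CollectI conjI ballI)
  have pos: "emeasure lborel (ball (0::real^'n) 1) \<noteq> 0" "emeasure lborel (ball (0::real^'n) 1) \<noteq> \<infinity>"
    using content_ball_pos[of 1 "0::real^'n"] emeasure_lborel_ball_finite[of "0::real^'n" 1]
    by (auto simp: measure_def)
  show "prob_space (unif_ball :: (real ^ 'n) measure)"
    unfolding unif_ball_def using pos by (intro prob_space_uniform_measure) auto
  show s: "sets (unif_ball :: (real ^ 'n) measure) = sets borel"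
    by (simp add: unif_ball_def)
  show "measure_support unif_ball \<subseteq> ball (0::real^'n) 2"
  proof
    fix z :: "real ^ 'n" assume z: "z \<in> measure_support unif_ball"
    show "z \<in> ball 0 2"
    proof (rule ccontr)
      assume "z \<notin> ball 0 2"
      have "y \<notin> ball 0 1" if "y \<in> ball z 1" for y
      proof
        assume "y \<in> ball 0 1"
        then have "norm y < 1" "norm (z - y) < 1" using that by (auto simp: dist_norm)
        then show False using \<open>z \<notin> ball 0 2\<close> norm_triangle_ineq[of y "z - y"] by auto
      qed
      then have "ball 0 1 \<inter> ball z 1 = {}" by auto
      then have "emeasure unif_ball (ball z 1) = 0"
        unfolding unif_ball_def by (subst emeasure_uniform_measure) auto
      with z show False by (auto simp: measure_support_def dest!: spec[of _ "ball z 1"])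
    qed
  qed
  fix E :: "(real ^ 'n) set" assume E: "E \<in> sets borel"
  have E': "uminus ` E \<in> sets borel"
    using measurable_sets[of uminus borel borel E] E by (simp add: vimage_uminus_eq)
  have "emeasure lborel (ball 0 1 \<inter> E) = emeasure (distr lborel borel uminus) (ball 0 1 \<inter> E)"
    by (simp add: lborel_distr_uminus_euclidean)
  also have "\<dots> = emeasure lborel (uminus -` (ball 0 1 \<inter> E))"
    using E by (subst emeasure_distr) auto
  also have "uminus -` (ball 0 1 \<inter> E) = ball 0 1 \<inter> uminus ` E"
    unfolding vimage_uminus_eq[symmetric] by auto
  finally show "emeasure unif_ball E = emeasure unif_ball (uminus ` E)"
    unfolding unif_ball_def using E E' by (simp add: emeasure_uniform_measure)
qed

lemma AE_unif_ball: "AE z in (unif_ball :: (real ^ 'n) measure). norm z < 1"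
  unfolding unif_ball_def by (rule AE_uniform_measureI) auto

lemma measure_unif_ball_subball:
  fixes w :: "real ^ 'n"
  assumes "ball w r \<subseteq> ball 0 1" "0 \<le> r"
  shows "measure unif_ball (ball w r) = r ^ CARD('n)"
proof -
  have "unit_ball_vol (real CARD('n)) \<noteq> 0"
    using content_ball_pos[of 1 "0::real^'n"] content_ball[of 1 "0::real^'n"] by auto
  then show ?thesis
    using assms by (simp add: measure_unif_ball Int_absorb2 content_ball)
qed

lemma unif_ball_markov:
  fixes f :: "real ^ 'n \<Rightarrow> real"
  assumes f: "f \<in> borel_measurable borel" "\<And>z. norm z < 1 \<Longrightarrow> 0 \<le> f z" "\<And>z. norm z < 1 \<Longrightarrow> f z \<le> B"
    and S: "S \<in> sets borel" and t: "\<And>z. norm z < 1 \<Longrightarrow> z \<in> S \<Longrightarrow> t \<le> f z"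
  shows "t * measure unif_ball S \<le> (\<integral>z. f z \<partial>unif_ball)"
proof -
  let ?U = "unif_ball :: (real ^ 'n) measure"
  interpret prob_space ?U by (rule symmetric_measuresD[OF unif_ball_symmetric])
  have s: "sets ?U = sets borel" by (rule symmetric_measuresD[OF unif_ball_symmetric])
  have "t * measure ?U S = (\<integral>z. t * indicator S z \<partial>?U)"
    using S s by (simp add: sets_eq_imp_space_eq[OF s])
  also have "\<dots> \<le> (\<integral>z. f z \<partial>?U)"
  proof (rule integral_mono_AE)
    show "integrable ?U (\<lambda>z. t * indicator S z)"
      using S s by (intro integrable_mult_right integrable_real_indicator) (auto simp: emeasure_eq_measure)
    show "integrable ?U f"
    proof (rule integrable_const_bound[where B=B])
      show "AE z in ?U. norm (f z) \<le> B" using AE_unif_ball by eventually_elim (use f in auto)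
      show "f \<in> borel_measurable ?U" using f(1) measurable_cong_sets[OF s refl] by blast
    qed
    show "AE z in ?U. t * indicator S z \<le> f z"
      using AE_unif_ball by eventually_elim (use f t in \<open>auto simp: indicator_def\<close>)
  qed
  finally show ?thesis .
qed

subsection \<open>The Gaussian barrier\<close>

definition gauss :: "real \<Rightarrow> real ^ 'n \<Rightarrow> real" where
  "gauss \<gamma> x = exp (- \<gamma> * (norm x)\<^sup>2)"

lemma gauss_measurable [measurable]: "gauss \<gamma> \<in> borel_measurable borel"
  unfolding gauss_def by measurable

lemma gauss_le_1: "0 \<le> \<gamma> \<Longrightarrow> gauss \<gamma> x \<le> 1"
  by (simp add: gauss_def)

lemma gauss_pos: "0 < gauss \<gamma> x"
  by (simp add: gauss_def)

text \<open>The product form makes all gains and losses of a step relative to the value at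
  \<open>x\<close>, and leaves an exponential whose linear part has mean zero.\<close>

lemma gauss_add:
  "gauss \<gamma> (x + \<epsilon> *\<^sub>R z) = gauss \<gamma> x * exp (- 2 * \<gamma> * \<epsilon> * (x \<bullet> z) - \<gamma> * \<epsilon>\<^sup>2 * (norm z)\<^sup>2)"
  unfolding gauss_def exp_add[symmetric] power2_norm_eq_inner
  by (simp add: inner_simps inner_commute power2_eq_square algebra_simps)

lemma integrable_gauss:
  assumes "\<mu> \<in> symmetric_measures L" "0 \<le> \<gamma>"
  shows "integrable \<mu> (\<lambda>z. gauss \<gamma> (x + \<epsilon> *\<^sub>R z))"
  by (rule integrable_symmetric_measure[OF assms(1), where B=1])
     (simp_all add: abs_of_pos[OF gauss_pos] gauss_le_1[OF assms(2)])

text \<open>For an arbitrary symmetric measure only \<open>exp s \<ge> 1 + s\<close> is available: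
  the linear term averages out and the quadratic term is the loss.\<close>

lemma integral_gauss_ge:
  assumes \<mu>: "\<mu> \<in> symmetric_measures L" and "0 \<le> \<gamma>" "0 \<le> L"
  shows "gauss \<gamma> x * (1 - \<gamma> * \<epsilon>\<^sup>2 * L\<^sup>2) \<le> (\<integral>z. gauss \<gamma> (x + \<epsilon> *\<^sub>R z) \<partial>\<mu>)"
proof -
  interpret prob_space \<mu> by (rule symmetric_measuresD[OF \<mu>])
  define a where "a = ((- 2 * \<gamma> * \<epsilon>) *\<^sub>R x)"
  have a: "a \<bullet> z = - 2 * \<gamma> * \<epsilon> * (x \<bullet> z)" for z by (simp add: a_def)
  let ?h = "\<lambda>z. gauss \<gamma> x * (1 - \<gamma> * \<epsilon>\<^sup>2 * L\<^sup>2 + a \<bullet> z)"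
  have "gauss \<gamma> x * (1 - \<gamma> * \<epsilon>\<^sup>2 * L\<^sup>2) = (\<integral>z. ?h z \<partial>\<mu>)"
    using symmetric_measure_inner[OF \<mu>, of a]
    by (subst integral_mult_right_zero, subst Bochner_Integration.integral_add) (simp_all add: prob_space)
  also have "\<dots> \<le> (\<integral>z. gauss \<gamma> (x + \<epsilon> *\<^sub>R z) \<partial>\<mu>)"
  proof (rule integral_mono_symmetric[OF \<mu>])
    show "integrable \<mu> ?h"
      using symmetric_measure_inner(1)[OF \<mu>, of a]
      by (intro integrable_mult_right Bochner_Integration.integrable_add) auto
    show "integrable \<mu> (\<lambda>z. gauss \<gamma> (x + \<epsilon> *\<^sub>R z))" by (rule integrable_gauss[OF \<mu> assms(2)])
    fix z :: "real ^ 'a" assume z: "norm z < L"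
    have "(norm z)\<^sup>2 \<le> L\<^sup>2" using z by (intro power_mono) auto
    then have "\<gamma> * \<epsilon>\<^sup>2 * (norm z)\<^sup>2 \<le> \<gamma> * \<epsilon>\<^sup>2 * L\<^sup>2" using assms(2) by (intro mult_left_mono) auto
    moreover have "1 + (- 2 * \<gamma> * \<epsilon> * (x \<bullet> z) - \<gamma> * \<epsilon>\<^sup>2 * (norm z)\<^sup>2)
        \<le> exp (- 2 * \<gamma> * \<epsilon> * (x \<bullet> z) - \<gamma> * \<epsilon>\<^sup>2 * (norm z)\<^sup>2)"
      by (rule exp_ge_add_one_self)
    ultimately have "1 - \<gamma> * \<epsilon>\<^sup>2 * L\<^sup>2 + a \<bullet> z
        \<le> exp (- 2 * \<gamma> * \<epsilon> * (x \<bullet> z) - \<gamma> * \<epsilon>\<^sup>2 * (norm z)\<^sup>2)"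
      unfolding a by linarith
    then show "?h z \<le> gauss \<gamma> (x + \<epsilon> *\<^sub>R z)"
      unfolding gauss_add using gauss_pos[of \<gamma> x] by (intro mult_left_mono) auto
  qed
  finally show ?thesis .
qed

text \<open>The gain comes from a ball \<open>S\<close> on which \<open>x \<bullet> z < 0\<close>: there \<open>exp s \<ge> 1 + s + s\<^sup>2 / 2\<close>,
  while elsewhere \<open>exp s \<ge> 1 + s\<close> suffices because \<open>s\<close> has mean zero.\<close>

lemma integral_gauss_unif_ball_ge:
  fixes x :: "real ^ 'n"
  assumes "0 \<le> \<gamma>" "0 < \<epsilon>" "\<gamma> * \<epsilon>\<^sup>2 \<le> 1"
  shows "gauss \<gamma> x * ((1 - \<gamma> * \<epsilon>\<^sup>2) * (1 + (1 / 4) ^ CARD('n) / 8 * \<gamma>\<^sup>2 * \<epsilon>\<^sup>2 * (norm x)\<^sup>2))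
    \<le> (\<integral>z. gauss \<gamma> (x + \<epsilon> *\<^sub>R z) \<partial>unif_ball)"
proof -
  let ?U = "unif_ball :: (real ^ 'n) measure"
  note U = unif_ball_symmetric[where 'n='n]
  interpret prob_space ?U by (rule symmetric_measuresD[OF U])
  \<comment> \<open>\<open>S\<close> is centred opposite to \<open>x\<close> at distance 1/2 and has
    radius 1/4, so \<open>x \<bullet> z \<le> - norm x / 4\<close> on it and it stays in the unit
    ball. For \<open>x = 0\<close> the division by zero gives \<open>w = 0\<close>, and the gain is
    zero as well.\<close>
  define w where "w = (- 1 / (2 * norm x)) *\<^sub>R x"
  define S where "S = ball w (1 / 4)"
  have "norm w \<le> 1 / 2" by (simp add: w_def)
  then have "S \<subseteq> ball 0 1" unfolding S_def
    by (intro ball_subset_ball_iff[THEN iffD2]) (auto simp: dist_norm)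
  then have mS: "measure ?U S = (1 / 4) ^ CARD('n)"
    unfolding S_def by (intro measure_unif_ball_subball) auto
  let ?q = "\<gamma>\<^sup>2 * \<epsilon>\<^sup>2 * (norm x)\<^sup>2 / 8"
  let ?C = "gauss \<gamma> x * (1 - \<gamma> * \<epsilon>\<^sup>2)"
  define a where "a = ((- 2 * \<gamma> * \<epsilon>) *\<^sub>R x)"
  have a: "a \<bullet> z = - 2 * \<gamma> * \<epsilon> * (x \<bullet> z)" for z by (simp add: a_def)
  let ?h = "\<lambda>z. ?C * (1 + a \<bullet> z + ?q * indicator S z)"
  have Sm: "S \<in> sets ?U" by (simp add: S_def symmetric_measuresD[OF U])
  have iS: "integrable ?U (\<lambda>z. ?q * indicator S z)"
    using Sm by (intro integrable_mult_right integrable_real_indicator) (auto simp: emeasure_eq_measure)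
  have ii: "integrable ?U (\<lambda>z. 1 + a \<bullet> z)"
    by (intro Bochner_Integration.integrable_add symmetric_measure_inner(1)[OF U]) auto
  have "(\<integral>z. 1 + a \<bullet> z \<partial>?U) = 1"
    using symmetric_measure_inner[OF U, of a]
    by (subst Bochner_Integration.integral_add) (auto simp: prob_space)
  moreover have "(\<integral>z. ?q * indicator S z \<partial>?U) = ?q * (1 / 4) ^ CARD('n)"
    using Sm mS by (simp add: symmetric_measuresD(3)[OF U])
  ultimately have "?C * (1 + ?q * (1 / 4) ^ CARD('n)) = (\<integral>z. ?h z \<partial>?U)"
    by (simp only: integral_mult_right_zero Bochner_Integration.integral_add[OF ii iS])
  also have "\<dots> \<le> (\<integral>z. gauss \<gamma> (x + \<epsilon> *\<^sub>R z) \<partial>?U)"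
  proof (rule integral_mono_AE)
    show "integrable ?U ?h" by (rule integrable_mult_right[OF Bochner_Integration.integrable_add[OF ii iS]])
    show "integrable ?U (\<lambda>z. gauss \<gamma> (x + \<epsilon> *\<^sub>R z))" by (rule integrable_gauss[OF U assms(1)])
    have le: "?h z \<le> gauss \<gamma> (x + \<epsilon> *\<^sub>R z)" if z: "norm z < 1" for z
    proof -
      define s where "s = a \<bullet> z"
      have "1 + s + ?q * indicator S z \<le> exp s"
      proof (cases "z \<in> S")
        case True
        have "x \<bullet> z = x \<bullet> w + x \<bullet> (z - w)" by (simp add: inner_diff_right)
        also have "x \<bullet> w = - norm x / 2"
          by (cases "x = 0") (simp_all add: w_def power2_norm_eq_inner[symmetric] power2_eq_square)
        also have "x \<bullet> (z - w) \<le> norm x * (1 / 4)"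
          using True by (intro order_trans[OF norm_cauchy_schwarz] mult_left_mono) (auto simp: S_def dist_norm norm_minus_commute)
        finally have "2 * \<gamma> * \<epsilon> * (x \<bullet> z) \<le> 2 * \<gamma> * \<epsilon> * (- norm x / 4)"
          using assms by (intro mult_left_mono) auto
        then have s: "\<gamma> * \<epsilon> * norm x / 2 \<le> s" by (simp add: s_def a algebra_simps)
        have s0: "0 \<le> \<gamma> * \<epsilon> * norm x / 2" using assms by auto
        have "(\<gamma> * \<epsilon> * norm x / 2)\<^sup>2 \<le> s\<^sup>2" using s s0 by (intro power_mono) auto
        then have "?q \<le> s\<^sup>2 / 2" by (simp add: power_mult_distrib power_divide mult_ac)
        moreover have "1 + s + s\<^sup>2 / 2 \<le> exp s" using s s0 by (intro exp_lower_Taylor_quadratic) auto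
        ultimately have "1 + s + ?q \<le> exp s" by linarith
        then show ?thesis using True by simp
      qed (use exp_ge_add_one_self[of s] in auto)
      moreover have "1 - \<gamma> * \<epsilon>\<^sup>2 \<le> exp (- \<gamma> * \<epsilon>\<^sup>2 * (norm z)\<^sup>2)"
      proof -
        have "(norm z)\<^sup>2 \<le> 1" using z by (simp add: power_le_one)
        then have "\<gamma> * \<epsilon>\<^sup>2 * (norm z)\<^sup>2 \<le> \<gamma> * \<epsilon>\<^sup>2 * 1" using assms by (intro mult_left_mono) auto
        then show ?thesis using exp_ge_add_one_self[of "- \<gamma> * \<epsilon>\<^sup>2 * (norm z)\<^sup>2"] by simp
      qed
      \<comment> \<open>The factor with \<open>1 + s\<close> may be negative, so it is first
        enlarged to \<open>exp s\<close>; only then is the nonnegative factor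
        \<open>1 - \<gamma> * \<epsilon>\<^sup>2\<close> enlarged.\<close>
      ultimately have "(1 - \<gamma> * \<epsilon>\<^sup>2) * (1 + s + ?q * indicator S z) \<le> exp (- \<gamma> * \<epsilon>\<^sup>2 * (norm z)\<^sup>2) * exp s"
        using assms(3) by (intro order_trans[OF mult_left_mono mult_right_mono]) auto
      then have "gauss \<gamma> x * ((1 - \<gamma> * \<epsilon>\<^sup>2) * (1 + s + ?q * indicator S z)) \<le> gauss \<gamma> x * (exp (- \<gamma> * \<epsilon>\<^sup>2 * (norm z)\<^sup>2) * exp s)"
        using gauss_pos[of \<gamma> x] by (intro mult_left_mono) auto
      moreover have "- 2 * \<gamma> * \<epsilon> * (x \<bullet> z) - \<gamma> * \<epsilon>\<^sup>2 * (norm z)\<^sup>2 = - \<gamma> * \<epsilon>\<^sup>2 * (norm z)\<^sup>2 + s"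
        by (simp add: s_def a)
      ultimately show ?thesis by (simp only: gauss_add exp_add s_def[symmetric] mult.assoc)
    qed
    show "AE z in ?U. ?h z \<le> gauss \<gamma> (x + \<epsilon> *\<^sub>R z)"
      using AE_unif_ball by eventually_elim (rule le)
  qed
  finally show ?thesis by (simp add: mult_ac)
qed

text \<open>The measure is a free parameter instead of \<open>\<nu> x\<close>: the analytic
  estimates treat one point at a time and never see how the measure depends on it.\<close>

definition step_mean :: "real \<Rightarrow> real \<Rightarrow> real \<Rightarrow> (real ^ 'n) measure \<Rightarrow> (real ^ 'n \<Rightarrow> real) \<Rightarrow> real ^ 'n \<Rightarrow> real" where
  "step_mean \<alpha> \<beta> \<epsilon> \<mu> u x =
     \<alpha> * (\<integral>z. u (x + \<epsilon> *\<^sub>R z) \<partial>\<mu>) + \<beta> * (\<integral>z. u (x + \<epsilon> *\<^sub>R z) \<partial>unif_ball)"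

locale increments =
  fixes \<Lambda> \<alpha> \<beta> :: real
  assumes \<Lambda>: "1 \<le> \<Lambda>" and \<beta>: "0 < \<beta>" "\<beta> \<le> 1" and \<alpha>: "\<alpha> = 1 - \<beta>"
begin

text \<open>The loss is linear in \<gamma>, the gain from the noise is quadratic in \<gamma>, so
  away from the origin a large \<gamma> makes the Gaussian a strict subsolution for every admissible
  measure at once. The bound on \<open>\<gamma> * \<epsilon>\<^sup>2\<close> ensures that the factor
  \<open>1 - \<gamma> * \<epsilon>\<^sup>2\<close> costs at most half of the gain.\<close>

lemma step_mean_gauss_ge:
  fixes x :: "real ^ 'n"
  assumes \<mu>: "\<mu> \<in> symmetric_measures \<Lambda>" and "0 \<le> \<gamma>" "0 < \<epsilon>" "\<gamma> * \<epsilon>\<^sup>2 \<le> 1 / 2"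
  shows "gauss \<gamma> x * (1 + \<gamma> * \<epsilon>\<^sup>2 * (\<beta> * (1 / 4) ^ CARD('n) / 16 * \<gamma> * (norm x)\<^sup>2 - \<Lambda>\<^sup>2))
    \<le> step_mean \<alpha> \<beta> \<epsilon> \<mu> (gauss \<gamma>) x"
proof -
  define t where "t = \<gamma> * \<epsilon>\<^sup>2"
  define X where "X = (1 / 4) ^ CARD('n) / 8 * \<gamma> * (norm x)\<^sup>2 * t"
  have X: "0 \<le> X" "0 \<le> t" "t \<le> 1 / 2" using assms by (auto simp: X_def t_def)
  have "1 \<le> \<Lambda>\<^sup>2" using \<Lambda> by simp
  then have "\<beta> * 1 \<le> \<beta> * \<Lambda>\<^sup>2" using \<beta> by (intro mult_left_mono) auto
  then have "\<alpha> * \<Lambda>\<^sup>2 + \<beta> \<le> \<Lambda>\<^sup>2" by (simp add: \<alpha> algebra_simps)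
  then have *: "t * (\<alpha> * \<Lambda>\<^sup>2 + \<beta>) \<le> t * \<Lambda>\<^sup>2" using X by (intro mult_left_mono)
  have "t * X \<le> 1 / 2 * X" using X by (intro mult_right_mono)
  then have **: "\<beta> * (t * X) \<le> \<beta> * (1 / 2 * X)" using \<beta> by (intro mult_left_mono) auto
  have "1 - t * \<Lambda>\<^sup>2 + \<beta> * X / 2 \<le> \<alpha> * (1 - t * \<Lambda>\<^sup>2) + \<beta> * ((1 - t) * (1 + X))"
  proof -
    have "\<alpha> * (1 - t * \<Lambda>\<^sup>2) + \<beta> * ((1 - t) * (1 + X))
        = (\<alpha> + \<beta>) - t * (\<alpha> * \<Lambda>\<^sup>2 + \<beta>) + \<beta> * X - \<beta> * (t * X)"
      by (simp add: algebra_simps)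
    moreover have "\<alpha> + \<beta> = 1" by (simp add: \<alpha>)
    ultimately show ?thesis using * ** by simp
  qed
  then have "gauss \<gamma> x * (1 - t * \<Lambda>\<^sup>2 + \<beta> * X / 2)
      \<le> gauss \<gamma> x * (\<alpha> * (1 - t * \<Lambda>\<^sup>2) + \<beta> * ((1 - t) * (1 + X)))"
    using gauss_pos[of \<gamma> x] by (intro mult_left_mono) auto
  also have "\<dots> = \<alpha> * (gauss \<gamma> x * (1 - t * \<Lambda>\<^sup>2)) + \<beta> * (gauss \<gamma> x * ((1 - t) * (1 + X)))"
    by (simp add: algebra_simps)
  also have "\<dots> \<le> step_mean \<alpha> \<beta> \<epsilon> \<mu> (gauss \<gamma>) x"
    unfolding step_mean_def
  proof (intro add_mono mult_left_mono)
    show "gauss \<gamma> x * (1 - t * \<Lambda>\<^sup>2) \<le> (\<integral>z. gauss \<gamma> (x + \<epsilon> *\<^sub>R z) \<partial>\<mu>)"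
      using integral_gauss_ge[OF \<mu> assms(2)] \<Lambda> by (simp add: t_def)
    show "gauss \<gamma> x * ((1 - t) * (1 + X)) \<le> (\<integral>z. gauss \<gamma> (x + \<epsilon> *\<^sub>R z) \<partial>unif_ball)"
      using integral_gauss_unif_ball_ge[OF assms(2,3), of x] X(3) unfolding t_def X_def
      by (simp add: power2_eq_square mult_ac)
  qed (use \<alpha> \<beta> in auto)
  finally show ?thesis by (simp add: X_def t_def algebra_simps)
qed

end

subsection \<open>Supersolutions and almost touching affine functions\<close>

lemma measure_vimage_affine:
  fixes A :: "(real ^ 'n) set"
  assumes A: "A \<in> sets borel" and \<epsilon>: "0 < \<epsilon>"
  shows "measure lborel A = \<epsilon> ^ CARD('n) * measure lborel {z. x + \<epsilon> *\<^sub>R z \<in> A}"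
proof -
  let ?T = "\<lambda>z :: real ^ 'n. x + \<epsilon> *\<^sub>R z"
  have mT: "?T \<in> borel_measurable borel" by measurable
  have "emeasure lborel A = emeasure (density (distr lborel borel ?T) (\<lambda>_. ennreal (\<bar>\<epsilon>\<bar> ^ DIM(real ^ 'n)))) A"
    using lborel_affine[of \<epsilon> x] \<epsilon> by simp
  also have "\<dots> = ennreal (\<epsilon> ^ CARD('n)) * emeasure lborel (?T -` A)"
    using A \<epsilon> mT by (simp add: emeasure_density nn_integral_cmult emeasure_distr)
  finally show ?thesis using \<epsilon> by (simp add: measure_def enn2real_mult vimage_def)
qed

lemma measure_unif_ball_affine:
  fixes E :: "(real ^ 'n) set"
  assumes E: "E \<in> sets borel" and \<epsilon>: "0 < \<epsilon>"
  shows "measure unif_ball {z. x + \<epsilon> *\<^sub>R z \<in> E}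
    = measure lborel (E \<inter> ball x \<epsilon>) / measure lborel (ball x \<epsilon>)"
proof -
  let ?T = "\<lambda>z :: real ^ 'n. x + \<epsilon> *\<^sub>R z"
  have mT: "?T \<in> borel_measurable borel" by measurable
  have S: "{z. ?T z \<in> E} \<in> sets borel"
    using measurable_sets[OF mT E] by (simp add: vimage_def)
  have "{z. ?T z \<in> E \<inter> ball x \<epsilon>} = {z. ?T z \<in> E} \<inter> ball 0 1" "{z. ?T z \<in> ball x \<epsilon>} = ball 0 1"
    using \<epsilon> by (auto simp: dist_norm)
  then show ?thesis
    using \<epsilon> E measure_vimage_affine[of "E \<inter> ball x \<epsilon>" \<epsilon> x] measure_vimage_affine[of "ball x \<epsilon>" \<epsilon> x]
    by (simp add: measure_unif_ball[OF S])
qed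

context increments
begin

text \<open>The measure may be chosen afresh at each point, with no measurability of the choice,
  which makes the class stable under rescaling. Nonnegativity is asked on the whole space because
  steps may leave \<open>D\<close>.\<close>

definition supersol :: "real \<Rightarrow> (real ^ 'n) set \<Rightarrow> (real ^ 'n \<Rightarrow> real) \<Rightarrow> bool" where
  "supersol \<epsilon> D u \<longleftrightarrow> u \<in> borel_measurable borel \<and> (\<forall>x. 0 \<le> u x) \<and> bdd_above (range u)
     \<and> (\<forall>x\<in>D. \<exists>\<mu>\<in>symmetric_measures \<Lambda>. step_mean \<alpha> \<beta> \<epsilon> \<mu> u x \<le> u x)"

lemma supersolD:
  assumes "supersol \<epsilon> D u"
  shows "u \<in> borel_measurable borel" "0 \<le> u x"
    "x \<in> D \<Longrightarrow> \<exists>\<mu>\<in>symmetric_measures \<Lambda>. step_mean \<alpha> \<beta> \<epsilon> \<mu> u x \<le> u x"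
  using assms by (auto simp: supersol_def)

lemma supersol_bound:
  assumes "supersol \<epsilon> D u" shows "\<exists>b. \<forall>x. u x \<le> b"
  using assms by (auto simp: supersol_def bdd_above_def)

lemma supersol_mono: "supersol \<epsilon> D u \<Longrightarrow> D' \<subseteq> D \<Longrightarrow> supersol \<epsilon> D' u"
  by (auto simp: supersol_def)

lemma supersol_divide:
  assumes u: "supersol \<epsilon> D u" and c: "0 < c"
  shows "supersol \<epsilon> D (\<lambda>x. u x / c)"
proof -
  obtain b where b: "\<And>x. u x \<le> b" using supersol_bound[OF u] by blast
  have "bdd_above (range (\<lambda>x. u x / c))"
    using b c by (intro bdd_aboveI2[where M="b / c"]) (simp add: divide_right_mono)
  moreover have "step_mean \<alpha> \<beta> \<epsilon> \<mu> (\<lambda>x. u x / c) x = step_mean \<alpha> \<beta> \<epsilon> \<mu> u x / c" for \<mu> x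
    by (simp add: step_mean_def add_divide_distrib)
  ultimately show ?thesis
    using u c unfolding supersol_def by (auto simp: divide_le_cancel)
qed

text \<open>Dilating space changes the step size but not the class of measures, so estimates on a
  cube of side \<open>s\<close> reduce to side 1 with step \<open>\<epsilon> / s\<close>.\<close>

lemma supersol_affine:
  assumes u: "supersol \<epsilon> D u" and s: "0 < s" and D: "\<And>x. x \<in> D' \<Longrightarrow> z + s *\<^sub>R x \<in> D"
  shows "supersol (\<epsilon> / s) D' (\<lambda>x. u (z + s *\<^sub>R x))"
proof -
  obtain b where b: "\<And>x. u x \<le> b" using supersol_bound[OF u] by blast
  have "step_mean \<alpha> \<beta> (\<epsilon> / s) \<mu> (\<lambda>x. u (z + s *\<^sub>R x)) x = step_mean \<alpha> \<beta> \<epsilon> \<mu> u (z + s *\<^sub>R x)" for \<mu> x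
    using s by (simp add: step_mean_def scaleR_add_right add.assoc)
  moreover have "(\<lambda>x. u (z + s *\<^sub>R x)) \<in> borel_measurable borel"
    using supersolD(1)[OF u] by measurable
  moreover have "bdd_above (range (\<lambda>x. u (z + s *\<^sub>R x)))"
    using b by (intro bdd_aboveI2[where M=b]) auto
  ultimately show ?thesis using u D unfolding supersol_def by auto
qed

lemma supersol_noise:
  fixes u :: "real ^ 'n \<Rightarrow> real"
  assumes u: "supersol \<epsilon> D u" and x: "x \<in> D"
  shows "\<beta> * (\<integral>z. u (x + \<epsilon> *\<^sub>R z) \<partial>unif_ball) \<le> u x"
proof -
  obtain \<mu> where "step_mean \<alpha> \<beta> \<epsilon> \<mu> u x \<le> u x" using supersolD(3)[OF u x] by auto
  moreover have "0 \<le> \<alpha> * (\<integral>z. u (x + \<epsilon> *\<^sub>R z) \<partial>\<mu>)"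
    using supersolD(2)[OF u] \<alpha> \<beta> by (intro mult_nonneg_nonneg integral_nonneg) auto
  ultimately show ?thesis by (simp add: step_mean_def)
qed

lemma supersol_ge_measure:
  fixes u :: "real ^ 'n \<Rightarrow> real"
  assumes u: "supersol \<epsilon> D u" and x: "x \<in> D" and \<epsilon>: "0 < \<epsilon>"
    and E: "E \<in> sets borel" "\<And>y. y \<in> E \<Longrightarrow> y \<in> ball x \<epsilon> \<Longrightarrow> t \<le> u y" and t: "0 \<le> t"
  shows "\<beta> * t * measure lborel (E \<inter> ball x \<epsilon>) \<le> u x * measure lborel (ball x \<epsilon>)"
proof -
  obtain b where b: "\<And>x. u x \<le> b" using supersol_bound[OF u] by blast
  have [measurable]: "u \<in> borel_measurable borel" by (rule supersolD[OF u])
  have mT: "(\<lambda>z. x + \<epsilon> *\<^sub>R z) \<in> borel_measurable borel" by measurable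
  have S: "{z. x + \<epsilon> *\<^sub>R z \<in> E} \<in> sets borel"
    using measurable_sets[OF mT E(1)] by (simp add: vimage_def)
  have "t * measure unif_ball {z. x + \<epsilon> *\<^sub>R z \<in> E} \<le> (\<integral>z. u (x + \<epsilon> *\<^sub>R z) \<partial>unif_ball)"
  proof (rule unif_ball_markov[OF _ _ _ S, where B=b])
    fix z :: "real ^ 'n" assume z: "norm z < 1" "z \<in> {z. x + \<epsilon> *\<^sub>R z \<in> E}"
    then show "t \<le> u (x + \<epsilon> *\<^sub>R z)" using \<epsilon> by (intro E(2)) (auto simp: dist_norm)
  qed (use supersolD(2)[OF u] b in auto)
  then have "\<beta> * (t * measure unif_ball {z. x + \<epsilon> *\<^sub>R z \<in> E}) \<le> \<beta> * (\<integral>z. u (x + \<epsilon> *\<^sub>R z) \<partial>unif_ball)"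
    using \<beta> by (intro mult_left_mono) auto
  also have "\<dots> \<le> u x" by (rule supersol_noise[OF u x])
  finally have "\<beta> * t * measure lborel (E \<inter> ball x \<epsilon>) / measure lborel (ball x \<epsilon>) \<le> u x"
    by (simp add: measure_unif_ball_affine[OF E(1) \<epsilon>] mult.assoc)
  then show ?thesis using content_ball_pos[OF \<epsilon>, of x] by (simp add: field_simps)
qed

lemma touching_affine:
  fixes u f :: "real ^ 'n \<Rightarrow> real"
  assumes \<mu>: "\<mu> \<in> symmetric_measures \<Lambda>" and u: "step_mean \<alpha> \<beta> \<epsilon> \<mu> u x \<le> u x"
    and m: "u \<in> borel_measurable borel" "f \<in> borel_measurable borel"
    and b: "\<And>y. \<bar>u y\<bar> \<le> b" "\<And>y. \<bar>f y\<bar> \<le> b'"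
    and le: "\<And>z. norm z < \<Lambda> \<Longrightarrow> f (x + \<epsilon> *\<^sub>R z) - u (x + \<epsilon> *\<^sub>R z) \<le> c + p \<bullet> (x + \<epsilon> *\<^sub>R z)"
    and ge: "c + p \<bullet> x - t \<le> f x - u x"
  shows "\<beta> * (\<integral>z. c + p \<bullet> (x + \<epsilon> *\<^sub>R z) - (f (x + \<epsilon> *\<^sub>R z) - u (x + \<epsilon> *\<^sub>R z)) \<partial>unif_ball)
    \<le> t - (step_mean \<alpha> \<beta> \<epsilon> \<mu> f x - f x)"
proof -
  let ?g = "\<lambda>z. c + p \<bullet> (x + \<epsilon> *\<^sub>R z) - (f (x + \<epsilon> *\<^sub>R z) - u (x + \<epsilon> *\<^sub>R z))"
  have [measurable]: "u \<in> borel_measurable borel" "f \<in> borel_measurable borel" by fact+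
  have int: "(\<integral>z. ?g z \<partial>\<nu>) = c + p \<bullet> x - (\<integral>z. f (x + \<epsilon> *\<^sub>R z) \<partial>\<nu>) + (\<integral>z. u (x + \<epsilon> *\<^sub>R z) \<partial>\<nu>)"
    if \<nu>: "\<nu> \<in> symmetric_measures L" for \<nu> :: "(real ^ 'n) measure" and L
  proof -
    interpret prob_space \<nu> by (rule symmetric_measuresD[OF \<nu>])
    have fu: "integrable \<nu> (\<lambda>z. f (x + \<epsilon> *\<^sub>R z))" "integrable \<nu> (\<lambda>z. u (x + \<epsilon> *\<^sub>R z))"
      by (rule integrable_symmetric_measure[OF \<nu> _ b(2)] integrable_symmetric_measure[OF \<nu> _ b(1)], measurable)+
    have g: "?g = (\<lambda>z. ((c + p \<bullet> x) + (\<epsilon> *\<^sub>R p) \<bullet> z) - (f (x + \<epsilon> *\<^sub>R z) - u (x + \<epsilon> *\<^sub>R z)))"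
      by (auto simp: inner_simps)
    have l: "integrable \<nu> (\<lambda>z. (c + p \<bullet> x) + (\<epsilon> *\<^sub>R p) \<bullet> z)"
      by (intro Bochner_Integration.integrable_add symmetric_measure_inner(1)[OF \<nu>]) auto
    have "(\<integral>z. (c + p \<bullet> x) + (\<epsilon> *\<^sub>R p) \<bullet> z \<partial>\<nu>) = c + p \<bullet> x"
      by (subst Bochner_Integration.integral_add[OF _ symmetric_measure_inner(1)[OF \<nu>]])
         (simp_all only: integrable_const symmetric_measure_inner(2)[OF \<nu>], simp add: prob_space)
    then show ?thesis
      unfolding g Bochner_Integration.integral_diff[OF l Bochner_Integration.integrable_diff[OF fu]]
        Bochner_Integration.integral_diff[OF fu] by linarith
  qed
  have pos: "0 \<le> ?g z" if "norm z < \<Lambda>" for z using le[OF that] by simp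
  have "0 \<le> (\<integral>z. ?g z \<partial>\<mu>)"
  proof (rule integral_nonneg_AE)
    show "AE z in \<mu>. 0 \<le> ?g z"
      using symmetric_measuresD(5)[OF \<mu>] by eventually_elim (rule pos)
  qed
  then have "0 \<le> \<alpha> * (\<integral>z. ?g z \<partial>\<mu>)" using \<alpha> \<beta> by simp
  moreover have "\<alpha> * (\<integral>z. ?g z \<partial>\<mu>) + \<beta> * (\<integral>z. ?g z \<partial>unif_ball)
      = (\<alpha> + \<beta>) * (c + p \<bullet> x) - step_mean \<alpha> \<beta> \<epsilon> \<mu> f x + step_mean \<alpha> \<beta> \<epsilon> \<mu> u x"
    unfolding int[OF \<mu>] int[OF unif_ball_symmetric] step_mean_def by (simp add: algebra_simps)
  moreover have "\<alpha> + \<beta> = 1" by (simp add: \<alpha>)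
  ultimately show ?thesis using u ge by simp
qed

end

text \<open>Substitute for a gradient bound on an envelope. On opposite sides along the direction of
  \<open>p1 - p2\<close>, pick a point where the first affine function is close to \<open>w\<close>
  and one where the second is. Each function dominates \<open>w\<close> at both points, so adding
  the two comparisons bounds the increment of \<open>p1 - p2\<close> between points that are at
  least \<epsilon>/4 apart in that direction.\<close>

lemma slope_separation:
  fixes w :: "real ^ 'n \<Rightarrow> real"
  assumes w: "w \<in> borel_measurable borel" "\<And>y. \<bar>w y\<bar> \<le> b"
    and le: "\<And>z. norm z < 1 \<Longrightarrow> w (x1 + \<epsilon> *\<^sub>R z) \<le> c1 + p1 \<bullet> (x1 + \<epsilon> *\<^sub>R z)"
      "\<And>z. norm z < 1 \<Longrightarrow> w (x1 + \<epsilon> *\<^sub>R z) \<le> c2 + p2 \<bullet> (x1 + \<epsilon> *\<^sub>R z)"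
      "\<And>z. norm z < 1 \<Longrightarrow> w (x2 + \<epsilon> *\<^sub>R z) \<le> c1 + p1 \<bullet> (x2 + \<epsilon> *\<^sub>R z)"
      "\<And>z. norm z < 1 \<Longrightarrow> w (x2 + \<epsilon> *\<^sub>R z) \<le> c2 + p2 \<bullet> (x2 + \<epsilon> *\<^sub>R z)"
    and i: "(\<integral>z. c1 + p1 \<bullet> (x1 + \<epsilon> *\<^sub>R z) - w (x1 + \<epsilon> *\<^sub>R z) \<partial>unif_ball) \<le> D * \<epsilon>\<^sup>2"
      "(\<integral>z. c2 + p2 \<bullet> (x2 + \<epsilon> *\<^sub>R z) - w (x2 + \<epsilon> *\<^sub>R z) \<partial>unif_ball) \<le> D * \<epsilon>\<^sup>2"
    and \<epsilon>: "0 < \<epsilon>" and D: "0 < D" and x: "norm (x1 - x2) \<le> \<epsilon> / 4"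
  shows "norm (p1 - p2) < 16 * 4 ^ CARD('n) * D * \<epsilon>"
proof (cases "p1 = p2")
  case True then show ?thesis using \<epsilon> D by simp
next
  case False
  define e where "e = (p1 - p2) /\<^sub>R norm (p1 - p2)"
  have ne: "norm e = 1" using False by (simp add: e_def)
  \<comment> \<open>Twice the level that Markov's inequality allows on a ball of radius 1/4, whose
    share of the noise is \<open>(1 / 4) ^ CARD('n)\<close>; the factor 2 yields a strict
    contradiction.\<close>
  define T where "T = 2 * 4 ^ CARD('n) * D * \<epsilon>\<^sup>2"
  have pick: "\<exists>z. norm z < 1 \<and> z \<in> ball v (1/4) \<and> c + p \<bullet> (x + \<epsilon> *\<^sub>R z) - w (x + \<epsilon> *\<^sub>R z) < T"
    if v: "norm v = 1 / 2" and le: "\<And>z. norm z < 1 \<Longrightarrow> w (x + \<epsilon> *\<^sub>R z) \<le> c + p \<bullet> (x + \<epsilon> *\<^sub>R z)"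
      and i: "(\<integral>z. c + p \<bullet> (x + \<epsilon> *\<^sub>R z) - w (x + \<epsilon> *\<^sub>R z) \<partial>unif_ball) \<le> D * \<epsilon>\<^sup>2" for v x p c
  proof (rule ccontr)
    assume *: "\<not> ?thesis"
    have "p \<bullet> (x + \<epsilon> *\<^sub>R z) \<le> norm p * (norm x + \<epsilon>)" if "norm z < 1" for z
    proof -
      have "norm (x + \<epsilon> *\<^sub>R z) \<le> norm x + \<epsilon>"
        using that \<epsilon> by (intro norm_triangle_le) auto
      then show ?thesis by (intro order_trans[OF norm_cauchy_schwarz] mult_left_mono) auto
    qed
    then have B: "c + p \<bullet> (x + \<epsilon> *\<^sub>R z) - w (x + \<epsilon> *\<^sub>R z) \<le> c + norm p * (norm x + \<epsilon>) + b" if "norm z < 1" for z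
      using that w(2)[of "x + \<epsilon> *\<^sub>R z"] by fastforce
    have sub: "ball v (1/4) \<subseteq> ball 0 1"
      using v by (intro ball_subset_ball_iff[THEN iffD2]) (auto simp: dist_norm)
    have "T * measure unif_ball (ball v (1/4)) \<le> (\<integral>z. c + p \<bullet> (x + \<epsilon> *\<^sub>R z) - w (x + \<epsilon> *\<^sub>R z) \<partial>unif_ball)"
    proof (rule unif_ball_markov)
      show "(\<lambda>z. c + p \<bullet> (x + \<epsilon> *\<^sub>R z) - w (x + \<epsilon> *\<^sub>R z)) \<in> borel_measurable borel"
        using w(1) by measurable
      show "c + p \<bullet> (x + \<epsilon> *\<^sub>R z) - w (x + \<epsilon> *\<^sub>R z) \<le> c + norm p * (norm x + \<epsilon>) + b" if "norm z < 1" for z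
        using that by (rule B)
      show "T \<le> c + p \<bullet> (x + \<epsilon> *\<^sub>R z) - w (x + \<epsilon> *\<^sub>R z)" if "norm z < 1" "z \<in> ball v (1/4)" for z
        using that * by (meson not_less)
    qed (use le in auto)
    also have "\<dots> \<le> D * \<epsilon>\<^sup>2" by (rule i)
    finally have "T * (1 / 4) ^ CARD('n) \<le> D * \<epsilon>\<^sup>2" by (simp add: measure_unif_ball_subball[OF sub])
    moreover have "T * (1 / 4) ^ CARD('n) = 2 * (D * \<epsilon>\<^sup>2)" by (simp add: T_def power_divide)
    ultimately show False using D \<epsilon> by (simp add: zero_less_mult_iff)
  qed
  have n2: "norm ((1/2) *\<^sub>R e) = 1 / 2" "norm ((-1/2) *\<^sub>R e) = 1 / 2" using ne by auto
  obtain z1 where z1: "norm z1 < 1" "z1 \<in> ball ((1/2) *\<^sub>R e) (1/4)"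
      "c1 + p1 \<bullet> (x1 + \<epsilon> *\<^sub>R z1) - w (x1 + \<epsilon> *\<^sub>R z1) < T"
    using pick[OF n2(1) le(1) i(1)] by auto
  obtain z2 where z2: "norm z2 < 1" "z2 \<in> ball ((-1/2) *\<^sub>R e) (1/4)"
      "c2 + p2 \<bullet> (x2 + \<epsilon> *\<^sub>R z2) - w (x2 + \<epsilon> *\<^sub>R z2) < T"
    using pick[OF n2(2) le(4) i(2)] by auto
  have ee: "e \<bullet> e = 1" using ne by (simp add: power2_norm_eq_inner[symmetric])
  \<comment> \<open>The points lie within 1/4 of \<open>e / 2\<close> and \<open>- e / 2\<close>,
    hence differ by at least 1/2 along \<open>e\<close>. After scaling by \<epsilon>, the distance
    of \<open>x1\<close> from \<open>x2\<close> uses up half of that.\<close>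
  have "\<bar>e \<bullet> ((1/2) *\<^sub>R e - z1)\<bar> \<le> 1/4" "\<bar>e \<bullet> ((-1/2) *\<^sub>R e - z2)\<bar> \<le> 1/4"
    using z1(2) z2(2) ne by (intro order_trans[OF Cauchy_Schwarz_ineq2]; simp add: dist_norm)+
  then have "1 / 2 \<le> e \<bullet> (z1 - z2)"
    unfolding inner_diff_right inner_scaleR_right ee by linarith
  then have "\<epsilon> * (1 / 2) \<le> \<epsilon> * (e \<bullet> (z1 - z2))" using \<epsilon> by (intro mult_left_mono) auto
  moreover have "\<bar>e \<bullet> (x1 - x2)\<bar> \<le> \<epsilon> / 4"
    using x ne by (intro order_trans[OF Cauchy_Schwarz_ineq2]) simp
  moreover have "e \<bullet> ((x1 + \<epsilon> *\<^sub>R z1) - (x2 + \<epsilon> *\<^sub>R z2)) = e \<bullet> (x1 - x2) + \<epsilon> * (e \<bullet> (z1 - z2))"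
    by (simp add: inner_simps algebra_simps)
  ultimately have "\<epsilon> / 4 \<le> e \<bullet> ((x1 + \<epsilon> *\<^sub>R z1) - (x2 + \<epsilon> *\<^sub>R z2))" by linarith
  then have "norm (p1 - p2) * (\<epsilon> / 4) \<le> norm (p1 - p2) * (e \<bullet> ((x1 + \<epsilon> *\<^sub>R z1) - (x2 + \<epsilon> *\<^sub>R z2)))"
    by (intro mult_left_mono) auto
  also have "\<dots> = (p1 - p2) \<bullet> ((x1 + \<epsilon> *\<^sub>R z1) - (x2 + \<epsilon> *\<^sub>R z2))"
    using False by (simp add: e_def)
  also have "\<dots> < 2 * T"
    using z1(3) z2(3) le(2)[OF z1(1)] le(3)[OF z2(1)] by (simp add: inner_diff_left inner_diff_right)
  also have "\<dots> = 16 * 4 ^ CARD('n) * D * \<epsilon> * (\<epsilon> / 4)" by (simp add: T_def power2_eq_square)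
  finally show ?thesis using \<epsilon> by (simp only: mult_less_cancel_right)
qed

subsection \<open>The measure estimate\<close>

text \<open>\<open>W\<close> need not attain a maximum, hence the slack \<open>t\<close>. The bound
  on \<open>p\<close> makes the linear part vary by at most 1/4 on the ball of radius
  \<open>R\<close> and 3/4 on that of radius \<open>3 * R\<close>. The surplus 1 of
  \<open>W x0\<close> over \<open>l\<close> then gives \<open>c \<ge> l + 3 / 4\<close>, just enough
  for the affine function to dominate \<open>W\<close> up to \<open>3 * R\<close>, which leaves room
  for a step starting inside \<open>R\<close>.\<close>

lemma exists_near_max_of_affine_shift:
  fixes W :: "real ^ 'n \<Rightarrow> real"
  assumes R: "0 < R" and p: "norm p * (4 * R) \<le> 1" and t: "0 < t" and bd: "\<And>y. W y \<le> b"
    and out: "\<And>y. R \<le> norm y \<Longrightarrow> W y \<le> l" and x0: "norm x0 < R" "l + 1 \<le> W x0"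
  shows "\<exists>x c. norm x < R \<and> (\<forall>y\<in>ball 0 (3 * R). W y \<le> c + p \<bullet> y) \<and> c + p \<bullet> x - t < W x \<and> l + 3 / 4 \<le> c"
proof -
  define c where "c = (SUP y\<in>ball 0 R. W y - p \<bullet> y)"
  have pR: "norm p * (k * R) \<le> k / 4" if "0 \<le> k" for k
    using mult_left_mono[OF p that] by (simp add: algebra_simps)
  have py: "\<bar>p \<bullet> y\<bar> \<le> k / 4" if "norm y < k * R" "0 \<le> k" for y k
  proof -
    have "\<bar>p \<bullet> y\<bar> \<le> norm p * (k * R)"
      using that by (intro order_trans[OF Cauchy_Schwarz_ineq2] mult_left_mono) auto
    then show ?thesis using pR[OF that(2)] by linarith
  qed
  have bdd: "bdd_above ((\<lambda>y. W y - p \<bullet> y) ` ball 0 R)"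
  proof (intro bdd_aboveI2[where M="b + 1 / 4"])
    fix y :: "real ^ 'n" assume "y \<in> ball 0 R"
    then show "W y - p \<bullet> y \<le> b + 1 / 4" using bd[of y] py[of y 1] by auto
  qed
  have up: "W y - p \<bullet> y \<le> c" if "norm y < R" for y
    unfolding c_def using that by (intro cSUP_upper bdd) auto
  have c: "l + 3 / 4 \<le> c" using up[OF x0(1)] x0 py[of x0 1] by linarith
  have "c - t < c" using t by simp
  then obtain x where x: "x \<in> ball 0 R" "c - t < W x - p \<bullet> x"
    unfolding c_def using less_cSUP_iff[OF _ bdd] R by (metis centre_in_ball empty_iff)
  have "W y \<le> c + p \<bullet> y" if "y \<in> ball 0 (3 * R)" for y
  proof (cases "norm y < R")
    case False
    then show ?thesis using out[of y] c py[of y 3] that by auto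
  qed (use up[of y] in simp)
  with x c show ?thesis by (intro exI[of _ x] exI[of _ c]) auto
qed

context increments
begin

text \<open>The ball of radius \<epsilon>/8 carries a share \<open>1 / 8 ^ CARD('n)\<close> of the
  noise. If \<open>u\<close> were above the threshold on more than half of it, one step of noise
  would already force \<open>u x > M\<close>.\<close>

lemma supersol_sublevel_in_ball:
  fixes u :: "real ^ 'n \<Rightarrow> real"
  assumes u: "supersol \<epsilon> D u" and x: "x \<in> D" and \<epsilon>: "0 < \<epsilon>" and M: "0 < M" "u x \<le> M"
  shows "measure lborel (ball x (\<epsilon> / 8)) / 2
    \<le> measure lborel ({y. u y < 2 * 8 ^ CARD('n) * M / \<beta>} \<inter> ball x (\<epsilon> / 8))"
proof -
  define K where "K = 2 * 8 ^ CARD('n) * M / \<beta>"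
  have [measurable]: "u \<in> borel_measurable borel" by (rule supersolD[OF u])
  let ?B = "ball x (\<epsilon> / 8)"
  define E where "E = {y. K \<le> u y} \<inter> ?B"
  have E: "E \<in> sets borel" unfolding E_def by measurable
  have Eb: "E \<inter> ball x \<epsilon> = E" using \<epsilon> by (auto simp: E_def)
  have "\<beta> * K * measure lborel E \<le> u x * measure lborel (ball x \<epsilon>)"
    using supersol_ge_measure[OF u x \<epsilon> E, of K] M \<beta> by (auto simp: E_def[symmetric] Eb) (auto simp: E_def K_def)
  also have "\<dots> \<le> M * measure lborel (ball x \<epsilon>)" using M by (intro mult_right_mono) auto
  also have "measure lborel (ball x \<epsilon>) = 8 ^ CARD('n) * measure lborel ?B"
    using \<epsilon> by (simp add: content_ball power_divide)
  finally have "M * 8 ^ CARD('n) * (2 * measure lborel E) \<le> M * 8 ^ CARD('n) * measure lborel ?B"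
    using \<beta> by (simp add: K_def mult_ac)
  then have "2 * measure lborel E \<le> measure lborel ?B" using M by simp
  moreover have "measure lborel (?B - E) = measure lborel ?B - measure lborel E"
    using E by (intro measure_Diff) (use emeasure_lborel_ball_finite[of x "\<epsilon> / 8"] in \<open>auto simp: E_def\<close>)
  moreover have "?B - E = {y. u y < K} \<inter> ?B" by (auto simp: E_def)
  ultimately show ?thesis unfolding K_def by simp
qed

text \<open>A discrete Aleksandrov--Bakelman--Pucci argument. With \<open>W = M * gauss \<gamma> - u\<close>, every slope \<open>p\<close> of a
  grid of mesh \<open>\<kappa> * \<epsilon>\<close> has a point where \<open>W\<close> almost touches an affine function of slope \<open>p\<close> from below.
  The barrier keeps these points in a small ball, different slopes give points at distance more
  than \<open>\<epsilon> / 4\<close>, and the noise makes \<open>u\<close> bounded on half of a ball of radius \<open>\<epsilon> / 8\<close> around each of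
  them. Counting slopes replaces measuring the gradient image of a convex envelope.\<close>

lemma measure_estimate:
  "\<exists>K>0. \<exists>m>0. \<exists>\<epsilon>\<^sub>1>0. \<forall>\<epsilon> (u :: real ^ 'n \<Rightarrow> real) x0. 0 < \<epsilon> \<longrightarrow> \<epsilon> < \<epsilon>\<^sub>1
     \<longrightarrow> supersol \<epsilon> (ball 0 (2 * sqrt (real CARD('n)))) u \<longrightarrow> norm x0 \<le> 3 / 2 * sqrt (real CARD('n)) \<longrightarrow> u x0 \<le> 1
     \<longrightarrow> m \<le> measure lborel ({x. u x < K} \<inter> ball 0 (1 / 2))"
proof -
  define N where "N = real CARD('n)"
  have N: "1 \<le> N" by (simp add: N_def Suc_le_eq)
  define R where "R = 2 * sqrt N"
  \<comment> \<open>The centre of a child cube of side 1 is within \<open>r1\<close> of every point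
    of its parent, see \<open>dist_hcube_center_le\<close>; \<open>R\<close> is larger so that the
    barrier drops between the two radii.\<close>
  define r1 where "r1 = 3 / 2 * sqrt N"
  have R: "2 \<le> R" "0 \<le> r1" "r1 < R" using N by (auto simp: R_def r1_def)
  define b where "b = \<beta> * (1 / 4) ^ CARD('n) / 16"
  have b: "0 < b" "b \<le> 1"
  proof -
    show "0 < b" using \<beta> by (simp add: b_def)
    have "\<beta> * (1 / 4) ^ CARD('n) \<le> 1 * 1" using \<beta> by (intro mult_mono power_le_one) auto
    then show "b \<le> 1" by (simp add: b_def)
  qed
  \<comment> \<open>Chosen so that
    \<open>b * \<gamma> * (norm x)\<^sup>2 - \<Lambda>\<^sup>2 \<ge> 1\<close> as soon as
    \<open>norm x \<ge> 1 / 4\<close>.\<close>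
  define \<gamma> where "\<gamma> = 16 * (\<Lambda>\<^sup>2 + 1) / b"
  have \<gamma>: "1 \<le> \<gamma>"
  proof -
    have "1 \<le> 16 * (\<Lambda>\<^sup>2 + 1)" by simp
    with b(2) have "b \<le> 16 * (\<Lambda>\<^sup>2 + 1)" by (rule order_trans)
    then show ?thesis unfolding \<gamma>_def using b(1) by (simp add: le_divide_eq)
  qed
  define e where "e = exp (- \<gamma> * R\<^sup>2)"
  have e: "0 < e" "e < exp (- \<gamma> * r1\<^sup>2)"
    using R \<gamma> by (auto simp: e_def intro!: power_strict_mono)
  \<comment> \<open>The scaled barrier is at least 2 higher at radius \<open>r1\<close> than at
    radius \<open>R\<close>. As \<open>u x0 \<le> 1\<close>, this leaves the surplus 1 required by
    \<open>exists_near_max_of_affine_shift\<close>.\<close>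
  define M where "M = 2 / (exp (- \<gamma> * r1\<^sup>2) - e)"
  have M: "0 < M" using e by (simp add: M_def)
  have M2: "M * (exp (- \<gamma> * r1\<^sup>2) - e) = 2"
    unfolding M_def using e by (subst times_divide_eq_left, subst nonzero_mult_div_cancel_right) auto
  \<comment> \<open>The slack is \<open>\<eta> * \<epsilon>\<^sup>2\<close>, half of the gain
    \<open>M * e * \<epsilon>\<^sup>2\<close> guaranteed to the scaled barrier outside the quarter
    ball.\<close>
  define \<eta> where "\<eta> = M * e / 2"
  have \<eta>: "0 < \<eta>" using M e by (simp add: \<eta>_def)
  \<comment> \<open>Slack plus the worst loss of the barrier, divided by the weight of the noise:
    the bound on the average gap that \<open>touching_affine\<close> yields. The mesh constant
    \<kappa> is then the one of \<open>slope_separation\<close>.\<close>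
  define D where "D = (\<eta> + M * \<gamma> * \<Lambda>\<^sup>2) / \<beta>"
  have D: "0 < D" using \<eta> M \<gamma> \<beta> by (auto simp: D_def intro!: divide_pos_pos add_pos_nonneg)
  define \<kappa> where "\<kappa> = 16 * 4 ^ CARD('n) * D"
  have \<kappa>: "0 < \<kappa>" using D by (simp add: \<kappa>_def)
  define \<rho> where "\<rho> = 1 / (4 * R)"
  have \<rho>: "0 < \<rho>" using R by (simp add: \<rho>_def)
  define K where "K = 2 * 8 ^ CARD('n) * M / \<beta>"
  have K: "0 < K" using M \<beta> by (simp add: K_def)
  define \<omega> where "\<omega> = unit_ball_vol N"
  have \<omega>: "0 < \<omega>" using content_ball_pos[of 1 "0::real^'n"] content_ball[of 1 "0::real^'n"] by (simp add: \<omega>_def N_def)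
  \<comment> \<open>A lower bound for the number of grid slopes times half the volume of a ball of
    radius \<epsilon>/8; the powers of \<epsilon> cancel.\<close>
  define m where "m = \<omega> / 2 * (\<rho> / (8 * \<kappa> * N)) ^ CARD('n)"
  have m: "0 < m" using \<omega> \<rho> \<kappa> N by (simp add: m_def)
  \<comment> \<open>The first bound keeps steps shorter than 1, hence inside the ball of radius
    \<open>3 * R\<close>; the second gives \<open>\<gamma> * \<epsilon>\<^sup>2 + \<eta> *
    \<epsilon>\<^sup>2 \<le> 1 / 2\<close>.\<close>
  define \<epsilon>\<^sub>1 where "\<epsilon>\<^sub>1 = min (1 / \<Lambda>) (1 / (2 * \<gamma> + 2 * \<eta>))"
  have \<epsilon>1: "0 < \<epsilon>\<^sub>1" using \<Lambda> \<gamma> \<eta> by (simp add: \<epsilon>\<^sub>1_def)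
  have "m \<le> measure lborel ({x. u x < K} \<inter> ball 0 (1 / 2))"
    if \<epsilon>: "0 < \<epsilon>" "\<epsilon> < \<epsilon>\<^sub>1" and u: "supersol \<epsilon> (ball 0 R) u" and x0: "norm x0 \<le> r1" "u x0 \<le> 1"
    for \<epsilon> and u :: "real ^ 'n \<Rightarrow> real" and x0
  proof -
    have "\<epsilon> < 1 / \<Lambda>" "\<epsilon> < 1 / (2 * \<gamma> + 2 * \<eta>)" using \<epsilon> by (auto simp: \<epsilon>\<^sub>1_def)
    then have \<epsilon>\<Lambda>: "\<epsilon> * \<Lambda> \<le> 1" and "\<epsilon> * (2 * \<gamma> + 2 * \<eta>) \<le> 1"
      using \<Lambda> \<gamma> \<eta> by (simp_all add: less_divide_eq)
    have "\<epsilon> * 1 \<le> \<epsilon> * \<Lambda>" using \<epsilon> \<Lambda> by (intro mult_left_mono) auto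
    then have e1: "\<epsilon> \<le> 1" using \<epsilon>\<Lambda> by simp
    have "\<epsilon>\<^sup>2 * (2 * \<gamma> + 2 * \<eta>) \<le> 1 * 1"
      unfolding power2_eq_square mult.assoc using \<epsilon> e1 \<open>\<epsilon> * (2 * \<gamma> + 2 * \<eta>) \<le> 1\<close> \<gamma> \<eta> by (intro mult_mono) auto
    then have small: "\<gamma> * \<epsilon>\<^sup>2 + \<eta> * \<epsilon>\<^sup>2 \<le> 1 / 2" by (simp add: algebra_simps)
    have nn: "0 \<le> \<gamma> * \<epsilon>\<^sup>2" "0 \<le> \<eta> * \<epsilon>\<^sup>2" using \<gamma> \<eta> by auto
    obtain B where B: "\<And>x. u x \<le> B" using supersol_bound[OF u] by blast
    have u0: "\<And>x. 0 \<le> u x" and [measurable]: "u \<in> borel_measurable borel" using supersolD[OF u] by auto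
    let ?f = "\<lambda>y :: real ^ 'n. M * gauss \<gamma> y"
    define W where "W y = ?f y - u y" for y
    have Wm: "W \<in> borel_measurable borel" unfolding W_def by measurable
    have f: "0 < ?f y" "?f y \<le> M" for y
      using M gauss_pos[of \<gamma> y] gauss_le_1[of \<gamma> y] \<gamma> by (auto simp: mult_le_cancel_left1)
    have Wb: "\<bar>W y\<bar> \<le> M + B" "W y \<le> M" for y
      using f[of y] u0[of y] B[of y] by (auto simp: W_def)
    have gm: "step_mean \<alpha> \<beta> \<epsilon> \<mu> ?f x = M * step_mean \<alpha> \<beta> \<epsilon> \<mu> (gauss \<gamma>) x" for \<mu> x
      by (simp add: step_mean_def algebra_simps)
    have gain: "gauss \<gamma> x * (1 + \<gamma> * \<epsilon>\<^sup>2 * (b * \<gamma> * (norm x)\<^sup>2 - \<Lambda>\<^sup>2)) \<le> step_mean \<alpha> \<beta> \<epsilon> \<mu> (gauss \<gamma>) x"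
      if "\<mu> \<in> symmetric_measures \<Lambda>" for \<mu> and x :: "real ^ 'n"
      unfolding b_def using small nn \<gamma> \<epsilon> by (intro step_mean_gauss_ge that) auto
    have low: "?f x - M * \<gamma> * \<Lambda>\<^sup>2 * \<epsilon>\<^sup>2 \<le> step_mean \<alpha> \<beta> \<epsilon> \<mu> ?f x"
      if "\<mu> \<in> symmetric_measures \<Lambda>" for \<mu> x
    proof -
      have "- \<Lambda>\<^sup>2 \<le> b * \<gamma> * (norm x)\<^sup>2 - \<Lambda>\<^sup>2" using b \<gamma> by simp
      then have "\<gamma> * \<epsilon>\<^sup>2 * (- \<Lambda>\<^sup>2) \<le> \<gamma> * \<epsilon>\<^sup>2 * (b * \<gamma> * (norm x)\<^sup>2 - \<Lambda>\<^sup>2)"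
        using nn by (intro mult_left_mono)
      then have "gauss \<gamma> x * (1 + \<gamma> * \<epsilon>\<^sup>2 * (- \<Lambda>\<^sup>2)) \<le> gauss \<gamma> x * (1 + \<gamma> * \<epsilon>\<^sup>2 * (b * \<gamma> * (norm x)\<^sup>2 - \<Lambda>\<^sup>2))"
        using gauss_pos[of \<gamma> x] by (intro mult_left_mono) auto
      then have "gauss \<gamma> x * (1 + \<gamma> * \<epsilon>\<^sup>2 * (- \<Lambda>\<^sup>2)) \<le> step_mean \<alpha> \<beta> \<epsilon> \<mu> (gauss \<gamma>) x"
        using gain[OF that, of x] by linarith
      moreover have "gauss \<gamma> x * (\<gamma> * \<epsilon>\<^sup>2 * \<Lambda>\<^sup>2) \<le> 1 * (\<gamma> * \<epsilon>\<^sup>2 * \<Lambda>\<^sup>2)"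
        using gauss_le_1[of \<gamma> x] \<gamma> nn by (intro mult_right_mono) auto
      ultimately have "gauss \<gamma> x - \<gamma> * \<epsilon>\<^sup>2 * \<Lambda>\<^sup>2 \<le> step_mean \<alpha> \<beta> \<epsilon> \<mu> (gauss \<gamma>) x"
        by (simp add: algebra_simps)
      then have "M * (gauss \<gamma> x - \<gamma> * \<epsilon>\<^sup>2 * \<Lambda>\<^sup>2) \<le> M * step_mean \<alpha> \<beta> \<epsilon> \<mu> (gauss \<gamma>) x"
        using M by (intro mult_left_mono) auto
      then show ?thesis unfolding gm by (simp add: algebra_simps)
    qed
    have high: "?f x + \<eta> * \<epsilon>\<^sup>2 < step_mean \<alpha> \<beta> \<epsilon> \<mu> ?f x"
      if \<mu>: "\<mu> \<in> symmetric_measures \<Lambda>" and x: "1 / 4 \<le> norm x" "norm x < R" for \<mu> x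
    proof -
      have "(1 / 4)\<^sup>2 \<le> (norm x)\<^sup>2" using x by (intro power_mono) auto
      then have "b * \<gamma> * (1 / 4)\<^sup>2 \<le> b * \<gamma> * (norm x)\<^sup>2" using b \<gamma> by (intro mult_left_mono) auto
      moreover have "b * \<gamma> * (1 / 4)\<^sup>2 = \<Lambda>\<^sup>2 + 1" using b by (simp add: \<gamma>_def power2_eq_square)
      ultimately have "1 \<le> b * \<gamma> * (norm x)\<^sup>2 - \<Lambda>\<^sup>2" by linarith
      then have "\<gamma> * \<epsilon>\<^sup>2 * 1 \<le> \<gamma> * \<epsilon>\<^sup>2 * (b * \<gamma> * (norm x)\<^sup>2 - \<Lambda>\<^sup>2)"
        using nn by (intro mult_left_mono)
      moreover have "1 * \<epsilon>\<^sup>2 \<le> \<gamma> * \<epsilon>\<^sup>2" using \<gamma> by (intro mult_right_mono) auto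
      ultimately have "1 + \<epsilon>\<^sup>2 \<le> 1 + \<gamma> * \<epsilon>\<^sup>2 * (b * \<gamma> * (norm x)\<^sup>2 - \<Lambda>\<^sup>2)" by linarith
      then have "gauss \<gamma> x * (1 + \<epsilon>\<^sup>2) \<le> gauss \<gamma> x * (1 + \<gamma> * \<epsilon>\<^sup>2 * (b * \<gamma> * (norm x)\<^sup>2 - \<Lambda>\<^sup>2))"
        using gauss_pos[of \<gamma> x] by (intro mult_left_mono) auto
      then have "gauss \<gamma> x * (1 + \<epsilon>\<^sup>2) \<le> step_mean \<alpha> \<beta> \<epsilon> \<mu> (gauss \<gamma>) x"
        using gain[OF that(1), of x] by linarith
      moreover have "e \<le> gauss \<gamma> x" using x \<gamma> by (auto simp: e_def gauss_def intro!: power_mono)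
      then have "e * \<epsilon>\<^sup>2 \<le> gauss \<gamma> x * \<epsilon>\<^sup>2" by (intro mult_right_mono) auto
      moreover have "0 < e * \<epsilon>\<^sup>2" using e \<epsilon> by simp
      ultimately have "gauss \<gamma> x + e * \<epsilon>\<^sup>2 / 2 < step_mean \<alpha> \<beta> \<epsilon> \<mu> (gauss \<gamma>) x"
        by (simp add: algebra_simps)
      then have "M * (gauss \<gamma> x + e * \<epsilon>\<^sup>2 / 2) < M * step_mean \<alpha> \<beta> \<epsilon> \<mu> (gauss \<gamma>) x"
        using M by (intro mult_strict_left_mono) auto
      then show ?thesis unfolding gm by (simp add: algebra_simps \<eta>_def)
    qed
    define touches where "touches p x c \<longleftrightarrow> norm x < 1 / 4 \<and> u x \<le> M \<and> (\<forall>y\<in>ball 0 (3 * R). W y \<le> c + p \<bullet> y)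
        \<and> (\<integral>z. c + p \<bullet> (x + \<epsilon> *\<^sub>R z) - W (x + \<epsilon> *\<^sub>R z) \<partial>unif_ball) \<le> D * \<epsilon>\<^sup>2" for p x c
    have "\<exists>x c. touches p x c" if p: "norm p \<le> \<rho>" for p
    proof -
      have pR: "norm p * (4 * R) \<le> 1" using p R by (simp add: \<rho>_def field_simps)
      have out: "W y \<le> M * e" if "R \<le> norm y" for y
      proof -
        have "gauss \<gamma> y \<le> e" using that \<gamma> R by (auto simp: e_def gauss_def intro!: power_mono)
        then have "?f y \<le> M * e" using M by (intro mult_left_mono) auto
        then show ?thesis using u0[of y] by (simp add: W_def)
      qed
      have in0: "M * e + 1 \<le> W x0"
      proof -
        have "exp (- \<gamma> * r1\<^sup>2) \<le> gauss \<gamma> x0" using x0 \<gamma> by (auto simp: gauss_def intro!: power_mono)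
        then have "M * exp (- \<gamma> * r1\<^sup>2) \<le> ?f x0" using M by (intro mult_left_mono) auto
        then show ?thesis using M2 x0(2) by (simp add: W_def algebra_simps)
      qed
      have pos: "0 < R" "0 < \<eta> * \<epsilon>\<^sup>2" "norm x0 < R" using \<eta> \<epsilon> R x0 by auto
      then obtain x c where x: "norm x < R" and le: "\<And>y. y \<in> ball 0 (3 * R) \<Longrightarrow> W y \<le> c + p \<bullet> y"
        and ge: "c + p \<bullet> x - \<eta> * \<epsilon>\<^sup>2 < W x" and c: "M * e + 3 / 4 \<le> c"
        using exists_near_max_of_affine_shift[where W=W and l="M * e", OF pos(1) pR pos(2) Wb(2) out pos(3) in0] by blast
      obtain \<mu> where \<mu>: "\<mu> \<in> symmetric_measures \<Lambda>" "step_mean \<alpha> \<beta> \<epsilon> \<mu> u x \<le> u x"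
        using supersolD(3)[OF u, of x] x by auto
      have reach: "x + \<epsilon> *\<^sub>R z \<in> ball 0 (3 * R)" if "norm z < \<Lambda>" for z
      proof -
        have "\<epsilon> * norm z \<le> \<epsilon> * \<Lambda>" using that \<epsilon> by (intro mult_left_mono) auto
        moreover have "norm (x + \<epsilon> *\<^sub>R z) \<le> norm x + \<epsilon> * norm z"
          using norm_triangle_ineq[of x "\<epsilon> *\<^sub>R z"] \<epsilon> by simp
        ultimately have "norm (x + \<epsilon> *\<^sub>R z) < 3 * R" using x R \<epsilon>\<Lambda> by linarith
        then show ?thesis by simp
      qed
      have T: "\<beta> * (\<integral>z. c + p \<bullet> (x + \<epsilon> *\<^sub>R z) - W (x + \<epsilon> *\<^sub>R z) \<partial>unif_ball)
          \<le> \<eta> * \<epsilon>\<^sup>2 - (step_mean \<alpha> \<beta> \<epsilon> \<mu> ?f x - ?f x)"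
        unfolding W_def
      proof (rule touching_affine[OF \<mu>])
        show "?f (x + \<epsilon> *\<^sub>R z) - u (x + \<epsilon> *\<^sub>R z) \<le> c + p \<bullet> (x + \<epsilon> *\<^sub>R z)" if "norm z < \<Lambda>" for z
          using le[OF reach[OF that]] by (simp add: W_def)
        show "c + p \<bullet> x - \<eta> * \<epsilon>\<^sup>2 \<le> ?f x - u x" using ge by (simp add: W_def)
        show "\<bar>u y\<bar> \<le> B" for y using u0[of y] B[of y] by simp
        show "\<bar>?f y\<bar> \<le> M" for y using f[of y] by simp
      qed measurable
      have T0: "0 \<le> (\<integral>z. c + p \<bullet> (x + \<epsilon> *\<^sub>R z) - W (x + \<epsilon> *\<^sub>R z) \<partial>unif_ball)"
      proof (rule integral_nonneg_AE)
        have pos: "0 \<le> c + p \<bullet> (x + \<epsilon> *\<^sub>R z) - W (x + \<epsilon> *\<^sub>R z)" if "norm z < 1" for z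
          using le[OF reach[of z]] that \<Lambda> by simp
        show "AE z in unif_ball. 0 \<le> c + p \<bullet> (x + \<epsilon> *\<^sub>R z) - W (x + \<epsilon> *\<^sub>R z)"
          using AE_unif_ball by eventually_elim (rule pos)
      qed
      \<comment> \<open>The average gap is nonnegative, so \<open>T\<close> lets the barrier gain at
        most \<open>\<eta> * \<epsilon>\<^sup>2\<close> at \<open>x\<close>, whereas
        \<open>high\<close> provides more outside the quarter ball.\<close>
      have x4: "norm x < 1 / 4"
      proof (rule ccontr)
        assume "\<not> norm x < 1 / 4"
        then have "?f x + \<eta> * \<epsilon>\<^sup>2 < step_mean \<alpha> \<beta> \<epsilon> \<mu> ?f x" using high[OF \<mu>(1)] x by simp
        moreover have "0 \<le> \<beta> * (\<integral>z. c + p \<bullet> (x + \<epsilon> *\<^sub>R z) - W (x + \<epsilon> *\<^sub>R z) \<partial>unif_ball)"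
          using T0 \<beta> by simp
        ultimately show False using T by linarith
      qed
      have "\<beta> * (\<integral>z. c + p \<bullet> (x + \<epsilon> *\<^sub>R z) - W (x + \<epsilon> *\<^sub>R z) \<partial>unif_ball) \<le> \<eta> * \<epsilon>\<^sup>2 + M * \<gamma> * \<Lambda>\<^sup>2 * \<epsilon>\<^sup>2"
        using T low[OF \<mu>(1), of x] by linarith
      then have "(\<integral>z. c + p \<bullet> (x + \<epsilon> *\<^sub>R z) - W (x + \<epsilon> *\<^sub>R z) \<partial>unif_ball) \<le> D * \<epsilon>\<^sup>2"
        using \<beta> by (simp add: D_def field_simps)
      \<comment> \<open>The offset \<open>c\<close> exceeds 3/4, the linear term is at most 1/4 and
        the slack at most 1/2, so \<open>W x \<ge> 0\<close>, that is, \<open>u\<close> lies below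
        the barrier at \<open>x\<close>.\<close>
      moreover have "u x \<le> M"
      proof -
        have "\<bar>p \<bullet> x\<bar> \<le> norm p * R"
          using x by (intro order_trans[OF Cauchy_Schwarz_ineq2] mult_left_mono) auto
        then have "\<bar>p \<bullet> x\<bar> \<le> 1 / 4" using pR by (simp add: mult.left_commute)
        moreover have "0 < M * e" using M e by simp
        ultimately have "0 \<le> W x" using ge c small nn by linarith
        then show ?thesis using f[of x] by (simp add: W_def)
      qed
      ultimately have "touches p x c" using x4 le by (simp add: touches_def)
      then show ?thesis by blast
    qed
    then obtain X C where "touches p (X p) (C p)" if "norm p \<le> \<rho>" for p by metis
    then have X: "norm (X p) < 1 / 4" "u (X p) \<le> M"
      and XW: "y \<in> ball 0 (3 * R) \<Longrightarrow> W y \<le> C p + p \<bullet> y"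
      and XI: "(\<integral>z. C p + p \<bullet> (X p + \<epsilon> *\<^sub>R z) - W (X p + \<epsilon> *\<^sub>R z) \<partial>unif_ball) \<le> D * \<epsilon>\<^sup>2"
      if "norm p \<le> \<rho>" for p y
      using that by (auto simp: touches_def)
    have sep: "\<epsilon> / 4 < norm (X p - X q)" if p: "norm p \<le> \<rho>" and q: "norm q \<le> \<rho>" and pq: "\<kappa> * \<epsilon> \<le> norm (p - q)" for p q
    proof (rule ccontr)
      assume *: "\<not> ?thesis"
      have reach: "X p + \<epsilon> *\<^sub>R z \<in> ball 0 (3 * R)" if "norm p \<le> \<rho>" "norm z < 1" for p z
      proof -
        have "\<epsilon> * norm z \<le> 1 * 1" using that \<epsilon> e1 by (intro mult_mono) auto
        moreover have "norm (X p + \<epsilon> *\<^sub>R z) \<le> norm (X p) + \<epsilon> * norm z"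
          using norm_triangle_ineq[of "X p" "\<epsilon> *\<^sub>R z"] \<epsilon> by simp
        ultimately have "norm (X p + \<epsilon> *\<^sub>R z) < 3 * R" using X(1)[OF that(1)] R by linarith
        then show ?thesis by simp
      qed
      have "norm (p - q) < 16 * 4 ^ CARD('n) * D * \<epsilon>"
        using * by (intro slope_separation[OF Wm Wb(1) _ _ _ _ XI[OF p] XI[OF q] \<epsilon>(1) D]) (auto intro!: XW p q reach)
      then show False using pq by (simp add: \<kappa>_def)
    qed
    \<comment> \<open>Bounding the Euclidean norm by the sum of coordinates costs the factor
      \<open>N\<close>. The case \<open>n = 0\<close> is harmless: each coordinate has
      \<open>n + 1\<close> values, and this count is at least the unrounded quotient.\<close>
    define n where "n = nat \<lfloor>\<rho> / (\<kappa> * \<epsilon> * N)\<rfloor>"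
    have kN: "0 < \<kappa> * \<epsilon> * N" using \<kappa> \<epsilon> N by simp
    have n: "real n \<le> \<rho> / (\<kappa> * \<epsilon> * N)" "\<rho> / (\<kappa> * \<epsilon> * N) \<le> real n + 1"
      using \<rho> kN unfolding n_def by (simp_all add: of_nat_nat)
    define I where "I = PiE (UNIV :: 'n set) (\<lambda>_. {0..n})"
    define P :: "('n \<Rightarrow> nat) \<Rightarrow> real ^ 'n" where "P k = (\<chi> i. \<kappa> * \<epsilon> * real (k i))" for k
    have fI: "finite I" unfolding I_def by (intro finite_PiE) auto
    have cI: "card I = (n + 1) ^ CARD('n)" unfolding I_def by (subst card_PiE) auto
    have P\<rho>: "norm (P k) \<le> \<rho>" if "k \<in> I" for k
    proof -
      have "norm (P k) \<le> (\<Sum>i\<in>UNIV. \<bar>P k $ i\<bar>)" by (rule norm_le_l1_cart)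
      also have "\<dots> \<le> (\<Sum>i\<in>(UNIV :: 'n set). \<kappa> * \<epsilon> * real n)"
        using that \<kappa> \<epsilon> by (intro sum_mono) (auto simp: P_def I_def abs_mult PiE_iff)
      also have "\<dots> = \<kappa> * \<epsilon> * N * real n" by (simp add: N_def)
      also have "\<dots> \<le> \<rho>" using n(1) kN by (simp add: field_simps)
      finally show ?thesis .
    qed
    have Psep: "\<kappa> * \<epsilon> \<le> norm (P k - P l)" if kl: "k \<noteq> l" for k l
    proof -
      obtain i where "k i \<noteq> l i" using kl by (auto simp: fun_eq_iff)
      then have "1 \<le> \<bar>real (k i) - real (l i)\<bar>" by linarith
      then have "\<kappa> * \<epsilon> * 1 \<le> \<kappa> * \<epsilon> * \<bar>real (k i) - real (l i)\<bar>" using \<kappa> \<epsilon> by (intro mult_left_mono) auto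
      also have "\<dots> = \<bar>(P k - P l) $ i\<bar>" using \<kappa> \<epsilon> by (simp add: P_def abs_mult right_diff_distrib[symmetric])
      also have "\<dots> \<le> norm (P k - P l)" by (rule component_le_norm_cart)
      finally show ?thesis by simp
    qed
    \<comment> \<open>Touching points are more than \<epsilon>/4 apart, so balls of radius
      \<epsilon>/8 around them are disjoint; they stay inside radius 1/2 because \<epsilon> is at
      most 1.\<close>
    define G where "G k = {y. u y < K} \<inter> ball (X (P k)) (\<epsilon> / 8)" for k
    have Gm: "G k \<in> sets lborel" for k unfolding G_def by measurable
    have Gf: "emeasure lborel (G k) \<noteq> \<infinity>" for k
      using emeasure_mono[of "G k" "ball (X (P k)) (\<epsilon> / 8)" lborel] emeasure_lborel_ball_finite[of "X (P k)" "\<epsilon> / 8"]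
      by (auto simp: G_def top_unique)
    have disj: "disjoint_family_on G I"
    proof (unfold disjoint_family_on_def, intro ballI impI)
      fix k l assume kl: "k \<in> I" "l \<in> I" "k \<noteq> l"
      have "ball (X (P k)) (\<epsilon> / 8) \<inter> ball (X (P l)) (\<epsilon> / 8) = {}"
        using sep[OF P\<rho>[OF kl(1)] P\<rho>[OF kl(2)] Psep[OF kl(3)]] by (intro disjoint_ballI) (simp add: dist_norm)
      then show "G k \<inter> G l = {}" by (auto simp: G_def)
    qed
    have Gge: "\<omega> * (\<epsilon> / 8) ^ CARD('n) / 2 \<le> measure lborel (G k)" if "k \<in> I" for k
    proof -
      have "X (P k) \<in> ball 0 R" using X(1)[OF P\<rho>[OF that]] R by simp
      from supersol_sublevel_in_ball[OF u this \<epsilon>(1) M X(2)[OF P\<rho>[OF that]]]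
      show ?thesis using \<epsilon> by (simp add: G_def K_def content_ball \<omega>_def N_def)
    qed
    have "m = (\<rho> / (\<kappa> * \<epsilon> * N)) ^ CARD('n) * (\<omega> * (\<epsilon> / 8) ^ CARD('n) / 2)"
      using \<epsilon> by (simp add: m_def power_mult_distrib power_divide mult_ac)
    also have "\<dots> \<le> (real n + 1) ^ CARD('n) * (\<omega> * (\<epsilon> / 8) ^ CARD('n) / 2)"
      using n(2) \<rho> kN \<omega> \<epsilon> by (intro mult_right_mono power_mono) auto
    also have "\<dots> = (\<Sum>k\<in>I. \<omega> * (\<epsilon> / 8) ^ CARD('n) / 2)" by (simp add: cI add.commute)
    also have "\<dots> \<le> (\<Sum>k\<in>I. measure lborel (G k))" by (intro sum_mono Gge)
    also have "\<dots> = measure lborel (\<Union>k\<in>I. G k)"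
      using Gm Gf by (intro measure_finite_Union[symmetric] fI disj) auto
    also have "\<dots> \<le> measure lborel ({x. u x < K} \<inter> ball 0 (1 / 2))"
    proof (rule measure_mono_fmeasurable)
      show "(\<Union>k\<in>I. G k) \<subseteq> {x. u x < K} \<inter> ball 0 (1 / 2)"
      proof (intro UN_least)
        fix k assume k: "k \<in> I"
        have "ball (X (P k)) (\<epsilon> / 8) \<subseteq> ball 0 (1 / 2)"
          using X(1)[OF P\<rho>[OF k]] e1 by (intro ball_subset_ball_iff[THEN iffD2]) (auto simp: dist_norm)
        then show "G k \<subseteq> {x. u x < K} \<inter> ball 0 (1 / 2)" by (auto simp: G_def)
      qed
      show "(\<Union>k\<in>I. G k) \<in> sets lborel" using Gm fI by auto
      show "{x. u x < K} \<inter> ball 0 (1 / 2) \<in> fmeasurable lborel"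
      proof (subst Int_commute, rule fmeasurable_Int_fmeasurable)
        show "ball (0 :: real ^ 'n) (1 / 2) \<in> fmeasurable lborel"
          by (intro fmeasurableI) (use emeasure_lborel_ball_finite[of "0 :: real ^ 'n" "1 / 2"] in auto)
        show "{x. u x < K} \<in> sets lborel" by measurable
      qed
    qed
    finally show ?thesis .
  qed
  then show ?thesis using K m \<epsilon>1 unfolding R_def r1_def N_def by blast
qed

end

subsection \<open>Dyadic cubes\<close>

lemma norm_le_componentwise:
  fixes x :: "real ^ 'n"
  assumes "\<And>i. \<bar>x $ i\<bar> \<le> r"
  shows "norm x \<le> sqrt (real CARD('n)) * r"
proof -
  have r: "0 \<le> r" using assms[of undefined] by simp
  have "(norm x)\<^sup>2 = (\<Sum>i\<in>UNIV. (x $ i)\<^sup>2)"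
    unfolding power2_norm_eq_inner inner_vec_def by (simp add: power2_eq_square)
  also have "\<dots> \<le> (\<Sum>i\<in>(UNIV :: 'n set). r\<^sup>2)"
    by (intro sum_mono) (metis assms abs_ge_zero power2_abs power_mono)
  also have "\<dots> = (sqrt (real CARD('n)) * r)\<^sup>2" by (simp add: power_mult_distrib)
  finally show ?thesis by (rule power2_le_imp_le) (use r in simp)
qed

text \<open>Half-open, so that the children of a cube partition it exactly and no common faces need
  to be discarded.\<close>

definition hcube :: "real ^ 'n \<Rightarrow> real \<Rightarrow> (real ^ 'n) set" where
  "hcube a s = {y. \<forall>i. a $ i \<le> y $ i \<and> y $ i < a $ i + s}"

definition hcube_center :: "real ^ 'n \<Rightarrow> real \<Rightarrow> real ^ 'n" where
  "hcube_center a s = a + (\<chi> i. s / 2)"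

text \<open>Only lower corners are recorded; the children are the cubes of side \<open>s / 2\<close>
  at these corners.\<close>

definition hcube_children :: "real ^ 'n \<Rightarrow> real \<Rightarrow> (real ^ 'n) set" where
  "hcube_children a s = (\<lambda>v. a + (s / 2) *\<^sub>R v) ` {v. \<forall>i. v $ i = 0 \<or> v $ i = 1}"

lemma hcube_borel [measurable]: "hcube a s \<in> sets borel"
proof -
  have "hcube a s = (\<Inter>i. {y. a $ i \<le> y $ i} \<inter> {y. y $ i < a $ i + s})"
    by (auto simp: hcube_def)
  also have "\<dots> \<in> sets borel"
    by (intro sets.countable_INT'' sets.Int borel_closed borel_open closed_Collect_le open_Collect_less continuous_intros) auto
  finally show ?thesis .
qed

lemma hcube_between:
  "box a (a + (\<chi> i. s)) \<subseteq> hcube a s" "hcube a s \<subseteq> cbox a (a + (\<chi> i. s))"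
  by (auto simp: hcube_def mem_box_cart less_imp_le)

lemma emeasure_hcube_finite: "emeasure lborel (A \<inter> hcube a s) \<noteq> \<infinity>"
proof -
  have "emeasure lborel (A \<inter> hcube a s) \<le> emeasure lborel (cbox a (a + (\<chi> i. s)))"
    using hcube_between(2)[of a s] by (intro emeasure_mono) auto
  then show ?thesis using emeasure_lborel_cbox_finite[of a "a + (\<chi> i. s)"] by (auto simp: top_unique)
qed

lemma fmeasurable_Int_hcube: "A \<in> sets borel \<Longrightarrow> A \<inter> hcube a s \<in> fmeasurable lborel"
  using emeasure_hcube_finite[of A a s] by (intro fmeasurableI) (auto simp: top.not_eq_extremum)

lemma measure_hcube:
  fixes a :: "real ^ 'n"
  assumes s: "0 \<le> s"
  shows "measure lborel (hcube a s) = s ^ CARD('n)"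
proof -
  let ?b = "a + (\<chi> i. s)"
  have ne: "cbox a ?b \<noteq> {}" using s by (auto simp: interval_ne_empty_cart)
  have c: "measure lborel (cbox a ?b) = s ^ CARD('n)"
    using content_cbox_cart[OF ne] by simp
  have "measure lborel (cbox a ?b) = measure lborel (box a ?b)"
    by (simp add: measure_lborel_box_eq measure_lborel_cbox_eq)
  also have "\<dots> \<le> measure lborel (hcube a s)"
    using hcube_between(1)[of a s] fmeasurable_Int_hcube[of UNIV a s] by (intro measure_mono_fmeasurable) auto
  finally have "s ^ CARD('n) \<le> measure lborel (hcube a s)" by (simp add: c)
  moreover have "measure lborel (hcube a s) \<le> measure lborel (cbox a ?b)"
    using hcube_between(2)[of a s] by (intro measure_mono_fmeasurable) auto
  ultimately show ?thesis by (simp add: c)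
qed

lemma finite_hcube_children:
  fixes a :: "real ^ 'n"
  shows "finite (hcube_children a s)"
proof -
  have "{v :: real ^ 'n. \<forall>i. v $ i = 0 \<or> v $ i = 1} \<subseteq> vec_lambda ` PiE UNIV (\<lambda>_. {0, 1})"
  proof
    fix v :: "real ^ 'n" assume "v \<in> {v. \<forall>i. v $ i = 0 \<or> v $ i = 1}"
    then have "vec_nth v \<in> PiE UNIV (\<lambda>_. {0, 1})" by auto
    then have "vec_lambda (vec_nth v) \<in> vec_lambda ` PiE UNIV (\<lambda>_. {0, 1})" by (rule imageI)
    then show "v \<in> vec_lambda ` PiE UNIV (\<lambda>_. {0, 1})" by simp
  qed
  then have "finite {v :: real ^ 'n. \<forall>i. v $ i = 0 \<or> v $ i = 1}"
    by (rule finite_subset) (intro finite_imageI finite_PiE, auto)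
  then show ?thesis unfolding hcube_children_def by (rule finite_imageI)
qed

lemma hcube_child_nth:
  "c \<in> hcube_children a s \<Longrightarrow> c $ i = a $ i \<or> c $ i = a $ i + s / 2"
  by (auto simp: hcube_children_def)

lemma hcube_child_subset:
  assumes "c \<in> hcube_children a s" "0 < s" shows "hcube c (s / 2) \<subseteq> hcube a s"
proof
  fix y assume y: "y \<in> hcube c (s / 2)"
  show "y \<in> hcube a s"
    unfolding hcube_def
  proof (intro CollectI allI)
    fix i show "a $ i \<le> y $ i \<and> y $ i < a $ i + s"
      using hcube_child_nth[OF assms(1), of i] y assms(2) by (auto simp: hcube_def dest!: spec[of _ i])
  qed
qed

lemma hcube_eq_UN_children:
  assumes s: "0 < s" shows "hcube a s = (\<Union>c\<in>hcube_children a s. hcube c (s / 2))"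
proof
  show "hcube a s \<subseteq> (\<Union>c\<in>hcube_children a s. hcube c (s / 2))"
  proof
    fix y assume y: "y \<in> hcube a s"
    define v :: "real ^ 'a" where "v = (\<chi> i. if y $ i < a $ i + s / 2 then 0 else 1)"
    have "a + (s / 2) *\<^sub>R v \<in> hcube_children a s"
      unfolding hcube_children_def by (intro imageI) (auto simp: v_def)
    moreover have "y \<in> hcube (a + (s / 2) *\<^sub>R v) (s / 2)"
      unfolding hcube_def
    proof (intro CollectI allI)
      fix i
      have "a $ i \<le> y $ i \<and> y $ i < a $ i + s" using y by (simp add: hcube_def)
      then show "(a + (s / 2) *\<^sub>R v) $ i \<le> y $ i \<and> y $ i < (a + (s / 2) *\<^sub>R v) $ i + s / 2"
        by (auto simp: v_def)
    qed
    ultimately show "y \<in> (\<Union>c\<in>hcube_children a s. hcube c (s / 2))" by blast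
  qed
qed (use hcube_child_subset s in blast)

lemma disjoint_hcube_children:
  assumes s: "0 < s" shows "disjoint_family_on (\<lambda>c. hcube c (s / 2)) (hcube_children a s)"
  unfolding disjoint_family_on_def
proof (intro ballI impI)
  fix c d assume cd: "c \<in> hcube_children a s" "d \<in> hcube_children a s" "c \<noteq> d"
  then obtain i where i: "c $ i \<noteq> d $ i" by (auto simp: vec_eq_iff)
  show "hcube c (s / 2) \<inter> hcube d (s / 2) = {}"
  proof (rule equals0I)
    fix y assume "y \<in> hcube c (s / 2) \<inter> hcube d (s / 2)"
    then have "c $ i \<le> y $ i" "y $ i < c $ i + s / 2" "d $ i \<le> y $ i" "y $ i < d $ i + s / 2"
      by (auto simp: hcube_def)
    then show False
      using hcube_child_nth[OF cd(1), of i] hcube_child_nth[OF cd(2), of i] i s by auto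
  qed
qed

lemma measure_Int_hcube_eq_sum:
  fixes A :: "(real ^ 'n) set"
  assumes A: "A \<in> sets borel" and s: "0 < s"
  shows "measure lborel (A \<inter> hcube a s) = (\<Sum>c\<in>hcube_children a s. measure lborel (A \<inter> hcube c (s / 2)))"
proof -
  have "A \<inter> hcube a s = (\<Union>c\<in>hcube_children a s. A \<inter> hcube c (s / 2))"
    unfolding hcube_eq_UN_children[OF s, of a] by auto
  also have "measure lborel \<dots> = (\<Sum>c\<in>hcube_children a s. measure lborel (A \<inter> hcube c (s / 2)))"
  proof (rule measure_finite_Union)
    show "disjoint_family_on (\<lambda>c. A \<inter> hcube c (s / 2)) (hcube_children a s)"
      using disjoint_hcube_children[OF s, of a] by (auto simp: disjoint_family_on_def)
  qed (use A emeasure_hcube_finite finite_hcube_children in auto)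
  finally show ?thesis .
qed

lemma sum_measure_hcube_children:
  fixes a :: "real ^ 'n"
  assumes s: "0 < s"
  shows "(\<Sum>c\<in>hcube_children a s. (s / 2) ^ CARD('n)) = s ^ CARD('n)"
  using measure_Int_hcube_eq_sum[of UNIV s a] s by (simp add: measure_hcube)

text \<open>The density of a cube is the average of the densities of its children, so in each
  generation some child is at least as dense.\<close>

lemma dense_subcube:
  fixes a :: "real ^ 'n"
  assumes A: "A \<in> sets borel" and h: "0 < h"
    and dense: "\<eta> * (h * 2 ^ k) ^ CARD('n) \<le> measure lborel (A \<inter> hcube a (h * 2 ^ k))"
  shows "\<exists>c. hcube c h \<subseteq> hcube a (h * 2 ^ k) \<and> \<eta> * h ^ CARD('n) \<le> measure lborel (A \<inter> hcube c h)"
  using dense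
proof (induction k arbitrary: a)
  case 0 then show ?case by auto
next
  case (Suc k)
  let ?s = "h * 2 ^ Suc k"
  have s: "0 < ?s" "?s / 2 = h * 2 ^ k" using h by auto
  have "\<exists>c\<in>hcube_children a ?s. \<eta> * (h * 2 ^ k) ^ CARD('n) \<le> measure lborel (A \<inter> hcube c (h * 2 ^ k))"
  proof (rule ccontr)
    assume *: "\<not> ?thesis"
    have "hcube_children a ?s \<noteq> {}" using sum_measure_hcube_children[OF s(1), of a] s(1) by auto
    then have "(\<Sum>c\<in>hcube_children a ?s. measure lborel (A \<inter> hcube c (h * 2 ^ k)))
        < (\<Sum>c\<in>hcube_children a ?s. \<eta> * (h * 2 ^ k) ^ CARD('n))"
      using * by (intro sum_strict_mono finite_hcube_children) (auto simp: not_le)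
    also have "\<dots> = \<eta> * ?s ^ CARD('n)"
      using sum_measure_hcube_children[OF s(1), of a] unfolding s(2) by (simp only: sum_distrib_left[symmetric])
    finally show False
      using Suc.prems unfolding measure_Int_hcube_eq_sum[OF A s(1), of a] s(2) by linarith
  qed
  then obtain c where c: "c \<in> hcube_children a ?s" "\<eta> * (h * 2 ^ k) ^ CARD('n) \<le> measure lborel (A \<inter> hcube c (h * 2 ^ k))"
    by blast
  from Suc.IH[OF c(2)] hcube_child_subset[OF c(1) s(1)] show ?case unfolding s(2) by blast
qed

text \<open>Calderon--Zygmund decomposition stopped at side length \<open>h\<close>. Sparse cubes of the last
  generation are simply discarded, which costs the error term with \<open>\<eta>\<close>.\<close>

lemma dyadic_stopping:
  fixes A B Q :: "(real ^ 'n) set"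
  assumes A: "A \<in> sets borel" and B: "B \<in> sets borel" and h: "0 < h" and \<eta>: "0 \<le> \<eta>" and q: "0 \<le> q"
    and parent: "\<And>a k c. hcube a (h * 2 ^ Suc k) \<subseteq> Q \<Longrightarrow> c \<in> hcube_children a (h * 2 ^ Suc k) \<Longrightarrow>
      q * (h * 2 ^ k) ^ CARD('n) < measure lborel (A \<inter> hcube c (h * 2 ^ k)) \<Longrightarrow> hcube a (h * 2 ^ Suc k) \<subseteq> B"
    and smallest: "\<And>a. hcube a h \<subseteq> Q \<Longrightarrow> \<eta> * h ^ CARD('n) \<le> measure lborel (A \<inter> hcube a h) \<Longrightarrow> hcube a h \<subseteq> B"
    and Q: "hcube a (h * 2 ^ k) \<subseteq> Q"
    and sparse: "measure lborel (A \<inter> hcube a (h * 2 ^ k)) \<le> q * (h * 2 ^ k) ^ CARD('n)"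
  shows "measure lborel (A \<inter> hcube a (h * 2 ^ k))
    \<le> q * measure lborel (B \<inter> hcube a (h * 2 ^ k)) + \<eta> * (h * 2 ^ k) ^ CARD('n)"
  using Q sparse
proof (induction k arbitrary: a)
  case 0
  show ?case
  proof (cases "\<eta> * h ^ CARD('n) \<le> measure lborel (A \<inter> hcube a h)")
    case True
    \<comment> \<open>The cube lies in \<open>B\<close>, and its own sparseness, carried along the
      recursion, bounds the part of \<open>A\<close> in it by \<open>q\<close> times its
      volume.\<close>
    then have "B \<inter> hcube a h = hcube a h" using smallest[of a] 0 by auto
    moreover have "0 \<le> \<eta> * h ^ CARD('n)" using \<eta> h by simp
    ultimately show ?thesis using 0 h by (simp add: measure_hcube)
  next
    case False
    moreover have "0 \<le> q * measure lborel (B \<inter> hcube a h)" using q by simp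
    ultimately show ?thesis unfolding power_0 mult_1_right by linarith
  qed
next
  case (Suc k)
  let ?s = "h * 2 ^ Suc k"
  have s: "0 < ?s" "?s / 2 = h * 2 ^ k" using h by auto
  show ?case
  \<comment> \<open>Invariant: every cube that is visited is itself sparse. A dense child puts the
    whole parent into \<open>B\<close>, and sparseness of the parent gives the estimate
    there.\<close>
  proof (cases "\<exists>c\<in>hcube_children a ?s. q * (h * 2 ^ k) ^ CARD('n) < measure lborel (A \<inter> hcube c (h * 2 ^ k))")
    case True
    then have "B \<inter> hcube a ?s = hcube a ?s" using parent[OF Suc.prems(1)] by blast
    moreover have "measure lborel (hcube a ?s) = ?s ^ CARD('n)" using s by (intro measure_hcube) auto
    moreover have "0 \<le> \<eta> * ?s ^ CARD('n)" using \<eta> h by simp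
    ultimately show ?thesis using Suc.prems(2) by simp
  next
    case False
    \<comment> \<open>All children are sparse, so the recursion enters each of them. The error is
      proportional to volume and therefore does not accumulate over generations.\<close>
    have "measure lborel (A \<inter> hcube a ?s) = (\<Sum>c\<in>hcube_children a ?s. measure lborel (A \<inter> hcube c (h * 2 ^ k)))"
      unfolding measure_Int_hcube_eq_sum[OF A s(1)] s(2) ..
    also have "\<dots> \<le> (\<Sum>c\<in>hcube_children a ?s. q * measure lborel (B \<inter> hcube c (h * 2 ^ k)) + \<eta> * (h * 2 ^ k) ^ CARD('n))"
    proof (rule sum_mono)
      fix c assume c: "c \<in> hcube_children a ?s"
      show "measure lborel (A \<inter> hcube c (h * 2 ^ k)) \<le> q * measure lborel (B \<inter> hcube c (h * 2 ^ k)) + \<eta> * (h * 2 ^ k) ^ CARD('n)"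
        using False c hcube_child_subset[OF c s(1)] Suc.prems(1) unfolding s(2) by (intro Suc.IH) (auto simp: not_less)
    qed
    also have "\<dots> = q * measure lborel (B \<inter> hcube a ?s) + \<eta> * ?s ^ CARD('n)"
      unfolding sum.distrib measure_Int_hcube_eq_sum[OF B s(1)] sum_measure_hcube_children[OF s(1), of a, symmetric] s(2)
      by (simp only: sum_distrib_left)
    finally show ?thesis .
  qed
qed

text \<open>In each coordinate the farther face of the parent is one and a half child sides away
  from the centre of the child.\<close>

lemma dist_hcube_center_le:
  fixes y :: "real ^ 'n"
  assumes c: "c \<in> hcube_children a (2 * s)" and s: "0 < s" and y: "y \<in> hcube a (2 * s)"
  shows "dist (hcube_center c s) y \<le> 3 / 2 * sqrt (real CARD('n)) * s"
proof -
  have "norm (hcube_center c s - y) \<le> sqrt (real CARD('n)) * (3 / 2 * s)"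
  proof (rule norm_le_componentwise)
    fix i
    have "a $ i \<le> y $ i" "y $ i < a $ i + 2 * s" using y by (auto simp: hcube_def)
    moreover have "(hcube_center c s - y) $ i = c $ i + s / 2 - y $ i" by (simp add: hcube_center_def)
    ultimately show "\<bar>(hcube_center c s - y) $ i\<bar> \<le> 3 / 2 * s"
      using hcube_child_nth[OF c, of i] s unfolding abs_le_iff by auto
  qed
  then show ?thesis by (simp add: dist_norm mult_ac)
qed

lemma ball_hcube_center_subset: "ball (hcube_center a s) (s / 2) \<subseteq> hcube a s"
proof
  fix y assume "y \<in> ball (hcube_center a s) (s / 2)"
  then have *: "norm (hcube_center a s - y) < s / 2" by (simp add: dist_norm)
  have "\<bar>a $ i + s / 2 - y $ i\<bar> < s / 2" for i
    using component_le_norm_cart[of "hcube_center a s - y" i] * by (simp add: hcube_center_def)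
  then have "a $ i \<le> y $ i \<and> y $ i < a $ i + s" for i by (smt (verit) field_sum_of_halves)
  then show "y \<in> hcube a s" by (simp add: hcube_def)
qed

lemma hcube_center_in: "0 < s \<Longrightarrow> hcube_center a s \<in> hcube a s"
  by (simp add: hcube_def hcube_center_def)

lemma convex_hcube: "convex (hcube a s)"
proof -
  have "hcube a s = (\<Inter>i. {y. y $ i \<in> {a $ i..<a $ i + s}})" by (auto simp: hcube_def)
  moreover have "convex {y :: real ^ 'a. y $ i \<in> {b..<c}}" for i b c
  proof -
    have "convex ((\<lambda>y :: real ^ 'a. y $ i) -` {b..<c})"
      by (intro convex_linear_vimage convex_real_interval) (simp add: linear_iff)
    then show ?thesis by (simp add: vimage_def)
  qed
  ultimately show ?thesis by (simp add: convex_INT)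
qed

subsection \<open>Growth of the set where a supersolution is bounded below\<close>

context increments
begin

text \<open>Contrapositive of \<open>measure_estimate\<close>, rescaled to side \<open>s\<close>: a
  value of \<open>u\<close> below \<open>1 / K\<close> near the cube would make \<open>u < 1\<close>
  on a fixed fraction of it, leaving too little room for \<open>A\<close>.\<close>

lemma density_growth:
  "\<exists>c>0. \<exists>m>0. \<exists>\<epsilon>\<^sub>1>0. m < 1 \<and> (\<forall>\<epsilon> s a (u :: real ^ 'n \<Rightarrow> real) A x.
     0 < \<epsilon> \<longrightarrow> 0 < s \<longrightarrow> \<epsilon> < \<epsilon>\<^sub>1 * s
     \<longrightarrow> supersol \<epsilon> (ball (hcube_center a s) (2 * sqrt (real CARD('n)) * s)) u
     \<longrightarrow> A \<in> sets borel \<longrightarrow> (\<forall>y\<in>A. 1 \<le> u y) \<longrightarrow> (1 - m) * s ^ CARD('n) < measure lborel (A \<inter> hcube a s)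
     \<longrightarrow> dist (hcube_center a s) x \<le> 3 / 2 * sqrt (real CARD('n)) * s \<longrightarrow> c \<le> u x)"
proof -
  obtain K m0 \<epsilon>1 where K: "0 < K" and m0: "0 < m0" and \<epsilon>1: "0 < \<epsilon>1"
    and est: "\<forall>\<epsilon> (u :: real ^ 'n \<Rightarrow> real) x0. 0 < \<epsilon> \<longrightarrow> \<epsilon> < \<epsilon>1
     \<longrightarrow> supersol \<epsilon> (ball 0 (2 * sqrt (real CARD('n)))) u \<longrightarrow> norm x0 \<le> 3 / 2 * sqrt (real CARD('n)) \<longrightarrow> u x0 \<le> 1
     \<longrightarrow> m0 \<le> measure lborel ({x. u x < K} \<inter> ball 0 (1 / 2))"
    using measure_estimate[where 'n='n] by (elim exE conjE) (rule that)
  \<comment> \<open>The cap keeps \<open>1 - m\<close> positive, as is needed when it is divided out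
    in the iteration.\<close>
  define m where "m = min m0 (1 / 2)"
  have m: "0 < m" "m < 1" "m \<le> m0" using m0 by (auto simp: m_def)
  have main: "1 / K \<le> u x"
    if \<epsilon>: "0 < \<epsilon>" and s: "0 < s" and \<epsilon>s: "\<epsilon> < \<epsilon>1 * s"
      and u: "supersol \<epsilon> (ball (hcube_center a s) (2 * sqrt (real CARD('n)) * s)) u"
      and A: "A \<in> sets borel" "\<forall>y\<in>A. 1 \<le> u y"
      and dens: "(1 - m) * s ^ CARD('n) < measure lborel (A \<inter> hcube a s)"
      and x: "dist (hcube_center a s) x \<le> 3 / 2 * sqrt (real CARD('n)) * s"
    for \<epsilon> s a A x and u :: "real ^ 'n \<Rightarrow> real"
  proof (rule ccontr)
    assume *: "\<not> 1 / K \<le> u x"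
    define z where "z = hcube_center a s"
    define v where "v y = u (z + s *\<^sub>R y) / (1 / K)" for y
    have [measurable]: "u \<in> borel_measurable borel" by (rule supersolD[OF u])
    have "supersol (\<epsilon> / s) (ball 0 (2 * sqrt (real CARD('n)))) (\<lambda>y. u (z + s *\<^sub>R y))"
    proof (rule supersol_affine[OF u s])
      fix y :: "real ^ 'n" assume "y \<in> ball 0 (2 * sqrt (real CARD('n)))"
      then show "z + s *\<^sub>R y \<in> ball (hcube_center a s) (2 * sqrt (real CARD('n)) * s)"
        using s by (simp add: z_def dist_norm mult.commute)
    qed
    then have v: "supersol (\<epsilon> / s) (ball 0 (2 * sqrt (real CARD('n)))) v"
      unfolding v_def using K by (intro supersol_divide) auto
    have "norm ((1 / s) *\<^sub>R (x - z)) \<le> 3 / 2 * sqrt (real CARD('n))"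
      using x s by (simp add: z_def dist_norm norm_minus_commute divide_le_eq)
    moreover have "v ((1 / s) *\<^sub>R (x - z)) \<le> 1"
      using * K s by (simp add: v_def not_le less_divide_eq)
    moreover have "0 < \<epsilon> / s" "\<epsilon> / s < \<epsilon>1" using \<epsilon> s \<epsilon>s by (auto simp: divide_less_eq)
    ultimately have est: "m0 \<le> measure lborel ({x. v x < K} \<inter> ball 0 (1 / 2))"
      using est[rule_format, OF _ _ v] by blast
    \<comment> \<open>After scaling \<open>u\<close> by \<open>K\<close>, the sublevel set
      \<open>v < K\<close> of the measure estimate is exactly \<open>u < 1\<close>, which is
      disjoint from \<open>A\<close>.\<close>
    define E where "E = {y. u y < 1} \<inter> ball z (s / 2)"
    have E: "E \<in> sets borel" unfolding E_def by measurable
    have Eh: "E \<subseteq> hcube a s" using ball_hcube_center_subset[of a s] by (auto simp: E_def z_def)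
    have "{y. z + s *\<^sub>R y \<in> E} = {x. v x < K} \<inter> ball 0 (1 / 2)"
      using K s by (auto simp: E_def v_def dist_norm mult.commute less_divide_eq)
    then have "measure lborel E = s ^ CARD('n) * measure lborel ({x. v x < K} \<inter> ball 0 (1 / 2))"
      using measure_vimage_affine[OF E s, of z] by simp
    then have "s ^ CARD('n) * m \<le> measure lborel E"
      using est m s by (auto intro!: mult_left_mono)
    moreover have "measure lborel (A \<inter> hcube a s) + measure lborel E = measure lborel (A \<inter> hcube a s \<union> E)"
    proof (rule measure_Un3[THEN trans, symmetric])
      show "A \<inter> hcube a s \<in> fmeasurable lborel" by (rule fmeasurable_Int_hcube[OF A(1)])
      show "E \<in> fmeasurable lborel" using fmeasurable_Int_hcube[OF E, of a s] Eh by (simp add: Int_absorb2)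
      have "A \<inter> hcube a s \<inter> E = {}" using A(2) by (fastforce simp: E_def)
      then show "measure lborel (A \<inter> hcube a s) + measure lborel E - measure lborel (A \<inter> hcube a s \<inter> E)
          = measure lborel (A \<inter> hcube a s) + measure lborel E" by simp
    qed
    moreover have "measure lborel (A \<inter> hcube a s \<union> E) \<le> measure lborel (hcube a s)"
      using Eh A E fmeasurable_Int_hcube[of UNIV a s] by (intro measure_mono_fmeasurable) auto
    ultimately show False
      using dens s by (simp add: measure_hcube algebra_simps)
  qed
  show ?thesis
    by (intro exI[of _ "1 / K"] exI[of _ m] exI[of _ \<epsilon>1] conjI allI impI m \<epsilon>1 main) (use K in simp)
qed

section \<open>Propagation by the noise in cubes of side comparable to \<epsilon>\<close>

lemma noise_step:
  fixes u :: "real ^ 'n \<Rightarrow> real"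
  assumes u: "supersol \<epsilon> D u" and \<epsilon>: "0 < \<epsilon>" and t: "0 \<le> t" and z: "\<And>y. y \<in> ball z (\<epsilon> / 2) \<Longrightarrow> t \<le> u y"
    and zz: "dist z z' \<le> \<epsilon> / 2" and D: "ball z' (\<epsilon> / 2) \<subseteq> D" and x: "x \<in> ball z' (\<epsilon> / 2)"
  shows "\<beta> / 4 ^ CARD('n) * t \<le> u x"
proof -
  have xz: "dist z x < \<epsilon>" using zz x dist_triangle[of z x z'] by auto
  \<comment> \<open>A quarter of the way from \<open>z\<close> to \<open>x\<close>: the ball of
    radius \<epsilon>/4 around it fits both into the ball where \<open>u\<close> is known to be
    large and into the range of the noise from \<open>x\<close>. Its share of the noise is the
    factor \<open>1 / 4 ^ CARD('n)\<close>.\<close>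
  define w where "w = z + (1 / 4) *\<^sub>R (x - z)"
  have "dist z w = dist z x / 4" by (simp add: w_def dist_norm norm_minus_commute)
  moreover have "x - w = (3 / 4) *\<^sub>R (x - z)" by (simp add: w_def algebra_simps scaleR_left_distrib[symmetric])
  then have "dist x w = 3 / 4 * dist z x" by (simp add: dist_norm norm_minus_commute)
  ultimately have sub: "ball w (\<epsilon> / 4) \<subseteq> ball z (\<epsilon> / 2)" "ball w (\<epsilon> / 4) \<subseteq> ball x \<epsilon>"
    using xz by (auto simp: ball_subset_ball_iff dist_commute)
  have "\<beta> * t * measure lborel (ball w (\<epsilon> / 4) \<inter> ball x \<epsilon>) \<le> u x * measure lborel (ball x \<epsilon>)"
    using D x sub(1) z by (intro supersol_ge_measure[OF u _ \<epsilon> _ _ t]) auto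
  then have "(\<beta> / 4 ^ CARD('n) * t) * measure lborel (ball x \<epsilon>) \<le> u x * measure lborel (ball x \<epsilon>)"
    using sub(2) \<epsilon> by (simp add: Int_absorb2 content_ball power_divide mult_ac)
  then show ?thesis using content_ball_pos[OF \<epsilon>, of x] by (rule mult_right_le_imp_le)
qed

text \<open>Carries the bound along the segment by \<open>k\<close> equal shifts, each of length at
  most \<epsilon>/2; the case \<open>k = 0\<close> is separate because the shifts divide by
  \<open>k\<close>.\<close>

lemma noise_chain:
  fixes u :: "real ^ 'n \<Rightarrow> real"
  assumes u: "supersol \<epsilon> D u" and \<epsilon>: "0 < \<epsilon>" and t: "0 \<le> t" and z: "\<And>y. y \<in> ball z (\<epsilon> / 2) \<Longrightarrow> t \<le> u y"
    and k: "dist z x \<le> real k * (\<epsilon> / 2)" and D: "\<And>w. w \<in> closed_segment z x \<Longrightarrow> ball w (\<epsilon> / 2) \<subseteq> D"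
  shows "(\<beta> / 4 ^ CARD('n)) ^ k * t \<le> u x"
proof (cases "k = 0")
  case True
  then show ?thesis using k z[of x] \<epsilon> by simp
next
  case False
  define p where "p j = z + (real j / real k) *\<^sub>R (x - z)" for j
  have step: "dist (p j) (p (Suc j)) \<le> \<epsilon> / 2" for j
  proof -
    have "p j - p (Suc j) = (- 1 / real k) *\<^sub>R (x - z)"
      by (simp add: p_def scaleR_diff_left[symmetric] diff_divide_distrib[symmetric])
    then have "dist (p j) (p (Suc j)) = dist z x / real k" by (simp add: dist_norm norm_minus_commute)
    then show ?thesis using k False by (simp add: divide_le_eq mult.commute)
  qed
  have "\<forall>y\<in>ball (p j) (\<epsilon> / 2). (\<beta> / 4 ^ CARD('n)) ^ j * t \<le> u y" if "j \<le> k" for j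
    using that
  proof (induction j)
    case 0 then show ?case using z by (simp add: p_def)
  next
    case (Suc j)
    have "p (Suc j) \<in> closed_segment z x"
      unfolding in_segment using Suc.prems False
      by (intro exI[of _ "real (Suc j) / real k"]) (auto simp: p_def algebra_simps divide_le_eq)
    then have sub: "ball (p (Suc j)) (\<epsilon> / 2) \<subseteq> D" by (rule D)
    have t': "0 \<le> (\<beta> / 4 ^ CARD('n)) ^ j * t" using \<beta> t by simp
    show ?case
    proof
      fix y assume "y \<in> ball (p (Suc j)) (\<epsilon> / 2)"
      with noise_step[OF u \<epsilon> t' _ step sub this] Suc show "(\<beta> / 4 ^ CARD('n)) ^ Suc j * t \<le> u y"
        by (simp add: mult.assoc)
    qed
  qed
  from this[of k] show ?thesis using \<epsilon> False by (simp add: p_def)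
qed

text \<open>At this scale any positive density suffices. Some subcube of diameter at most
  \<epsilon>/4 is dense enough, it is within reach of one noise step from a whole ball of radius
  \<epsilon>/2, and a chain of such balls crosses the cube. The numbers of halvings and of links
  depend on \<open>C\<close> and the dimension, not on \<epsilon>.\<close>

lemma small_scale_growth:
  assumes C: "1 \<le> C" and \<eta>: "0 < \<eta>"
  shows "\<exists>c>0. \<forall>\<epsilon> s a (u :: real ^ 'n \<Rightarrow> real) A D x. 0 < \<epsilon> \<longrightarrow> \<epsilon> \<le> s \<longrightarrow> s \<le> C * \<epsilon> \<longrightarrow> supersol \<epsilon> D u
    \<longrightarrow> (\<forall>w\<in>hcube a s. ball w (\<epsilon> / 2) \<subseteq> D) \<longrightarrow> A \<in> sets borel \<longrightarrow> (\<forall>y\<in>A. 1 \<le> u y)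
    \<longrightarrow> \<eta> * s ^ CARD('n) \<le> measure lborel (A \<inter> hcube a s) \<longrightarrow> x \<in> hcube a s \<longrightarrow> c \<le> u x"
proof -
  define N where "N = sqrt (real CARD('n))"
  have N: "1 \<le> N" by (simp add: N_def Suc_le_eq)
  \<comment> \<open>After \<open>J\<close> halvings the diameter is at most \<epsilon>/4.\<close>
  obtain J where J: "4 * N * C < 2 ^ J" using real_arch_pow[of 2 "4 * N * C"] by auto
  define \<omega> where "\<omega> = unit_ball_vol (real CARD('n))"
  have \<omega>: "0 < \<omega>" using content_ball_pos[of 1 "0::real^'n"] content_ball[of 1 "0::real^'n"] by (simp add: \<omega>_def)
  \<comment> \<open>The lower bound after one noise step into the dense subcube, using that its side
    is at least \<open>\<epsilon> / 2 ^ J\<close>.\<close>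
  define t where "t = \<beta> * \<eta> / (\<omega> * (2 ^ J) ^ CARD('n))"
  have t: "0 < t" using \<beta> \<eta> \<omega> by (simp add: t_def)
  \<comment> \<open>The cube has diameter at most \<open>N * C * \<epsilon>\<close>, so
    \<open>k\<close> shifts of length \<epsilon>/2 cross it.\<close>
  obtain k :: nat where k: "2 * N * C \<le> real k" using real_arch_simple by blast
  define c where "c = (\<beta> / 4 ^ CARD('n)) ^ k * t"
  have c: "0 < c" using \<beta> t by (simp add: c_def)
  have main: "c \<le> u x"
    if \<epsilon>: "0 < \<epsilon>" and s: "\<epsilon> \<le> s" "s \<le> C * \<epsilon>" and u: "supersol \<epsilon> D u"
      and D: "\<forall>w\<in>hcube a s. ball w (\<epsilon> / 2) \<subseteq> D" and A: "A \<in> sets borel" "\<forall>y\<in>A. 1 \<le> u y"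
      and dens: "\<eta> * s ^ CARD('n) \<le> measure lborel (A \<inter> hcube a s)" and x: "x \<in> hcube a s"
    for \<epsilon> s a A D x and u :: "real ^ 'n \<Rightarrow> real"
  proof -
    have diam: "dist y y' \<le> N * r" if "y \<in> hcube b r" "y' \<in> hcube b r" for y y' b :: "real ^ 'n" and r :: real
      unfolding dist_norm N_def
    proof (rule norm_le_componentwise)
      fix i
      have "b $ i \<le> y $ i \<and> y $ i < b $ i + r" "b $ i \<le> y' $ i \<and> y' $ i < b $ i + r"
        using that by (auto simp: hcube_def)
      then show "\<bar>(y - y') $ i\<bar> \<le> r" by auto
    qed
    define h where "h = s / 2 ^ J"
    have h: "0 < h" "h * 2 ^ J = s" using \<epsilon> s by (auto simp: h_def)
    obtain b where b: "hcube b h \<subseteq> hcube a s" "\<eta> * h ^ CARD('n) \<le> measure lborel (A \<inter> hcube b h)"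
      using dense_subcube[OF A(1) h(1), of \<eta> J a] dens unfolding h(2) by blast
    have bb: "b \<in> hcube b h" using h by (simp add: hcube_def)
    have Nh: "N * h \<le> \<epsilon> / 4"
    proof -
      have "4 * N * s \<le> 4 * N * (C * \<epsilon>)" using N s by (intro mult_left_mono) auto
      also have "\<dots> = 4 * N * C * \<epsilon>" by simp
      also have "\<dots> \<le> 2 ^ J * \<epsilon>" using J \<epsilon> by (intro mult_right_mono) auto
      finally show ?thesis by (simp add: h_def field_simps)
    qed
    have "t \<le> u y" if y: "y \<in> ball b (\<epsilon> / 2)" for y
    proof -
      have sub: "hcube b h \<subseteq> ball y \<epsilon>"
      proof
        fix q assume "q \<in> hcube b h"
        then have "dist b q \<le> \<epsilon> / 4" using diam[OF bb] Nh by force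
        then show "q \<in> ball y \<epsilon>" using y dist_triangle[of y q b] \<epsilon> by (auto simp: dist_commute)
      qed
      have yD: "y \<in> D" using D bb b(1) y by blast
      have "\<beta> * 1 * measure lborel ((A \<inter> hcube b h) \<inter> ball y \<epsilon>) \<le> u y * measure lborel (ball y \<epsilon>)"
        using A by (intro supersol_ge_measure[OF u yD \<epsilon>]) auto
      also have "(A \<inter> hcube b h) \<inter> ball y \<epsilon> = A \<inter> hcube b h" using sub by auto
      finally have 1: "\<beta> * measure lborel (A \<inter> hcube b h) \<le> u y * (\<omega> * \<epsilon> ^ CARD('n))"
        using \<epsilon> by (simp add: content_ball \<omega>_def)
      have "\<epsilon> / 2 ^ J \<le> h" using s by (simp add: h_def divide_right_mono)
      then have "\<beta> * (\<eta> * (\<epsilon> / 2 ^ J) ^ CARD('n)) \<le> \<beta> * (\<eta> * h ^ CARD('n))"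
        using \<beta> \<eta> \<epsilon> by (intro mult_left_mono power_mono) auto
      also have "\<dots> \<le> \<beta> * measure lborel (A \<inter> hcube b h)" using b(2) \<beta> by (intro mult_left_mono) auto
      also note 1
      also have "\<beta> * (\<eta> * (\<epsilon> / 2 ^ J) ^ CARD('n)) = t * (\<omega> * \<epsilon> ^ CARD('n))"
        using \<omega> by (simp add: t_def power_divide)
      finally show ?thesis using \<omega> \<epsilon> by simp
    qed
    moreover have "dist b x \<le> real k * (\<epsilon> / 2)"
    proof -
      have "dist b x \<le> N * s" using diam[of b a s x] b(1) bb x by auto
      also have "\<dots> \<le> N * (C * \<epsilon>)" using N s by (intro mult_left_mono) auto
      also have "\<dots> = (2 * N * C) * (\<epsilon> / 2)" by simp
      also have "\<dots> \<le> real k * (\<epsilon> / 2)" using k \<epsilon> by (intro mult_right_mono) auto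
      finally show ?thesis .
    qed
    moreover have "ball w (\<epsilon> / 2) \<subseteq> D" if "w \<in> closed_segment b x" for w
      using D closed_segment_subset[OF _ x convex_hcube, of b] b(1) bb that by blast
    ultimately show ?thesis unfolding c_def using t by (intro noise_chain[OF u \<epsilon>]) auto
  qed
  show ?thesis by (intro exI[of _ c] conjI allI impI c main)
qed

section \<open>Iteration in the unit cube\<close>

abbreviation unit_hcube :: "(real ^ 'n) set" where
  "unit_hcube \<equiv> hcube (\<chi> i. - (1 / 2)) 1"

lemma norm_unit_hcube: "x \<in> unit_hcube \<Longrightarrow> norm (x :: real ^ 'n) \<le> sqrt (real CARD('n)) * (1 / 2)"
proof (rule norm_le_componentwise)
  fix i assume "x \<in> unit_hcube"
  then have "- (1 / 2) \<le> x $ i \<and> x $ i < - (1 / 2) + 1" by (simp add: hcube_def)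
  then show "\<bar>x $ i\<bar> \<le> 1 / 2" by linarith
qed

text \<open>The order of quantifiers matters: \<open>c\<close>, \<open>m\<close> and the range of
  \<epsilon> are fixed before \<eta>, and only \<open>c'\<close> depends on \<eta>. The iteration
  can thus adapt \<eta> to the current measure without shrinking the range of \<epsilon>.\<close>

lemma measure_growth:
  "\<exists>c>0. \<exists>m>0. \<exists>\<epsilon>\<^sub>0>0. m < 1 \<and> (\<forall>\<eta>>0. \<exists>c'>0. \<forall>\<epsilon> (u :: real ^ 'n \<Rightarrow> real) A.
     0 < \<epsilon> \<longrightarrow> \<epsilon> < \<epsilon>\<^sub>0 \<longrightarrow> supersol \<epsilon> (ball 0 (5 * sqrt (real CARD('n)))) u \<longrightarrow> A \<in> sets borel \<longrightarrow> (\<forall>y\<in>A. 1 \<le> u y)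
     \<longrightarrow> (1 - m < measure lborel (A \<inter> unit_hcube) \<longrightarrow> (\<forall>x\<in>unit_hcube. c \<le> u x))
       \<and> (measure lborel (A \<inter> unit_hcube) \<le> 1 - m \<longrightarrow>
           measure lborel (A \<inter> unit_hcube) \<le> (1 - m) * measure lborel ({y. c' \<le> u y} \<inter> unit_hcube) + \<eta>))"
proof -
  define N where "N = sqrt (real CARD('n))"
  have N: "1 \<le> N" by (simp add: N_def Suc_le_eq)
  obtain c m \<epsilon>1 where c: "0 < c" and m: "0 < m" "m < 1" and \<epsilon>1: "0 < \<epsilon>1"
    and growth: "\<forall>\<epsilon> s a (u :: real ^ 'n \<Rightarrow> real) A x. 0 < \<epsilon> \<longrightarrow> 0 < s \<longrightarrow> \<epsilon> < \<epsilon>1 * s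
     \<longrightarrow> supersol \<epsilon> (ball (hcube_center a s) (2 * N * s)) u
     \<longrightarrow> A \<in> sets borel \<longrightarrow> (\<forall>y\<in>A. 1 \<le> u y) \<longrightarrow> (1 - m) * s ^ CARD('n) < measure lborel (A \<inter> hcube a s)
     \<longrightarrow> dist (hcube_center a s) x \<le> 3 / 2 * N * s \<longrightarrow> c \<le> u x"
    using density_growth[where 'n='n, folded N_def] by (elim exE conjE) (rule that)
  define \<epsilon>0 where "\<epsilon>0 = min \<epsilon>1 1"
  have \<epsilon>0: "0 < \<epsilon>0" "\<epsilon>0 \<le> \<epsilon>1" "\<epsilon>0 \<le> 1" using \<epsilon>1 by (auto simp: \<epsilon>0_def)
  have main: "\<exists>c'>0. \<forall>\<epsilon> (u :: real ^ 'n \<Rightarrow> real) A.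
     0 < \<epsilon> \<longrightarrow> \<epsilon> < \<epsilon>0 \<longrightarrow> supersol \<epsilon> (ball 0 (5 * N)) u \<longrightarrow> A \<in> sets borel \<longrightarrow> (\<forall>y\<in>A. 1 \<le> u y)
     \<longrightarrow> (1 - m < measure lborel (A \<inter> unit_hcube) \<longrightarrow> (\<forall>x\<in>unit_hcube. c \<le> u x))
       \<and> (measure lborel (A \<inter> unit_hcube) \<le> 1 - m \<longrightarrow>
           measure lborel (A \<inter> unit_hcube) \<le> (1 - m) * measure lborel ({y. c' \<le> u y} \<inter> unit_hcube) + \<eta>)"
    if \<eta>: "0 < \<eta>" for \<eta>
  proof -
    have "1 \<le> 2 / \<epsilon>0" using \<epsilon>0 by (simp add: le_divide_eq)
    from small_scale_growth[OF this \<eta>, where 'n='n]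
    obtain c2 where c2: "0 < c2"
      and small: "\<forall>\<epsilon> s a (u :: real ^ 'n \<Rightarrow> real) A D x. 0 < \<epsilon> \<longrightarrow> \<epsilon> \<le> s \<longrightarrow> s \<le> 2 / \<epsilon>0 * \<epsilon> \<longrightarrow> supersol \<epsilon> D u
        \<longrightarrow> (\<forall>w\<in>hcube a s. ball w (\<epsilon> / 2) \<subseteq> D) \<longrightarrow> A \<in> sets borel \<longrightarrow> (\<forall>y\<in>A. 1 \<le> u y)
        \<longrightarrow> \<eta> * s ^ CARD('n) \<le> measure lborel (A \<inter> hcube a s) \<longrightarrow> x \<in> hcube a s \<longrightarrow> c2 \<le> u x"
      by (elim exE conjE) (rule that)
    define c' where "c' = min c c2"
    have c': "0 < c'" using c c2 by (simp add: c'_def)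
    have *: "(1 - m < measure lborel (A \<inter> unit_hcube) \<longrightarrow> (\<forall>x\<in>unit_hcube. c \<le> u x))
       \<and> (measure lborel (A \<inter> unit_hcube) \<le> 1 - m \<longrightarrow>
           measure lborel (A \<inter> unit_hcube) \<le> (1 - m) * measure lborel ({y. c' \<le> u y} \<inter> unit_hcube) + \<eta>)"
      if \<epsilon>: "0 < \<epsilon>" "\<epsilon> < \<epsilon>0" and u: "supersol \<epsilon> (ball 0 (5 * N)) u" and A: "A \<in> sets borel" "\<forall>y\<in>A. 1 \<le> u y"
      for \<epsilon> A and u :: "real ^ 'n \<Rightarrow> real"
    proof (intro conjI impI ballI)
      have [measurable]: "u \<in> borel_measurable borel" by (rule supersolD[OF u])
      have A2: "\<And>y. y \<in> A \<Longrightarrow> 1 \<le> u y" using A(2) by blast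
      have big: "supersol \<epsilon> (ball (hcube_center a s) (2 * N * s)) u"
        if "0 < s" "s \<le> 1" "hcube a s \<subseteq> unit_hcube" for a s
      proof (rule supersol_mono[OF u])
        have "norm (hcube_center a s) \<le> N * (1 / 2)"
          using hcube_center_in[OF that(1), of a] that(3) norm_unit_hcube unfolding N_def by blast
        moreover have "2 * N * s \<le> 2 * N * 1" using that N by (intro mult_left_mono) auto
        ultimately have "norm (hcube_center a s) + 2 * N * s \<le> 5 * N" using N by linarith
        then show "ball (hcube_center a s) (2 * N * s) \<subseteq> ball 0 (5 * N)"
          by (simp add: ball_subset_ball_iff)
      qed
      { fix x :: "real ^ 'n" assume dens: "1 - m < measure lborel (A \<inter> unit_hcube)" and x: "x \<in> unit_hcube"
        show "c \<le> u x"
        proof (rule growth[rule_format, OF \<epsilon>(1) _ _ big A(1) A2])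
          have "hcube_center (\<chi> i. - (1 / 2)) 1 = (0 :: real ^ 'n)" by (simp add: hcube_center_def vec_eq_iff)
          then show "dist (hcube_center (\<chi> i. - (1 / 2)) 1) x \<le> 3 / 2 * N * 1"
            using norm_unit_hcube[OF x] N by (simp add: N_def[symmetric])
        qed (use dens \<epsilon> \<epsilon>0 in auto) }
      assume sparse: "measure lborel (A \<inter> unit_hcube) \<le> 1 - m"
      \<comment> \<open>\<open>L\<close> is the first generation whose side is at most
        \<open>\<epsilon> / \<epsilon>0\<close>, and subdivision stops one generation earlier. There
        the side \<open>h\<close> exceeds \<open>\<epsilon> / \<epsilon>0\<close>, so that
        \<open>growth\<close> applies at every scale used, and is at most twice that, so that
        \<open>small\<close> applies with \<open>2 / \<epsilon>0\<close>.\<close>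
      define P where "P k \<longleftrightarrow> (1 / 2) ^ k \<le> \<epsilon> / \<epsilon>0" for k :: nat
      obtain k0 where k0: "P k0"
        unfolding P_def using real_arch_pow_inv[of "\<epsilon> / \<epsilon>0" "1 / 2"] \<epsilon> \<epsilon>0 by (auto intro: less_imp_le)
      define L where "L = (LEAST k. P k)"
      have L: "P L" "\<And>k. k < L \<Longrightarrow> \<not> P k" unfolding L_def using LeastI[of P, OF k0] not_less_Least by auto
      have "L \<noteq> 0"
      proof
        assume "L = 0"
        with L(1) have "1 \<le> \<epsilon> / \<epsilon>0" by (simp add: P_def)
        then show False using \<epsilon> \<epsilon>0 by (simp add: le_divide_eq)
      qed
      then obtain n where n: "L = Suc n" by (cases L) auto
      define h :: real where "h = (1 / 2) ^ n"
      have h: "0 < h" "\<epsilon> < \<epsilon>0 * h" "h \<le> 2 / \<epsilon>0 * \<epsilon>" "h * 2 ^ n = 1"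
        using L(2)[of n] L(1) \<epsilon>0 unfolding n P_def h_def
        by (auto simp: not_le divide_less_eq field_simps power_divide)
      have "\<epsilon>0 * h \<le> 1 * h" using \<epsilon>0 h by (intro mult_right_mono) auto
      then have \<epsilon>h: "\<epsilon> \<le> h" using h(2) by linarith
      \<comment> \<open>The stopping lemma only tells that a cube lies in the unit cube; comparing
        volumes recovers the bound on its side that \<open>big\<close> requires.\<close>
      have side: "s \<le> 1" if "0 < s" "hcube a s \<subseteq> (unit_hcube :: (real ^ 'n) set)" for a s
      proof (rule ccontr)
        assume "\<not> s \<le> 1"
        then have "1 < s ^ CARD('n)" by (intro one_less_power) auto
        moreover have "measure lborel (hcube a s) \<le> measure lborel (unit_hcube :: (real ^ 'n) set)"
          using that fmeasurable_Int_hcube[of UNIV] by (intro measure_mono_fmeasurable) auto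
        ultimately show False using that by (simp add: measure_hcube)
      qed
      have "measure lborel (A \<inter> hcube (\<chi> i. - (1 / 2)) (h * 2 ^ n))
        \<le> (1 - m) * measure lborel ({y. c' \<le> u y} \<inter> hcube (\<chi> i. - (1 / 2)) (h * 2 ^ n)) + \<eta> * (h * 2 ^ n) ^ CARD('n)"
      proof (rule dyadic_stopping[where Q=unit_hcube, OF A(1) _ h(1)])
        show "{y. c' \<le> u y} \<in> sets borel" by measurable
        fix a k d
        assume sub: "hcube a (h * 2 ^ Suc k) \<subseteq> unit_hcube" and d: "d \<in> hcube_children a (h * 2 ^ Suc k)"
          and dens: "(1 - m) * (h * 2 ^ k) ^ CARD('n) < measure lborel (A \<inter> hcube d (h * 2 ^ k))"
        let ?s = "h * 2 ^ k"
        have s2: "h * 2 ^ Suc k = 2 * ?s" "2 * ?s / 2 = ?s" by auto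
        have s: "0 < ?s" "0 < 2 * ?s" using h by auto
        have ds: "hcube d ?s \<subseteq> unit_hcube"
          using hcube_child_subset[OF d] sub s unfolding s2 by auto
        have "\<epsilon>0 * h * 1 \<le> \<epsilon>1 * h * 2 ^ k" using \<epsilon>0 h by (intro mult_mono) auto
        then have es: "\<epsilon> < \<epsilon>1 * ?s" using h(2) by (simp only: mult.assoc mult_1_right)
        show "hcube a (h * 2 ^ Suc k) \<subseteq> {y. c' \<le> u y}"
        proof
          fix y assume "y \<in> hcube a (h * 2 ^ Suc k)"
          then have "dist (hcube_center d ?s) y \<le> 3 / 2 * N * ?s"
            using dist_hcube_center_le[of d a ?s y] d s unfolding s2 N_def by auto
          then have "c \<le> u y"
            using growth[rule_format, OF \<epsilon>(1) s(1) es big[OF s(1) side[OF s(1) ds] ds] A(1) A2 dens] by blast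
          then show "y \<in> {y. c' \<le> u y}" by (simp add: c'_def)
        qed
      next
        fix a assume sub: "hcube a h \<subseteq> unit_hcube" and dens: "\<eta> * h ^ CARD('n) \<le> measure lborel (A \<inter> hcube a h)"
        have balls: "ball w (\<epsilon> / 2) \<subseteq> ball 0 (5 * N)" if "w \<in> hcube a h" for w
        proof -
          have "norm w \<le> N * (1 / 2)" using that norm_unit_hcube sub unfolding N_def by blast
          then show ?thesis using N \<epsilon> \<epsilon>0 by (simp add: ball_subset_ball_iff)
        qed
        show "hcube a h \<subseteq> {y. c' \<le> u y}"
        proof
          fix y assume "y \<in> hcube a h"
          from small[rule_format, OF \<epsilon>(1) \<epsilon>h h(3) u balls A(1) A2 dens this]
          show "y \<in> {y. c' \<le> u y}" by (simp add: c'_def)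
        qed
      qed (use \<eta> m sparse in \<open>simp_all add: h(4)\<close>)
      then show "measure lborel (A \<inter> unit_hcube) \<le> (1 - m) * measure lborel ({y. c' \<le> u y} \<inter> unit_hcube) + \<eta>"
        unfolding h(4) by simp
    qed
    show ?thesis by (intro exI[of _ c'] conjI[OF c'] allI impI *)
  qed
  show ?thesis
    unfolding N_def[symmetric]
    by (intro exI[of _ c] exI[of _ m] exI[of _ \<epsilon>0] conjI[OF c] conjI[OF m(1)] conjI[OF \<epsilon>0(1)] conjI[OF m(2)] allI impI main)
qed

text \<open>While the set is sparse, passing from \<open>A\<close> to the superlevel set of
  \<open>c'\<close>, and from \<open>u\<close> to \<open>u / c'\<close>, multiplies the lower bound
  for the measure by \<open>1 + m / 2\<close>; once it exceeds \<open>1 - m\<close>, the dense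
  alternative ends the argument. The number of rounds depends only on \<delta> and
  \<open>m\<close>.\<close>

theorem supersol_lower_bound:
  "\<exists>\<epsilon>\<^sub>0>0. \<forall>\<delta>>0. \<exists>c>0. \<forall>\<epsilon> (u :: real ^ 'n \<Rightarrow> real) A.
     0 < \<epsilon> \<longrightarrow> \<epsilon> < \<epsilon>\<^sub>0 \<longrightarrow> supersol \<epsilon> (ball 0 (5 * sqrt (real CARD('n)))) u \<longrightarrow> A \<in> sets borel \<longrightarrow> (\<forall>y\<in>A. 1 \<le> u y)
     \<longrightarrow> \<delta> \<le> measure lborel (A \<inter> unit_hcube) \<longrightarrow> (\<forall>x\<in>unit_hcube. c \<le> u x)"
proof -
  let ?D = "ball (0 :: real ^ 'n) (5 * sqrt (real CARD('n)))"
  obtain c m \<epsilon>0 where c: "0 < c" and m: "0 < m" "m < 1" and \<epsilon>0: "0 < \<epsilon>0"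
    and growth: "\<forall>\<eta>>0. \<exists>c'>0. \<forall>\<epsilon> (u :: real ^ 'n \<Rightarrow> real) A.
     0 < \<epsilon> \<longrightarrow> \<epsilon> < \<epsilon>0 \<longrightarrow> supersol \<epsilon> ?D u \<longrightarrow> A \<in> sets borel \<longrightarrow> (\<forall>y\<in>A. 1 \<le> u y)
     \<longrightarrow> (1 - m < measure lborel (A \<inter> unit_hcube) \<longrightarrow> (\<forall>x\<in>unit_hcube. c \<le> u x))
       \<and> (measure lborel (A \<inter> unit_hcube) \<le> 1 - m \<longrightarrow>
           measure lborel (A \<inter> unit_hcube) \<le> (1 - m) * measure lborel ({y. c' \<le> u y} \<inter> unit_hcube) + \<eta>)"
    using measure_growth[where 'n='n] by (elim exE conjE) (rule that)
  define P where "P \<delta> \<longleftrightarrow> (\<exists>c>0. \<forall>\<epsilon> (u :: real ^ 'n \<Rightarrow> real) A. 0 < \<epsilon> \<longrightarrow> \<epsilon> < \<epsilon>0 \<longrightarrow> supersol \<epsilon> ?D u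
     \<longrightarrow> A \<in> sets borel \<longrightarrow> (\<forall>y\<in>A. 1 \<le> u y) \<longrightarrow> \<delta> \<le> measure lborel (A \<inter> unit_hcube)
     \<longrightarrow> (\<forall>x\<in>unit_hcube. c \<le> u x))" for \<delta>
  have step: "P \<delta>" if \<delta>: "0 < \<delta>" and next_P: "P (\<delta> * (1 + m / 2)) \<or> 1 - m < \<delta>" for \<delta>
  proof -
    \<comment> \<open>With this error, \<open>\<delta> - \<eta> = \<delta> * (1 - m / 2)\<close>,
      which is at least \<open>(1 - m) * (\<delta> * (1 + m / 2))\<close>; dividing by
      \<open>1 - m\<close> yields the growth factor.\<close>
    define \<eta> where "\<eta> = m * \<delta> / 2"
    have \<eta>: "0 < \<eta>" using m \<delta> by (simp add: \<eta>_def)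
    obtain c' where c': "0 < c'" and G: "\<forall>\<epsilon> (u :: real ^ 'n \<Rightarrow> real) A.
        0 < \<epsilon> \<longrightarrow> \<epsilon> < \<epsilon>0 \<longrightarrow> supersol \<epsilon> ?D u \<longrightarrow> A \<in> sets borel \<longrightarrow> (\<forall>y\<in>A. 1 \<le> u y)
        \<longrightarrow> (1 - m < measure lborel (A \<inter> unit_hcube) \<longrightarrow> (\<forall>x\<in>unit_hcube. c \<le> u x))
       \<and> (measure lborel (A \<inter> unit_hcube) \<le> 1 - m \<longrightarrow>
           measure lborel (A \<inter> unit_hcube) \<le> (1 - m) * measure lborel ({y. c' \<le> u y} \<inter> unit_hcube) + \<eta>)"
      using growth[THEN spec, THEN mp, OF \<eta>] by (elim exE conjE) (rule that)
    define Q where "Q d \<longleftrightarrow> (\<forall>\<epsilon> (u :: real ^ 'n \<Rightarrow> real) A. 0 < \<epsilon> \<longrightarrow> \<epsilon> < \<epsilon>0 \<longrightarrow> supersol \<epsilon> ?D u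
     \<longrightarrow> A \<in> sets borel \<longrightarrow> (\<forall>y\<in>A. 1 \<le> u y) \<longrightarrow> \<delta> * (1 + m / 2) \<le> measure lborel (A \<inter> unit_hcube)
     \<longrightarrow> (\<forall>x\<in>unit_hcube. d \<le> u x))" for d
    \<comment> \<open>If \<delta> already exceeds \<open>1 - m\<close>, the sparse case below cannot
      occur and any positive \<open>d\<close>, here 1, will do.\<close>
    have "\<exists>d>0. 1 - m < \<delta> \<or> Q d"
      using next_P zero_less_one unfolding P_def Q_def[symmetric] by blast
    then obtain d where d: "0 < d" and dP: "1 - m < \<delta> \<or> Q d" by blast
    have main: "min c (c' * d) \<le> u x"
      if \<epsilon>: "0 < \<epsilon>" "\<epsilon> < \<epsilon>0" and u: "supersol \<epsilon> ?D u" and A: "A \<in> sets borel" "\<forall>y\<in>A. 1 \<le> u y"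
        and dens: "\<delta> \<le> measure lborel (A \<inter> unit_hcube)" and x: "x \<in> unit_hcube"
      for \<epsilon> A x and u :: "real ^ 'n \<Rightarrow> real"
    proof (cases "1 - m < measure lborel (A \<inter> unit_hcube)")
      case True
      then show ?thesis using G[THEN spec, THEN spec, THEN spec, THEN mp, THEN mp, THEN mp, THEN mp, THEN mp, OF \<epsilon> u A] x by (simp add: min_le_iff_disj)
    next
      case False
      have [measurable]: "u \<in> borel_measurable borel" by (rule supersolD[OF u])
      let ?B = "{y. 1 \<le> u y / c'}"
      have B: "?B = {y. c' \<le> u y}" using c' by (auto simp: le_divide_eq)
      have "measure lborel (A \<inter> unit_hcube) \<le> (1 - m) * measure lborel (?B \<inter> unit_hcube) + \<eta>"
        unfolding B using G[THEN spec, THEN spec, THEN spec, THEN mp, THEN mp, THEN mp, THEN mp, THEN mp, OF \<epsilon> u A] False by (simp add: not_less)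
      then have "\<delta> - \<eta> \<le> (1 - m) * measure lborel (?B \<inter> unit_hcube)" using dens by linarith
      moreover have "(1 - m) * (\<delta> * (1 + m / 2)) \<le> \<delta> - \<eta>"
      proof -
        have "0 \<le> \<delta> * (m * m)" using \<delta> by simp
        then show ?thesis by (simp add: \<eta>_def algebra_simps)
      qed
      ultimately have "(1 - m) * (\<delta> * (1 + m / 2)) \<le> (1 - m) * measure lborel (?B \<inter> unit_hcube)" by linarith
      then have "\<delta> * (1 + m / 2) \<le> measure lborel (?B \<inter> unit_hcube)" using m by simp
      moreover have "\<not> 1 - m < \<delta>" using False dens by linarith
      moreover have "supersol \<epsilon> ?D (\<lambda>y. u y / c')" by (rule supersol_divide[OF u c'])
      moreover have "?B \<in> sets borel" by measurable
      ultimately have "d \<le> u x / c'" using dP \<epsilon> x unfolding Q_def by blast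
      then show ?thesis using c' by (simp add: le_divide_eq min_le_iff_disj mult.commute)
    qed
    have "0 < min c (c' * d)" using c c' d by simp
    from main show ?thesis unfolding P_def
      by (intro exI[of _ "min c (c' * d)"] conjI[OF \<open>0 < min c (c' * d)\<close>] allI impI ballI)
  qed
  \<comment> \<open>The induction runs downwards in \<delta>: large values are settled by the dense
    alternative, smaller ones by one round of growth.\<close>
  have "P \<delta>" if "0 < \<delta>" "1 - m < \<delta> * (1 + m / 2) ^ k" for k \<delta>
    using that
  proof (induction k arbitrary: \<delta>)
    case 0 then show ?case using step by simp
  next
    case (Suc k)
    have "P (\<delta> * (1 + m / 2))" using Suc.prems m by (intro Suc.IH) (auto simp: mult.assoc)
    then show ?case using step Suc.prems(1) by blast
  qed
  moreover have "\<exists>k. 1 - m < \<delta> * (1 + m / 2) ^ k" if "0 < \<delta>" for \<delta>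
    using real_arch_pow[of "1 + m / 2" "(1 - m) / \<delta>"] m that by (auto simp: divide_less_eq mult.commute)
  ultimately have "P \<delta>" if "0 < \<delta>" for \<delta> using that by blast
  then have "\<forall>\<delta>>0. P \<delta>" by blast
  then show ?thesis unfolding P_def by (intro exI[of _ \<epsilon>0] conjI[OF \<epsilon>0])
qed

end

subsection \<open>Hitting probabilities\<close>

text \<open>The kernel is prescribed through its values on Borel sets; the standard induction over
  measurable functions turns this into the formula behind \<open>step_mean\<close>.\<close>

lemma nn_integral_kernel:
  fixes \<nu> :: "real ^ 'n \<Rightarrow> (real ^ 'n) measure"
  assumes \<nu>: "\<nu> y \<in> symmetric_measures L" and \<beta>: "0 \<le> \<beta>" "\<beta> \<le> 1" "\<alpha> = 1 - \<beta>" and \<epsilon>: "0 < \<epsilon>"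
    and \<kappa>: "prob_space \<kappa>" "sets \<kappa> = sets borel" "\<And>E. E \<in> sets borel \<Longrightarrow> measure \<kappa> E = transition_prob \<alpha> \<beta> \<epsilon> \<nu> y E"
    and f: "f \<in> borel_measurable borel"
  shows "(\<integral>\<^sup>+z. f z \<partial>\<kappa>) = ennreal \<alpha> * (\<integral>\<^sup>+z. f (y + \<epsilon> *\<^sub>R z) \<partial>\<nu> y) + ennreal \<beta> * (\<integral>\<^sup>+z. f (y + \<epsilon> *\<^sub>R z) \<partial>unif_ball)"
proof -
  let ?T = "\<lambda>z :: real ^ 'n. y + \<epsilon> *\<^sub>R z"
  let ?U = "unif_ball :: (real ^ 'n) measure"
  have "?T \<in> M \<rightarrow>\<^sub>M borel" if "sets M = sets borel" for M
    unfolding measurable_cong_sets[OF that refl] by measurable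
  then have T: "?T \<in> \<nu> y \<rightarrow>\<^sub>M borel" "?T \<in> ?U \<rightarrow>\<^sub>M borel"
    using symmetric_measuresD(2)[OF \<nu>] symmetric_measuresD(2)[OF unif_ball_symmetric[where 'n='n]] by auto
  interpret \<kappa>: prob_space \<kappa> by fact
  interpret \<nu>: prob_space "\<nu> y" by (rule symmetric_measuresD[OF \<nu>])
  interpret U: prob_space ?U by (rule symmetric_measuresD[OF unif_ball_symmetric])
  have sp: "space \<kappa> = UNIV" using sets_eq_imp_space_eq[OF \<kappa>(2)] by simp
  have fT: "(\<lambda>z. g (?T z)) \<in> borel_measurable (\<nu> y)" "(\<lambda>z. g (?T z)) \<in> borel_measurable ?U" "g \<in> borel_measurable \<kappa>"
    if "g \<in> borel_measurable borel" for g :: "real ^ 'n \<Rightarrow> ennreal"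
    using measurable_compose[OF T(1) that] measurable_compose[OF T(2) that] that \<kappa>(2) by (auto cong: measurable_cong_sets)
  show ?thesis
    using f
  proof (induction rule: borel_measurable_induct)
    case (cong f g)
    then show ?case by (simp cong: nn_integral_cong)
  next
    case (set E)
    then have E: "E \<in> sets borel" by simp
    have img: "(\<lambda>z. (1 / \<epsilon>) *\<^sub>R (z - y)) ` E = {z. ?T z \<in> E}"
    proof safe
      fix w assume "?T w \<in> E"
      then show "w \<in> (\<lambda>z. (1 / \<epsilon>) *\<^sub>R (z - y)) ` E"
        using \<epsilon> by (intro image_eqI[where x="?T w"]) auto
    qed (use \<epsilon> in simp)
    have m: "{z. ?T z \<in> E} \<in> sets borel"
      using measurable_sets[of ?T borel borel E] E by (simp add: vimage_def)
    have "measure lborel (ball y \<epsilon>) = measure lborel (ball (0 :: real ^ 'n) \<epsilon>)"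
      using \<epsilon> by (simp add: content_ball)
    then have "measure \<kappa> E = \<alpha> * measure (\<nu> y) {z. ?T z \<in> E} + \<beta> * measure ?U {z. ?T z \<in> E}"
      unfolding \<kappa>(3)[OF E] transition_prob_def img measure_unif_ball_affine[OF E \<epsilon>] by simp
    then have "emeasure \<kappa> E = ennreal \<alpha> * emeasure (\<nu> y) {z. ?T z \<in> E} + ennreal \<beta> * emeasure ?U {z. ?T z \<in> E}"
      using \<beta> by (simp add: \<kappa>.emeasure_eq_measure \<nu>.emeasure_eq_measure U.emeasure_eq_measure ennreal_mult)
    moreover have "(\<integral>\<^sup>+z. indicator E (?T z) \<partial>M) = emeasure M {z. ?T z \<in> E}" if "sets M = sets borel" for M
    proof -
      have "(\<lambda>z. indicator E (?T z) :: ennreal) = indicator {z. ?T z \<in> E}" by (auto simp: indicator_def)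
      then show ?thesis using m that by simp
    qed
    ultimately show ?case
      using E \<kappa>(2) by (simp add: symmetric_measuresD(2)[OF \<nu>] symmetric_measuresD(2)[OF unif_ball_symmetric])
  next
    case (mult f c)
    then show ?case using fT[OF mult(2)] by (simp add: nn_integral_cmult algebra_simps)
  next
    case (add f g)
    then show ?case using fT[OF add(1)] fT[OF add(3)] by (simp add: nn_integral_add algebra_simps)
  next
    case (seq F)
    have inc: "incseq (\<lambda>i z. F i (?T z))" using seq(3) by (auto simp: incseq_def le_fun_def)
    have "(\<integral>\<^sup>+z. (SUP i. F i) z \<partial>\<kappa>) = (SUP i. \<integral>\<^sup>+z. F i z \<partial>\<kappa>)"
      unfolding SUP_apply using seq(3) fT(3)[OF seq(1)] by (intro nn_integral_monotone_convergence_SUP) auto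
    also have "\<dots> = (SUP i. ennreal \<alpha> * (\<integral>\<^sup>+z. F i (?T z) \<partial>\<nu> y) + ennreal \<beta> * (\<integral>\<^sup>+z. F i (?T z) \<partial>?U))"
      by (simp add: seq.IH)
    also have "\<dots> = ennreal \<alpha> * (SUP i. \<integral>\<^sup>+z. F i (?T z) \<partial>\<nu> y) + ennreal \<beta> * (SUP i. \<integral>\<^sup>+z. F i (?T z) \<partial>?U)"
      using inc by (subst ennreal_SUP_add)
        (auto simp: SUP_mult_left_ennreal intro!: mult_left_mono nn_integral_mono simp: incseq_def le_fun_def)
    also have "\<dots> = ennreal \<alpha> * (\<integral>\<^sup>+z. (SUP i. F i) (?T z) \<partial>\<nu> y) + ennreal \<beta> * (\<integral>\<^sup>+z. (SUP i. F i) (?T z) \<partial>?U)"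
      unfolding SUP_apply using inc fT[OF seq(1)]
      by (subst (1 2) nn_integral_monotone_convergence_SUP) auto
    finally show ?case .
  qed
qed

text \<open>Value iteration: the probability, from \<open>x\<close>, of reaching \<open>A\<close> in
  at most \<open>n\<close> steps with all earlier positions in \<open>D\<close>. It refers to the
  kernel only, so its measurability in \<open>x\<close> does not involve path measures.\<close>

primrec hit_val :: "('a \<Rightarrow> 'a measure) \<Rightarrow> 'a set \<Rightarrow> 'a set \<Rightarrow> nat \<Rightarrow> 'a \<Rightarrow> ennreal" where
  "hit_val K A D 0 x = indicator A x"
| "hit_val K A D (Suc n) x = indicator A x + indicator (D - A) x * (\<integral>\<^sup>+y. hit_val K A D n y \<partial>K x)"

lemma hit_val_measurable:
  assumes K: "K \<in> borel \<rightarrow>\<^sub>M subprob_algebra borel" and A: "A \<in> sets borel" and D: "D \<in> sets borel"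
  shows "hit_val K A D n \<in> borel_measurable borel"
proof (induction n)
  case 0 then show ?case using A by (simp add: borel_measurable_indicator)
next
  case (Suc n)
  note [measurable] = A D measurable_compose[OF K nn_integral_measurable_subprob_algebra[OF Suc]]
  show ?case unfolding hit_val.simps by measurable
qed

lemma hit_val_le_1:
  assumes "\<And>x. prob_space (K x)"
  shows "hit_val K A D n x \<le> 1"
proof (induction n arbitrary: x)
  case 0 then show ?case by (simp add: indicator_def)
next
  case (Suc n)
  have "(\<integral>\<^sup>+y. hit_val K A D n y \<partial>K x) \<le> (\<integral>\<^sup>+y. 1 \<partial>K x)" by (intro nn_integral_mono Suc)
  also have "\<dots> = 1" using prob_space.emeasure_space_1[OF assms] by simp
  finally show ?case by (auto simp: indicator_def)
qed

lemma hit_val_incseq: "incseq (\<lambda>n x. hit_val K A D n x)"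
proof (rule incseq_SucI, rule le_funI)
  fix n x show "hit_val K A D n x \<le> hit_val K A D (Suc n) x"
  proof (induction n arbitrary: x)
    case 0 then show ?case by simp
  next
    case (Suc n)
    then show ?case unfolding hit_val.simps(2)[of _ _ _ n] hit_val.simps(2)[of _ _ _ "Suc n"]
      by (intro add_left_mono mult_left_mono nn_integral_mono) auto
  qed
qed

text \<open>Outside \<open>A\<close> the recursion passes to the limit by monotone convergence. On
  \<open>A\<close> the value is already 1, the largest possible mean, so the inequality holds there
  too.\<close>

lemma SUP_hit_val_supermean:
  assumes K: "K \<in> borel \<rightarrow>\<^sub>M subprob_algebra borel" "\<And>x. prob_space (K x)"
    and A: "A \<in> sets borel" and D: "D \<in> sets borel" and x: "x \<in> D"
  shows "(\<integral>\<^sup>+y. (SUP n. hit_val K A D n y) \<partial>K x) \<le> (SUP n. hit_val K A D n x)"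
proof -
  have s: "sets (K x) = sets borel"
    using measurable_space[OF K(1), of x] by (auto simp: space_subprob_algebra)
  have m: "hit_val K A D n \<in> borel_measurable (K x)" for n
    using hit_val_measurable[OF K(1) A D] s by (auto cong: measurable_cong_sets)
  have eq: "(\<integral>\<^sup>+y. (SUP n. hit_val K A D n y) \<partial>K x) = (SUP n. \<integral>\<^sup>+y. hit_val K A D n y \<partial>K x)"
    using hit_val_incseq m by (intro nn_integral_monotone_convergence_SUP) auto
  show ?thesis
    unfolding eq
  proof (rule SUP_least)
    fix n
    show "(\<integral>\<^sup>+y. hit_val K A D n y \<partial>K x) \<le> (SUP n. hit_val K A D n x)"
    proof (cases "x \<in> A")
      case True
      have "(\<integral>\<^sup>+y. hit_val K A D n y \<partial>K x) \<le> (\<integral>\<^sup>+y. 1 \<partial>K x)"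
        by (intro nn_integral_mono hit_val_le_1 K)
      also have "\<dots> = hit_val K A D 0 x" using prob_space.emeasure_space_1[OF K(2)] True by simp
      also have "\<dots> \<le> (SUP n. hit_val K A D n x)" by (intro SUP_upper) simp
      finally show ?thesis .
    next
      case False
      then have "(\<integral>\<^sup>+y. hit_val K A D n y \<partial>K x) = hit_val K A D (Suc n) x" using x by simp
      also have "\<dots> \<le> (SUP n. hit_val K A D n x)" by (intro SUP_upper) simp
      finally show ?thesis .
    qed
  qed
qed

section \<open>The Markov property and the decomposition by the time of entrance\<close>

lemma space_past: "space (past k) = UNIV"
  by (simp add: past_def)

lemma past_coordinate: "j \<le> k \<Longrightarrow> (\<lambda>\<omega>. \<omega> j) \<in> past k \<rightarrow>\<^sub>M borel"
proof -
  assume j: "j \<le> k"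
  have "(\<lambda>\<omega> :: nat \<Rightarrow> real ^ 'a. restrict \<omega> {..k}) \<in> past k \<rightarrow>\<^sub>M PiM {..k} (\<lambda>_. borel)"
    unfolding past_def by (rule measurable_vimage_algebra1) (auto simp: space_PiM)
  from measurable_compose[OF this measurable_component_singleton[of j "{..k}"]] j show ?thesis by simp
qed

lemma subalgebra_past:
  fixes P :: "(nat \<Rightarrow> real ^ 'n) measure"
  assumes P: "sets P = sets path_space"
  shows "subalgebra P (past k)"
proof -
  have sP: "space P = UNIV" using sets_eq_imp_space_eq[OF P] by (simp add: space_PiM)
  have r: "(\<lambda>\<omega>. restrict \<omega> {..k}) \<in> P \<rightarrow>\<^sub>M PiM {..k} (\<lambda>_. borel)"
    unfolding measurable_cong_sets[OF P refl] by (rule measurable_restrict_subset) simp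
  show ?thesis
    unfolding subalgebra_def
  proof
    show "space (past k) = space P" by (simp add: space_past sP)
    have "sets (past k) = {(\<lambda>\<omega> :: nat \<Rightarrow> real ^ 'n. restrict \<omega> {..k}) -` B |B. B \<in> sets (PiM {..k} (\<lambda>_. borel))}"
      unfolding past_def by (subst sets_vimage_algebra2) (auto simp: space_PiM)
    then show "sets (past k) \<subseteq> sets P" using measurable_sets[OF r] by (auto simp: sP)
  qed
qed

text \<open>The Markov property in integrated form. The exceptional null set in the conditional
  probability depends on \<open>E\<close>, so the passage from sets to functions is made after
  integrating over \<open>S\<close>, where null sets no longer matter.\<close>

lemma chain_law_step:
  fixes K :: "real ^ 'n \<Rightarrow> (real ^ 'n) measure"
  assumes P: "chain_law \<alpha> \<beta> \<epsilon> \<nu> x P"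
    and K: "K \<in> borel \<rightarrow>\<^sub>M subprob_algebra borel" "\<And>y. prob_space (K y)"
      "\<And>y E. E \<in> sets borel \<Longrightarrow> measure (K y) E = transition_prob \<alpha> \<beta> \<epsilon> \<nu> y E"
    and S: "S \<in> sets (past k)" and f: "f \<in> borel_measurable borel"
  shows "(\<integral>\<^sup>+\<omega>. indicator S \<omega> * f (\<omega> (Suc k)) \<partial>P) = (\<integral>\<^sup>+\<omega>. indicator S \<omega> * (\<integral>\<^sup>+z. f z \<partial>K (\<omega> k)) \<partial>P)"
proof -
  have Pp: "prob_space P" and sP: "sets P = sets path_space"
    and ce: "\<And>E. E \<in> sets borel \<Longrightarrow> AE \<omega> in P. real_cond_exp P (past k) (indicator {\<omega>. \<omega> (Suc k) \<in> E}) \<omega>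
            = transition_prob \<alpha> \<beta> \<epsilon> \<nu> (\<omega> k) E"
    using P by (auto simp: chain_law_def)
  interpret P: prob_space P by (rule Pp)
  have sub: "subalgebra P (past k)" by (rule subalgebra_past[OF sP])
  interpret F: finite_measure_subalgebra P "past k" by standard (rule sub)
  have spP: "space P = UNIV" using sets_eq_imp_space_eq[OF sP] by (simp add: space_PiM)
  have pc[measurable]: "(\<lambda>\<omega>. \<omega> j) \<in> P \<rightarrow>\<^sub>M borel" for j
    using measurable_component_singleton[of j UNIV "\<lambda>_. borel"] measurable_cong_sets[OF sP refl] by blast
  have SP[measurable]: "S \<in> sets P" using S sub unfolding subalgebra_def by blast
  note [measurable] = K(1)
  have sK: "sets (K y) = sets borel" for y
    using measurable_space[OF K(1), of y] by (auto simp: space_subprob_algebra)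
  have Km: "(\<lambda>\<omega>. \<integral>\<^sup>+z. g z \<partial>K (\<omega> k)) \<in> borel_measurable P" if g: "g \<in> borel_measurable borel" for g
    by (rule measurable_compose[OF pc measurable_compose[OF K(1) nn_integral_measurable_subprob_algebra[OF g]]])
  have gK: "g \<in> borel_measurable (K y)" if "g \<in> borel_measurable borel" for g :: "real ^ 'n \<Rightarrow> ennreal" and y
    using that sK by (auto cong: measurable_cong_sets)
  show ?thesis
    using f
  proof (induction rule: borel_measurable_induct)
    case (cong f g)
    then have "f = g" by auto
    with cong show ?case by simp
  next
    case (set E)
    then have E[measurable]: "E \<in> sets borel" by simp
    let ?I = "{\<omega>. \<omega> (Suc k) \<in> E}"
    have Im: "?I \<in> sets P" using measurable_sets[OF pc E, of "Suc k"] by (simp add: spP vimage_def)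
    have le1: "measure (K y) E \<le> 1" for y by (rule prob_space.prob_le_1[OF K(2)])
    have gi: "integrable P (\<lambda>\<omega>. indicator S \<omega> * measure (K (\<omega> k)) E)"
      by (rule P.integrable_const_bound[where B=1]) (auto simp: le1 indicator_def)
    have "measure P (S \<inter> ?I) = (\<integral>\<omega>\<in>S. indicator ?I \<omega> \<partial>P)"
      unfolding set_lebesgue_integral_def using SP Im spP by (simp add: indicator_inter_arith[symmetric])
    also have "\<dots> = (\<integral>\<omega>\<in>S. real_cond_exp P (past k) (indicator ?I) \<omega> \<partial>P)"
      using Im by (intro F.real_cond_exp_intA S) (simp add: P.emeasure_eq_measure)
    also have "\<dots> = (\<integral>\<omega>\<in>S. measure (K (\<omega> k)) E \<partial>P)"
      unfolding set_lebesgue_integral_def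
    proof (rule integral_cong_AE)
      show "AE \<omega> in P. indicat_real S \<omega> *\<^sub>R real_cond_exp P (past k) (indicator ?I) \<omega> = indicat_real S \<omega> *\<^sub>R measure (K (\<omega> k)) E"
        using ce[OF E] by eventually_elim (simp add: K(3)[OF E])
    qed measurable
    finally have "emeasure P (S \<inter> ?I) = ennreal (\<integral>\<omega>. indicator S \<omega> * measure (K (\<omega> k)) E \<partial>P)"
      by (simp add: P.emeasure_eq_measure set_lebesgue_integral_def)
    also have "\<dots> = (\<integral>\<^sup>+\<omega>. ennreal (indicator S \<omega> * measure (K (\<omega> k)) E) \<partial>P)"
      by (rule nn_integral_eq_integral[symmetric, OF gi]) auto
    also have "\<dots> = (\<integral>\<^sup>+\<omega>. indicator S \<omega> * ennreal (measure (K (\<omega> k)) E) \<partial>P)"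
      by (intro nn_integral_cong) (auto simp: indicator_def)
    also have "\<dots> = (\<integral>\<^sup>+\<omega>. indicator S \<omega> * (\<integral>\<^sup>+z. indicator E z \<partial>K (\<omega> k)) \<partial>P)"
      using E by (simp add: sK finite_measure.emeasure_eq_measure[OF prob_space.finite_measure[OF K(2)]])
    also have "emeasure P (S \<inter> ?I) = (\<integral>\<^sup>+\<omega>. indicator S \<omega> * indicator E (\<omega> (Suc k)) \<partial>P)"
    proof -
      have "(\<lambda>\<omega>. indicator S \<omega> * indicator E (\<omega> (Suc k)) :: ennreal) = indicator (S \<inter> ?I)"
        by (auto simp: indicator_def)
      then show ?thesis using SP Im by simp
    qed
    finally show ?case .
  next
    case (mult f c)
    have "(\<integral>\<^sup>+\<omega>. indicator S \<omega> * (c * f (\<omega> (Suc k))) \<partial>P) = c * (\<integral>\<^sup>+\<omega>. indicator S \<omega> * f (\<omega> (Suc k)) \<partial>P)"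
      using mult(2) by (subst nn_integral_cmult[symmetric]) (auto simp: mult.left_commute)
    also have "\<dots> = c * (\<integral>\<^sup>+\<omega>. indicator S \<omega> * (\<integral>\<^sup>+z. f z \<partial>K (\<omega> k)) \<partial>P)" by (simp add: mult)
    also have "\<dots> = (\<integral>\<^sup>+\<omega>. indicator S \<omega> * (\<integral>\<^sup>+z. c * f z \<partial>K (\<omega> k)) \<partial>P)"
      using Km[OF mult(2)] gK[OF mult(2)]
      by (subst nn_integral_cmult[symmetric]) (auto simp: nn_integral_cmult mult.left_commute)
    finally show ?case .
  next
    case (add f g)
    note [measurable] = add(1,3) Km[OF add(1)] Km[OF add(3)]
    show ?case
      using add gK[OF add(1)] gK[OF add(3)]
      by (simp add: nn_integral_add distrib_left)
  next
    case (seq F)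
    note [measurable] = seq(1) Km[OF seq(1)]
    have "(\<integral>\<^sup>+\<omega>. indicator S \<omega> * (SUP i. F i) (\<omega> (Suc k)) \<partial>P) = (\<integral>\<^sup>+\<omega>. (SUP i. indicator S \<omega> * F i (\<omega> (Suc k))) \<partial>P)"
      by (simp add: SUP_mult_left_ennreal SUP_apply image_comp)
    also have "\<dots> = (SUP i. \<integral>\<^sup>+\<omega>. indicator S \<omega> * F i (\<omega> (Suc k)) \<partial>P)"
      using seq(3) by (intro nn_integral_monotone_convergence_SUP) (auto simp: incseq_def le_fun_def intro!: mult_left_mono)
    also have "\<dots> = (SUP i. \<integral>\<^sup>+\<omega>. indicator S \<omega> * (\<integral>\<^sup>+z. F i z \<partial>K (\<omega> k)) \<partial>P)"
      by (simp add: seq.IH)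
    also have "\<dots> = (\<integral>\<^sup>+\<omega>. (SUP i. indicator S \<omega> * (\<integral>\<^sup>+z. F i z \<partial>K (\<omega> k))) \<partial>P)"
      using seq(3) by (intro nn_integral_monotone_convergence_SUP[symmetric])
        (auto simp: incseq_def le_fun_def intro!: mult_left_mono nn_integral_mono)
    also have "\<dots> = (\<integral>\<^sup>+\<omega>. indicator S \<omega> * (\<integral>\<^sup>+z. (SUP i. F i) z \<partial>K (\<omega> k)) \<partial>P)"
    proof (rule nn_integral_cong)
      fix \<omega> show "(SUP i. indicator S \<omega> * (\<integral>\<^sup>+z. F i z \<partial>K (\<omega> k))) = indicator S \<omega> * (\<integral>\<^sup>+z. (SUP i. F i) z \<partial>K (\<omega> k))"
        unfolding SUP_apply using seq(3) gK[OF seq(1)]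
        by (subst nn_integral_monotone_convergence_SUP) (auto simp: SUP_mult_left_ennreal)
    qed
    finally show ?case .
  qed
qed

lemma Inf_enat_image: "S \<noteq> {} \<Longrightarrow> Inf (enat ` S) = enat (LEAST k. k \<in> S)"
  by (intro antisym Inf_lower Inf_greatest imageI) (auto intro: LeastI Least_le)

text \<open>Decomposition by the time of first entrance into \<open>A\<close>. Because
  \<open>A \<subseteq> D\<close>, the chain is still in \<open>D\<close> at that time, so the exit
  comes at least one step later and the comparison is strict.\<close>

lemma hitting_less_exit_eq:
  assumes "A \<subseteq> D"
  shows "{\<omega>. hitting_time A \<omega> < exit_time D \<omega>} = (\<Union>j. {\<omega>. (\<forall>i<j. \<omega> i \<in> D - A) \<and> \<omega> j \<in> A})"
proof (intro set_eqI iffI)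
  fix \<omega> assume "\<omega> \<in> {\<omega>. hitting_time A \<omega> < exit_time D \<omega>}"
  then have lt: "hitting_time A \<omega> < exit_time D \<omega>" by simp
  have ne: "{k. \<omega> k \<in> A} \<noteq> {}"
  proof
    assume "{k. \<omega> k \<in> A} = {}"
    then have "hitting_time A \<omega> = top" unfolding hitting_time_def by (simp only: image_empty Inf_empty)
    then show False using lt by simp
  qed
  define j where "j = (LEAST k. k \<in> {k. \<omega> k \<in> A})"
  have j: "hitting_time A \<omega> = enat j" unfolding hitting_time_def j_def by (rule Inf_enat_image[OF ne])
  have jA: "\<omega> j \<in> A" using ne LeastI[of "\<lambda>k. \<omega> k \<in> A"] by (auto simp: j_def)
  have "\<omega> i \<in> D - A" if i: "i < j" for i
  proof
    show "\<omega> i \<notin> A" using not_less_Least[of i "\<lambda>k. \<omega> k \<in> A"] i by (simp add: j_def)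
    show "\<omega> i \<in> D"
    proof (rule ccontr)
      assume "\<omega> i \<notin> D"
      then have "exit_time D \<omega> \<le> enat i" unfolding exit_time_def by (intro Inf_lower) auto
      also have "\<dots> < enat j" using i by simp
      finally show False using lt j by simp
    qed
  qed
  with jA show "\<omega> \<in> (\<Union>j. {\<omega>. (\<forall>i<j. \<omega> i \<in> D - A) \<and> \<omega> j \<in> A})" by blast
next
  fix \<omega> :: "nat \<Rightarrow> 'a" assume "\<omega> \<in> (\<Union>j. {\<omega>. (\<forall>i<j. \<omega> i \<in> D - A) \<and> \<omega> j \<in> A})"
  then obtain j where j: "\<forall>i<j. \<omega> i \<in> D - A" "\<omega> j \<in> A" by blast
  have "hitting_time A \<omega> \<le> enat j" unfolding hitting_time_def using j by (intro Inf_lower) auto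
  also have "enat j < enat (Suc j)" by simp
  also have "enat (Suc j) \<le> exit_time D \<omega>"
    unfolding exit_time_def
  proof (rule Inf_greatest)
    fix n assume "n \<in> enat ` {k. \<omega> k \<notin> D}"
    then obtain k where k: "n = enat k" "\<omega> k \<notin> D" by blast
    then have "j < k" using j assms by (metis DiffD1 linorder_neqE_nat subsetD)
    then show "enat (Suc j) \<le> n" by (simp add: k)
  qed
  finally show "\<omega> \<in> {\<omega>. hitting_time A \<omega> < exit_time D \<omega>}" by simp
qed

lemma hit_val_le_prob:
  fixes K :: "real ^ 'n \<Rightarrow> (real ^ 'n) measure"
  assumes P: "chain_law \<alpha> \<beta> \<epsilon> \<nu> x P"
    and K: "K \<in> borel \<rightarrow>\<^sub>M subprob_algebra borel" "\<And>y. prob_space (K y)"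
      "\<And>y E. E \<in> sets borel \<Longrightarrow> measure (K y) E = transition_prob \<alpha> \<beta> \<epsilon> \<nu> y E"
    and A: "A \<in> sets borel" and D: "D \<in> sets borel" and AD: "A \<subseteq> D"
  shows "hit_val K A D n x \<le> emeasure P {\<omega>. hitting_time A \<omega> < exit_time D \<omega>}"
proof -
  have Pp: "prob_space P" and sP: "sets P = sets path_space" and x: "AE \<omega> in P. \<omega> 0 = x"
    using P by (auto simp: chain_law_def)
  interpret P: prob_space P by (rule Pp)
  have spP: "space P = UNIV" using sets_eq_imp_space_eq[OF sP] by (simp add: space_PiM)
  have pc[measurable]: "(\<lambda>\<omega>. \<omega> j) \<in> P \<rightarrow>\<^sub>M borel" for j
    using measurable_component_singleton[of j UNIV "\<lambda>_. borel"] measurable_cong_sets[OF sP refl] by blast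
  note [measurable] = A D
  \<comment> \<open>The shift of index matters: \<open>V (Suc k)\<close> involves the times up to
    \<open>k\<close> only, so it belongs to \<open>past k\<close> and can serve as the set
    \<open>S\<close> in \<open>chain_law_step\<close>. \<open>V 0\<close> is the whole
    space.\<close>
  define V :: "nat \<Rightarrow> (nat \<Rightarrow> real ^ 'n) set" where "V k = {\<omega>. \<forall>j<k. \<omega> j \<in> D - A}" for k
  have Vpast: "V (Suc k) \<in> sets (past k)" for k
  proof -
    have "{\<omega> \<in> space (past k). \<forall>j\<in>{..k}. \<omega> j \<in> D - A} \<in> sets (past k)"
    proof (rule sets.sets_Collect_finite_All)
      fix j assume "j \<in> {..k}"
      then have "(\<lambda>\<omega>. \<omega> j) -` (D - A) \<inter> space (past k) \<in> sets (past k)"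
        by (intro measurable_sets[OF past_coordinate]) auto
      then show "{\<omega> \<in> space (past k). \<omega> j \<in> D - A} \<in> sets (past k)"
        by (simp add: vimage_def Int_def conj_commute)
    qed simp
    then show ?thesis by (simp add: V_def space_past less_Suc_eq_le Ball_def)
  qed
  have VP: "V k \<in> sets P" for k
  proof (cases k)
    case 0 then show ?thesis using sets.top[of P] by (simp add: V_def spP)
  next
    case (Suc j)
    then show ?thesis using Vpast[of j] subalgebra_past[OF sP, of j] by (auto simp: subalgebra_def)
  qed
  define H where "H k = V k \<inter> {\<omega>. \<omega> k \<in> A}" for k
  have HP: "H k \<in> sets P" for k
    using measurable_sets[OF pc A, of k] VP[of k] by (simp add: H_def spP vimage_def)
  have first: "(\<integral>\<^sup>+\<omega>. indicator (V k) \<omega> * indicator A (\<omega> k) \<partial>P) = emeasure P (H k)" for k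
  proof -
    have "(\<lambda>\<omega>. indicator (V k) \<omega> * indicator A (\<omega> k) :: ennreal) = indicator (H k)"
      by (auto simp: indicator_def H_def)
    then show ?thesis using HP by simp
  qed
  \<comment> \<open>With \<open>m\<close> steps left at time \<open>k\<close>, either the chain is
    in \<open>A\<close> now, which contributes \<open>H k\<close>, or it is in \<open>D - A\<close>.
    In the second case the indicator becomes that of \<open>V (Suc k)\<close>, and the Markov
    property moves the remaining value to time \<open>k + 1\<close>.\<close>
  have sum: "(\<integral>\<^sup>+\<omega>. indicator (V k) \<omega> * hit_val K A D m (\<omega> k) \<partial>P) = (\<Sum>j\<in>{k..k + m}. emeasure P (H j))" for k m
  proof (induction m arbitrary: k)
    case 0 then show ?case by (simp add: first)
  next
    case (Suc m)
    have hm: "hit_val K A D m \<in> borel_measurable borel" by (rule hit_val_measurable[OF K(1) A D])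
    have [measurable]: "(\<lambda>\<omega>. \<integral>\<^sup>+z. hit_val K A D m z \<partial>K (\<omega> k)) \<in> borel_measurable P"
      by (rule measurable_compose[OF pc measurable_compose[OF K(1) nn_integral_measurable_subprob_algebra[OF hm]]])
    have "indicator (V k) \<omega> * hit_val K A D (Suc m) (\<omega> k)
        = indicator (V k) \<omega> * indicator A (\<omega> k) + indicator (V (Suc k)) \<omega> * (\<integral>\<^sup>+z. hit_val K A D m z \<partial>K (\<omega> k))" for \<omega>
      by (auto simp: indicator_def V_def less_Suc_eq)
    then have "(\<integral>\<^sup>+\<omega>. indicator (V k) \<omega> * hit_val K A D (Suc m) (\<omega> k) \<partial>P)
        = (\<integral>\<^sup>+\<omega>. indicator (V k) \<omega> * indicator A (\<omega> k) \<partial>P)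
          + (\<integral>\<^sup>+\<omega>. indicator (V (Suc k)) \<omega> * (\<integral>\<^sup>+z. hit_val K A D m z \<partial>K (\<omega> k)) \<partial>P)"
      using VP by (simp add: nn_integral_add)
    also have "\<dots> = emeasure P (H k) + (\<Sum>j\<in>{Suc k..Suc k + m}. emeasure P (H j))"
      unfolding first Suc.IH[symmetric] using chain_law_step[OF P K Vpast hm] by simp
    also have "\<dots> = (\<Sum>j\<in>{k..k + Suc m}. emeasure P (H j))"
      by (simp add: sum.atLeast_Suc_atMost[of k])
    finally show ?case .
  qed
  have "hit_val K A D n x = (\<integral>\<^sup>+\<omega>. hit_val K A D n x \<partial>P)"
    using P.emeasure_space_1 by simp
  also have "\<dots> = (\<integral>\<^sup>+\<omega>. indicator (V 0) \<omega> * hit_val K A D n (\<omega> 0) \<partial>P)"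
    using x by (intro nn_integral_cong_AE) (auto simp: V_def)
  also have "\<dots> = (\<Sum>j\<in>{0..n}. emeasure P (H j))" using sum[of 0 n] by simp
  also have "\<dots> = emeasure P (\<Union>j\<in>{0..n}. H j)"
  proof (rule sum_emeasure)
    show "disjoint_family_on H {0..n}"
      unfolding disjoint_family_on_def H_def V_def
      by (safe, metis (no_types, lifting) DiffD2 linorder_neqE_nat mem_Collect_eq)
  qed (use HP in auto)
  also have "\<dots> \<le> emeasure P {\<omega>. hitting_time A \<omega> < exit_time D \<omega>}"
  proof (rule emeasure_mono)
    have eq: "{\<omega>. hitting_time A \<omega> < exit_time D \<omega>} = (\<Union>j. H j)"
      unfolding hitting_less_exit_eq[OF AD] H_def V_def by auto
    show "(\<Union>j\<in>{0..n}. H j) \<subseteq> {\<omega>. hitting_time A \<omega> < exit_time D \<omega>}" unfolding eq by auto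
    show "{\<omega>. hitting_time A \<omega> < exit_time D \<omega>} \<in> sets P" unfolding eq using HP by auto
  qed
  finally show ?thesis .
qed

text \<open>Bridge from probability to analysis: \<open>u\<close> is the limit of the value
  iteration, and at each point \<open>y\<close> of \<open>D\<close> the measure demanded by
  \<open>supersol\<close> is \<open>\<nu> y\<close> itself.\<close>

lemma (in increments) exists_supersol_le_prob:
  fixes \<nu> :: "real ^ 'n \<Rightarrow> (real ^ 'n) measure"
  assumes adm: "admissible \<Lambda> \<nu>" and \<epsilon>: "0 < \<epsilon>" and P: "chain_law \<alpha> \<beta> \<epsilon> \<nu> x P"
    and A: "A \<in> sets borel" and D: "D \<in> sets borel" and AD: "A \<subseteq> D"
  shows "\<exists>u. supersol \<epsilon> D u \<and> (\<forall>y\<in>A. 1 \<le> u y) \<and> u x \<le> measure P {\<omega>. hitting_time A \<omega> < exit_time D \<omega>}"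
proof -
  have b: "0 \<le> \<beta>" using \<beta> by simp
  obtain K where K: "K \<in> borel \<rightarrow>\<^sub>M subprob_algebra borel" "\<And>y. prob_space (K y)"
      "\<And>y E. E \<in> sets borel \<Longrightarrow> measure (K y) E = transition_prob \<alpha> \<beta> \<epsilon> \<nu> y E"
    using transition_kernel_exists[OF adm b \<beta>(2) \<alpha> \<epsilon>] by blast
  have sK: "sets (K y) = sets borel" for y
    using measurable_space[OF K(1), of y] by (auto simp: space_subprob_algebra)
  have \<nu>: "\<nu> y \<in> symmetric_measures \<Lambda>" for y using adm by (simp add: admissible_def)
  interpret P: prob_space P using P by (simp add: chain_law_def)
  define g where "g y = (SUP n. hit_val K A D n y)" for y
  have gm[measurable]: "g \<in> borel_measurable borel"
    unfolding g_def using hit_val_measurable[OF K(1) A D] by measurable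
  have g1: "g y \<le> 1" for y unfolding g_def by (intro SUP_least hit_val_le_1 K)
  define u where "u y = enn2real (g y)" for y
  have gu: "ennreal (u y) = g y" for y
    unfolding u_def using g1[of y] by (intro ennreal_enn2real) (auto simp: less_top[symmetric] top_unique)
  have u01: "0 \<le> u y" "u y \<le> 1" for y
  proof -
    show "0 \<le> u y" by (simp add: u_def)
    have "ennreal (u y) \<le> ennreal 1" using g1[of y] by (simp add: gu)
    then show "u y \<le> 1" by (simp add: ennreal_le_iff)
  qed
  have um[measurable]: "u \<in> borel_measurable borel" unfolding u_def by measurable
  have nni: "(\<integral>\<^sup>+z. g (y + \<epsilon> *\<^sub>R z) \<partial>\<mu>) = ennreal (\<integral>z. u (y + \<epsilon> *\<^sub>R z) \<partial>\<mu>)"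
    if \<mu>: "\<mu> \<in> symmetric_measures L" for \<mu> y L
    unfolding gu[symmetric] using u01
    by (intro nn_integral_eq_integral integrable_symmetric_measure[OF \<mu>, where B=1]) auto
  have "step_mean \<alpha> \<beta> \<epsilon> (\<nu> y) u y \<le> u y" if y: "y \<in> D" for y
  proof -
    have i0: "0 \<le> (\<integral>z. u (y + \<epsilon> *\<^sub>R z) \<partial>\<mu>)" for \<mu> by (intro Bochner_Integration.integral_nonneg u01)
    have "(\<integral>\<^sup>+z. g z \<partial>K y) = ennreal \<alpha> * (\<integral>\<^sup>+z. g (y + \<epsilon> *\<^sub>R z) \<partial>\<nu> y) + ennreal \<beta> * (\<integral>\<^sup>+z. g (y + \<epsilon> *\<^sub>R z) \<partial>unif_ball)"
      by (rule nn_integral_kernel[OF \<nu> b \<beta>(2) \<alpha> \<epsilon> K(2) sK K(3) gm])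
    moreover have "0 \<le> \<alpha>" using \<alpha> \<beta> by simp
    ultimately have "ennreal (step_mean \<alpha> \<beta> \<epsilon> (\<nu> y) u y) = (\<integral>\<^sup>+z. g z \<partial>K y)"
      unfolding nni[OF \<nu>] nni[OF unif_ball_symmetric]
      using b i0 by (simp add: step_mean_def ennreal_mult ennreal_plus)
    also have "\<dots> \<le> g y" unfolding g_def by (rule SUP_hit_val_supermean[OF K(1,2) A D y])
    finally show ?thesis unfolding gu[symmetric] using u01 by (simp add: ennreal_le_iff)
  qed
  moreover have "bdd_above (range u)" by (rule bdd_aboveI2[where M=1]) (rule u01)
  ultimately have "supersol \<epsilon> D u"
    using u01(1) um \<nu> unfolding supersol_def by blast
  moreover have "1 \<le> u y" if "y \<in> A" for y
  proof -
    have "1 = hit_val K A D 0 y" using that by simp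
    also have "\<dots> \<le> g y" unfolding g_def by (intro SUP_upper) simp
    finally have "ennreal 1 \<le> ennreal (u y)" by (simp add: gu)
    then show ?thesis using u01(1)[of y] by (simp only: ennreal_le_iff)
  qed
  moreover have "u x \<le> measure P {\<omega>. hitting_time A \<omega> < exit_time D \<omega>}"
  proof -
    have "ennreal (u x) \<le> emeasure P {\<omega>. hitting_time A \<omega> < exit_time D \<omega>}"
      unfolding gu g_def by (intro SUP_least hit_val_le_prob[OF P K A D AD])
    then show ?thesis by (simp add: P.emeasure_eq_measure)
  qed
  ultimately show ?thesis by blast
qed

section \<open>One monotone bound for all chains\<close>

lemma mono_minorant:
  fixes F :: "(real \<times> real) set"
  assumes "\<And>\<delta>. 0 < \<delta> \<Longrightarrow> \<exists>c>0. \<forall>(a, p)\<in>F. \<delta> \<le> a \<longrightarrow> c \<le> p"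
  shows "\<exists>\<phi> :: real \<Rightarrow> real. \<phi> \<in> {0<..1} \<rightarrow> {0<..<1} \<and> mono_on {0<..1} \<phi> \<and> (\<forall>(a, p)\<in>F. 0 < a \<longrightarrow> \<phi> a < p)"
proof -
  \<comment> \<open>\<open>S t\<close> collects the lower bounds valid for all pairs with first
    entry at least \<open>t\<close>, so it grows with \<open>t\<close> and its supremum is monotone.
    The cap at 1 keeps it bounded even if no pair qualifies; halving the supremum makes the final
    inequality strict and the value less than 1.\<close>
  define S where "S t = {c. 0 \<le> c \<and> c \<le> 1 \<and> (\<forall>(a, p)\<in>F. t \<le> a \<longrightarrow> c \<le> p)}" for t :: real
  have bdd: "bdd_above (S t)" for t by (rule bdd_aboveI[of _ 1]) (simp add: S_def)
  have pos: "\<exists>c\<in>S t. 0 < c" if t: "0 < t" for t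
  proof -
    obtain c where "0 < c" "\<forall>(a, p)\<in>F. t \<le> a \<longrightarrow> c \<le> p" using assms[OF t] by blast
    then show ?thesis by (intro bexI[of _ "min c 1"]) (auto simp: S_def)
  qed
  have Sup_pos: "0 < Sup (S t)" if t: "0 < t" for t
    using pos[OF t] cSup_upper[OF _ bdd] by (meson less_le_trans)
  have Sup_le: "Sup (S t) \<le> 1" if t: "0 < t" for t
    using pos[OF t] by (intro cSup_least) (auto simp: S_def)
  show ?thesis
  proof (intro exI[of _ "\<lambda>t. Sup (S t) / 2"] conjI)
    show "(\<lambda>t. Sup (S t) / 2) \<in> {0<..1} \<rightarrow> {0<..<1}"
      using Sup_pos Sup_le by (fastforce intro: le_less_trans)
    show "mono_on {0<..1} (\<lambda>t. Sup (S t) / 2)"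
    proof (intro mono_onI divide_right_mono cSup_subset_mono bdd)
      fix r s :: real assume "r \<in> {0<..1}" "r \<le> s"
      then show "S r \<noteq> {}" "S r \<subseteq> S s" using pos[of r] by (auto simp: S_def)
    qed simp
    show "\<forall>(a, p)\<in>F. 0 < a \<longrightarrow> Sup (S a) / 2 < p"
    proof (intro ballI, clarify)
      fix a p assume F: "(a, p) \<in> F" and a: "0 < a"
      have "Sup (S a) \<le> p" using pos[OF a] F by (intro cSup_least) (auto simp: S_def)
      then show "Sup (S a) / 2 < p" using Sup_pos[OF a] by linarith
    qed
  qed
qed

theorem theorem5p7:
  fixes \<Lambda> \<alpha> \<beta> :: real
  assumes "1 \<le> \<Lambda>" and "0 < \<beta>" and "\<beta> \<le> 1" and "\<alpha> = 1 - \<beta>"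
  shows "\<exists>\<epsilon>\<^sub>0 > 0. \<exists>\<phi> :: real \<Rightarrow> real.
    \<phi> \<in> {0<..1} \<rightarrow> {0<..<1} \<and> mono_on {0<..1} \<phi> \<and>
    (\<forall>(\<nu> :: real ^ 'n \<Rightarrow> (real ^ 'n) measure) \<epsilon> A x P.
       admissible \<Lambda> \<nu> \<longrightarrow> 0 < \<epsilon> \<longrightarrow> \<epsilon> < \<epsilon>\<^sub>0 \<longrightarrow>
       A \<in> sets borel \<longrightarrow> A \<subseteq> cube 1 \<longrightarrow> 0 < measure lborel A \<longrightarrow> x \<in> cube 1 \<longrightarrow>
       chain_law \<alpha> \<beta> \<epsilon> \<nu> x P \<longrightarrow>
       measure P {\<omega>. hitting_time A \<omega> < exit_time (cube (10 * sqrt (real CARD('n)))) \<omega>}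
         > \<phi> (measure lborel A))"
proof -
  interpret increments \<Lambda> \<alpha> \<beta> by unfold_locales (use assms in auto)
  let ?D = "cube (10 * sqrt (real CARD('n))) :: (real ^ 'n) set"
  let ?hit = "\<lambda>A. {\<omega>. hitting_time A \<omega> < exit_time ?D \<omega>}"
  obtain \<epsilon>0 where \<epsilon>0: "0 < \<epsilon>0" and bound: "\<And>\<delta>. 0 < \<delta> \<Longrightarrow> \<exists>c>0. \<forall>\<epsilon> (u :: real ^ 'n \<Rightarrow> real) A.
     0 < \<epsilon> \<longrightarrow> \<epsilon> < \<epsilon>0 \<longrightarrow> supersol \<epsilon> (ball 0 (5 * sqrt (real CARD('n)))) u \<longrightarrow> A \<in> sets borel \<longrightarrow> (\<forall>y\<in>A. 1 \<le> u y)
     \<longrightarrow> \<delta> \<le> measure lborel (A \<inter> unit_hcube) \<longrightarrow> (\<forall>x\<in>unit_hcube. c \<le> u x)"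
    using supersol_lower_bound[where 'n='n] by blast
  \<comment> \<open>All admissible families, step sizes below the threshold, sets, starting points
    and laws enter a single set of pairs, so the function obtained from it can depend only on the
    dimension and the fixed parameters.\<close>
  define F where "F = {(measure lborel A, measure P (?hit A)) |(\<nu> :: real ^ 'n \<Rightarrow> (real ^ 'n) measure) \<epsilon> A x P.
    admissible \<Lambda> \<nu> \<and> 0 < \<epsilon> \<and> \<epsilon> < \<epsilon>0 \<and> A \<in> sets borel \<and> A \<subseteq> cube 1 \<and> x \<in> cube 1 \<and> chain_law \<alpha> \<beta> \<epsilon> \<nu> x P}"
  have cube_unit: "cube 1 \<subseteq> (unit_hcube :: (real ^ 'n) set)"
  proof
    fix y :: "real ^ 'n" assume y: "y \<in> cube 1"
    show "y \<in> unit_hcube"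
      unfolding hcube_def
    proof (intro CollectI allI)
      fix i
      have "\<bar>y $ i\<bar> < 1 / 2" using y by (simp add: cube_def)
      then show "(\<chi> i. - (1 / 2)) $ i \<le> y $ i \<and> y $ i < (\<chi> i. - (1 / 2)) $ i + 1"
        unfolding vec_lambda_beta by linarith
    qed
  qed
  have N: "1 \<le> sqrt (real CARD('n))" by (simp add: Suc_le_eq)
  have cube_D: "cube 1 \<subseteq> ?D"
  proof
    fix y :: "real ^ 'n" assume y: "y \<in> cube 1"
    have "\<bar>y $ i\<bar> < 10 * sqrt (real CARD('n)) / 2" for i
    proof -
      have "\<bar>y $ i\<bar> < 1 / 2" using y by (simp add: cube_def)
      then show ?thesis using N by linarith
    qed
    then show "y \<in> ?D" by (simp add: cube_def)
  qed
  have ball_D: "ball 0 (5 * sqrt (real CARD('n))) \<subseteq> ?D"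
  proof
    fix y :: "real ^ 'n" assume "y \<in> ball 0 (5 * sqrt (real CARD('n)))"
    then have "\<bar>y $ i\<bar> < 10 * sqrt (real CARD('n)) / 2" for i
      using component_le_norm_cart[of y i] by simp
    then show "y \<in> ?D" by (simp add: cube_def)
  qed
  have D: "?D \<in> sets borel"
  proof -
    have "?D = (\<Inter>i. {y. \<bar>y $ i\<bar> < 10 * sqrt (real CARD('n)) / 2})" by (auto simp: cube_def)
    also have "\<dots> \<in> sets borel"
      by (intro borel_open open_INT ballI open_Collect_less continuous_intros) auto
    finally show ?thesis .
  qed
  have "\<exists>c>0. \<forall>(a, p)\<in>F. \<delta> \<le> a \<longrightarrow> c \<le> p" if \<delta>: "0 < \<delta>" for \<delta>
  proof -
    obtain c where c: "0 < c" and lb: "\<And>\<epsilon> (u :: real ^ 'n \<Rightarrow> real) A x. 0 < \<epsilon> \<Longrightarrow> \<epsilon> < \<epsilon>0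
       \<Longrightarrow> supersol \<epsilon> (ball 0 (5 * sqrt (real CARD('n)))) u \<Longrightarrow> A \<in> sets borel \<Longrightarrow> (\<forall>y\<in>A. 1 \<le> u y)
       \<Longrightarrow> \<delta> \<le> measure lborel (A \<inter> unit_hcube) \<Longrightarrow> x \<in> unit_hcube \<Longrightarrow> c \<le> u x"
      using bound[OF \<delta>] by metis
    have "c \<le> measure P (?hit A)"
      if H: "admissible \<Lambda> \<nu>" "0 < \<epsilon>" "\<epsilon> < \<epsilon>0" "A \<in> sets borel" "A \<subseteq> cube 1" "x \<in> cube 1"
        "chain_law \<alpha> \<beta> \<epsilon> \<nu> x P" "\<delta> \<le> measure lborel A"
      for \<nu> :: "real ^ 'n \<Rightarrow> (real ^ 'n) measure" and \<epsilon> A x P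
    proof -
      have "A \<subseteq> ?D" using H(5) cube_D by blast
      then obtain u where u: "supersol \<epsilon> ?D u" "\<forall>y\<in>A. 1 \<le> u y" "u x \<le> measure P (?hit A)"
        using exists_supersol_le_prob[OF H(1,2,7,4) D] by blast
      have "A \<inter> unit_hcube = A" using H(5) cube_unit by blast
      then have "c \<le> u x"
        using lb[OF H(2,3) supersol_mono[OF u(1) ball_D] H(4) u(2), of x] H(6,8) cube_unit by auto
      then show ?thesis using u(3) by linarith
    qed
    then show ?thesis using c unfolding F_def by (intro exI[of _ c]) auto
  qed
  from mono_minorant[OF this] obtain \<phi> :: "real \<Rightarrow> real" where \<phi>: "\<phi> \<in> {0<..1} \<rightarrow> {0<..<1}" "mono_on {0<..1} \<phi>"
    and F: "\<And>a p. (a, p) \<in> F \<Longrightarrow> 0 < a \<Longrightarrow> \<phi> a < p"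
    by blast
  show ?thesis
  proof (intro exI[of _ \<epsilon>0] exI[of _ \<phi>] conjI \<epsilon>0 \<phi> allI impI)
    fix \<nu> :: "real ^ 'n \<Rightarrow> (real ^ 'n) measure" and \<epsilon> x P and A :: "(real ^ 'n) set"
    assume "admissible \<Lambda> \<nu>" "0 < \<epsilon>" "\<epsilon> < \<epsilon>0" "A \<in> sets borel" "A \<subseteq> cube 1" "0 < measure lborel A" "x \<in> cube 1"
      "chain_law \<alpha> \<beta> \<epsilon> \<nu> x P"
    then have "0 < measure lborel A \<and> (measure lborel A, measure P (?hit A)) \<in> F"
      unfolding F_def by (intro CollectI exI conjI) (assumption | rule refl)+
    then show "\<phi> (measure lborel A) < measure P (?hit A)" using F by blast
  qed
qed

end
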